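(* Let $k$ be a field and let $\Sigma_0\to\Sigma_1\to\cdots\to\Sigma_n$ be a filtration of finite simplicial complexes, i.e. a functor $\Sigma\colon[n]\to\mathbf{SimpComp}$ with $\Sigma_i=\Sigma(i)$. Let $\mathcal{I}\colon[n]^{\mathrm{op}}\to\mathbf{Alg}_k$ be the diagram with $\mathcal{I}(i)=I(\Sigma_i)$ and, for $i\leq j$, the restriction map $I(\Sigma_j)\to I(\Sigma_i)$. Then \[\mathrm{HH}^q_{\mathrm{GS}}(\mathcal{I},\mathcal{I})\cong \mathrm{H}^q(\Sigma_n;k)\] for all $q\geq 0$, where the right side is simplicial cohomology.
   Context: $[n]$ is the category with objects $0,\dots,n$ and a unique morphism $i\to j$ iff $i\le j$. $\mathbf{SimpComp}$ is the category of finite simplicial complexes and injective simplicial maps. For a finite simplicial complex $\Sigma$, its face poset $F(\Sigma)$ is the set of simplices ordered by inclusion, and $I(\Sigma)$ is the incidence algebra of $F(\Sigma)$: the $k$-vector space with basis the pairs $x\le y$ in $F(\Sigma)$ (morphisms of the poset viewed as a category), with product of basis elements equal to their composite when composable and $0$ otherwise. An injective simplicial map $\Sigma_i\to\Sigma_j$ identifies $F(\Sigma_i)$ with a lower ideal of $F(\Sigma_j)$; the restriction map $I(\Sigma_j)\to I(\Sigma_i)$ sends a basis element $x\le y$ to the corresponding basis element if $x,y$ lie in the image of $F(\Sigma_i)$, and to $0$ otherwise. Diagrammatic Hochschild cohomology of a presheaf of algebras $\mathcal{A}\colon\mathbf C^{\mathrm{op}}\to\mathbf{Alg}_k$ with coefficients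 in itself: the cohomology of the total complex of the double complex $C^{p,q}=\prod_\sigma\mathrm{Hom}_k(\mathcal{A}(c_p)^{\otimes q},\mathcal{A}(c_0))$ over strings $\sigma=(c_0\to\cdots\to c_p)$ of composable morphisms, with Hochschild differential in $q$ and simplicial differential $(d\Gamma)^\sigma=\mathcal{A}(c_0\to c_1)\circ\Gamma^{\partial_0\sigma}+\sum_{r=1}^{p-1}(-1)^r\Gamma^{\partial_r\sigma}+(-1)^p\Gamma^{\partial_p\sigma}\circ\mathcal{A}(c_{p-1}\to c_p)^{\otimes q}$ in $p$ ($\partial_r$ deletes $c_r$). *)

theory Defs
  imports Main
begin

definition simplicial_complex :: "'v set set \<Rightarrow> bool" where
  "simplicial_complex S \<longleftrightarrow> finite S \<and>
     (\<forall>s\<in>S. finite s \<and> s \<noteq> {} \<and> (\<forall>t. t \<subseteq> s \<and> t \<noteq> {} \<longrightarrow> t \<in> S))"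

definition inj_simplicial_map :: "'v set set \<Rightarrow> 'w set set \<Rightarrow> ('v \<Rightarrow> 'w) \<Rightarrow> bool" where
  "inj_simplicial_map S T f \<longleftrightarrow> inj_on f (\<Union>S) \<and> (\<forall>s\<in>S. f ` s \<in> T)"

definition filtration :: "nat \<Rightarrow> (nat \<Rightarrow> 'v set set) \<Rightarrow> (nat \<Rightarrow> nat \<Rightarrow> 'v \<Rightarrow> 'v) \<Rightarrow> bool" where
  "filtration n Sig phi \<longleftrightarrow>
     (\<forall>i\<le>n. simplicial_complex (Sig i)) \<and>
     (\<forall>i j. i \<le> j \<and> j \<le> n \<longrightarrow> inj_simplicial_map (Sig i) (Sig j) (phi i j)) \<and>
     (\<forall>i\<le>n. \<forall>v\<in>\<Union>(Sig i). phi i i v = v) \<and>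
     (\<forall>i j l. i \<le> j \<and> j \<le> l \<and> l \<le> n \<longrightarrow> (\<forall>v\<in>\<Union>(Sig i). phi j l (phi i j v) = phi i l v))"

type_synonym ('v, 'k) ielt = "'v set \<times> 'v set \<Rightarrow> 'k"

definition face_pairs :: "'v set set \<Rightarrow> ('v set \<times> 'v set) set" where
  "face_pairs S = {(x, y). x \<in> S \<and> y \<in> S \<and> x \<subseteq> y}"

definition inc_alg :: "'v set set \<Rightarrow> ('v, 'k::field) ielt set" where
  "inc_alg S = {a. \<forall>p. p \<notin> face_pairs S \<longrightarrow> a p = 0}"

(* product: e_(x,y) * e_(y,z) = e_(x,z), other products of basis elements 0 *)
definition inc_mult :: "'v set set \<Rightarrow> ('v, 'k::field) ielt \<Rightarrow> ('v, 'k) ielt \<Rightarrow> ('v, 'k) ielt" where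
  "inc_mult S a b = (\<lambda>(x, z). if (x, z) \<in> face_pairs S
       then (\<Sum>y\<in>{y \<in> S. x \<subseteq> y \<and> y \<subseteq> z}. a (x, y) * b (y, z)) else 0)"

definition inc_restr :: "'v set set \<Rightarrow> ('v \<Rightarrow> 'w) \<Rightarrow> ('w, 'k::field) ielt \<Rightarrow> ('v, 'k) ielt" where
  "inc_restr S f a = (\<lambda>(x, y). if (x, y) \<in> face_pairs S then a (f ` x, f ` y) else 0)"

definition ezero :: "('v, 'k::field) ielt" where "ezero = (\<lambda>_. 0)"
definition eadd :: "('v, 'k::field) ielt \<Rightarrow> ('v, 'k) ielt \<Rightarrow> ('v, 'k) ielt" where
  "eadd a b = (\<lambda>p. a p + b p)"
definition escale :: "'k::field \<Rightarrow> ('v, 'k) ielt \<Rightarrow> ('v, 'k) ielt" where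
  "escale c a = (\<lambda>p. c * a p)"
definition esum :: "(nat \<Rightarrow> ('v, 'k::field) ielt) \<Rightarrow> nat set \<Rightarrow> ('v, 'k) ielt" where
  "esum f I = (\<lambda>p. \<Sum>i\<in>I. f i p)"

(* k-multilinear maps A^q -> B (i.e. elements of Hom_k(A^{\<otimes>q}, B)), represented as
   functions on lists of length q, extended by 0 outside A^q *)
definition multilinear :: "nat \<Rightarrow> ('v, 'k::field) ielt set \<Rightarrow> ('w, 'k) ielt set
      \<Rightarrow> (('v, 'k) ielt list \<Rightarrow> ('w, 'k) ielt) \<Rightarrow> bool" where
  "multilinear q A B F \<longleftrightarrow>
     (\<forall>as. length as = q \<and> set as \<subseteq> A \<longrightarrow> F as \<in> B) \<and>
     (\<forall>as. \<not> (length as = q \<and> set as \<subseteq> A) \<longrightarrow> F as = ezero) \<and>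
     (\<forall>as i b c. length as = q \<and> set as \<subseteq> A \<and> i < q \<and> b \<in> A \<longrightarrow>
        F (as[i := eadd (escale c (as ! i)) b]) = eadd (escale c (F as)) (F (as[i := b])))"

(* strings c_0 <= ... <= c_p of composable morphisms in [n] *)
definition chains :: "nat \<Rightarrow> nat \<Rightarrow> nat list set" where
  "chains n p = {\<sigma>. length \<sigma> = Suc p \<and> sorted \<sigma> \<and> (\<forall>c\<in>set \<sigma>. c \<le> n)}"

type_synonym ('v, 'k) gs_cochain = "nat list \<Rightarrow> ('v, 'k) ielt list \<Rightarrow> ('v, 'k) ielt"

(* total degree m cochains: prod_{p+q=m} prod_{sigma} Hom(I(Sig c_p)^{\<otimes>q}, I(Sig c_0)) *)
definition GS_cochains :: "nat \<Rightarrow> (nat \<Rightarrow> 'v set set) \<Rightarrow> nat \<Rightarrow> ('v, 'k::field) gs_cochain set" where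
  "GS_cochains n Sig m = {\<Gamma>. \<forall>\<sigma>.
     (if \<exists>p\<le>m. \<sigma> \<in> chains n p
      then multilinear (Suc m - length \<sigma>) (inc_alg (Sig (last \<sigma>))) (inc_alg (Sig (hd \<sigma>))) (\<Gamma> \<sigma>)
      else \<Gamma> \<sigma> = (\<lambda>_. ezero))}"

definition remove_nth :: "nat \<Rightarrow> 'a list \<Rightarrow> 'a list" where
  "remove_nth r xs = take r xs @ drop (Suc r) xs"

(* Hochschild differential of Gamma^sigma (bimodule structure via I(c_0 -> c_p)),
   evaluated at as = [a_1,...,a_q], q = length as >= 1 *)
definition hoch_part :: "(nat \<Rightarrow> 'v set set) \<Rightarrow> (nat \<Rightarrow> nat \<Rightarrow> 'v \<Rightarrow> 'v)
     \<Rightarrow> ('v, 'k::field) gs_cochain \<Rightarrow> nat list \<Rightarrow> ('v, 'k) ielt list \<Rightarrow> ('v, 'k) ielt" where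
  "hoch_part Sig phi \<Gamma> \<sigma> as =
     (let c0 = hd \<sigma>; cp = last \<sigma>; q = length as;
          \<rho> = inc_restr (Sig c0) (phi c0 cp) in
      eadd (inc_mult (Sig c0) (\<rho> (hd as)) (\<Gamma> \<sigma> (tl as)))
       (eadd (esum (\<lambda>i. escale ((-1) ^ i)
                (\<Gamma> \<sigma> (take (i - 1) as @ [inc_mult (Sig cp) (as ! (i - 1)) (as ! i)] @ drop (Suc i) as)))
              {1..<q})
             (escale ((-1) ^ q) (inc_mult (Sig c0) (\<Gamma> \<sigma> (butlast as)) (\<rho> (last as))))))"

definition simp_part :: "(nat \<Rightarrow> 'v set set) \<Rightarrow> (nat \<Rightarrow> nat \<Rightarrow> 'v \<Rightarrow> 'v)
     \<Rightarrow> ('v, 'k::field) gs_cochain \<Rightarrow> nat list \<Rightarrow> ('v, 'k) ielt list \<Rightarrow> ('v, 'k) ielt" where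
  "simp_part Sig phi \<Gamma> \<sigma> as =
     (let p = length \<sigma> - 1 in
      eadd (inc_restr (Sig (\<sigma> ! 0)) (phi (\<sigma> ! 0) (\<sigma> ! 1)) (\<Gamma> (tl \<sigma>) as))
       (eadd (esum (\<lambda>r. escale ((-1) ^ r) (\<Gamma> (remove_nth r \<sigma>) as)) {1..<p})
             (escale ((-1) ^ p)
                (\<Gamma> (butlast \<sigma>) (map (inc_restr (Sig (\<sigma> ! (p - 1))) (phi (\<sigma> ! (p - 1)) (\<sigma> ! p))) as)))))"

definition GS_diff :: "nat \<Rightarrow> (nat \<Rightarrow> 'v set set) \<Rightarrow> (nat \<Rightarrow> nat \<Rightarrow> 'v \<Rightarrow> 'v) \<Rightarrow> nat
     \<Rightarrow> ('v, 'k::field) gs_cochain \<Rightarrow> ('v, 'k) gs_cochain" where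
  "GS_diff n Sig phi m \<Gamma> = (\<lambda>\<sigma> as.
     if (\<exists>p\<le>Suc m. \<sigma> \<in> chains n p) \<and> length as = Suc (Suc m) - length \<sigma>
        \<and> set as \<subseteq> inc_alg (Sig (last \<sigma>))
     then eadd (if 1 \<le> length as then escale ((-1) ^ (length \<sigma> - 1)) (hoch_part Sig phi \<Gamma> \<sigma> as) else ezero)
               (if 2 \<le> length \<sigma> then simp_part Sig phi \<Gamma> \<sigma> as else ezero)
     else ezero)"

definition GS_zero :: "('v, 'k::field) gs_cochain" where "GS_zero = (\<lambda>_ _. ezero)"
definition GS_add :: "('v, 'k::field) gs_cochain \<Rightarrow> ('v, 'k) gs_cochain \<Rightarrow> ('v, 'k) gs_cochain" where
  "GS_add \<Gamma> \<Delta> = (\<lambda>\<sigma> as. eadd (\<Gamma> \<sigma> as) (\<Delta> \<sigma> as))"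
definition GS_scale :: "'k::field \<Rightarrow> ('v, 'k) gs_cochain \<Rightarrow> ('v, 'k) gs_cochain" where
  "GS_scale c \<Gamma> = (\<lambda>\<sigma> as. escale c (\<Gamma> \<sigma> as))"

definition GS_cocycles :: "nat \<Rightarrow> (nat \<Rightarrow> 'v set set) \<Rightarrow> (nat \<Rightarrow> nat \<Rightarrow> 'v \<Rightarrow> 'v) \<Rightarrow> nat
     \<Rightarrow> ('v, 'k::field) gs_cochain set" where
  "GS_cocycles n Sig phi m = {\<Gamma> \<in> GS_cochains n Sig m. GS_diff n Sig phi m \<Gamma> = GS_zero}"

definition GS_coboundaries :: "nat \<Rightarrow> (nat \<Rightarrow> 'v set set) \<Rightarrow> (nat \<Rightarrow> nat \<Rightarrow> 'v \<Rightarrow> 'v) \<Rightarrow> nat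
     \<Rightarrow> ('v, 'k::field) gs_cochain set" where
  "GS_coboundaries n Sig phi m =
     (if m = 0 then {GS_zero} else GS_diff n Sig phi (m - 1) ` GS_cochains n Sig (m - 1))"

(* ordered cochain complex w.r.t. the linear order on vertices: a q-cochain is a k-valued
   function on q-simplices (extended by 0) *)

definition simp_cochains :: "'v::linorder set set \<Rightarrow> nat \<Rightarrow> ('v set \<Rightarrow> 'k::field) set" where
  "simp_cochains S q = {f. \<forall>x. (x \<in> S \<and> card x = Suc q) \<or> f x = 0}"

definition simp_diff :: "'v::linorder set set \<Rightarrow> nat \<Rightarrow> ('v set \<Rightarrow> 'k::field) \<Rightarrow> ('v set \<Rightarrow> 'k)" where
  "simp_diff S q f = (\<lambda>x. if x \<in> S \<and> card x = Suc (Suc q)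
      then (\<Sum>i<Suc (Suc q). (-1) ^ i * f (x - {sorted_list_of_set x ! i})) else 0)"

definition simp_cocycles :: "'v::linorder set set \<Rightarrow> nat \<Rightarrow> ('v set \<Rightarrow> 'k::field) set" where
  "simp_cocycles S q = {f \<in> simp_cochains S q. simp_diff S q f = (\<lambda>_. 0)}"

definition simp_coboundaries :: "'v::linorder set set \<Rightarrow> nat \<Rightarrow> ('v set \<Rightarrow> 'k::field) set" where
  "simp_coboundaries S q =
     (if q = 0 then {\<lambda>_. 0} else simp_diff S (q - 1) ` simp_cochains S (q - 1))"

definition fadd :: "('a \<Rightarrow> 'k::field) \<Rightarrow> ('a \<Rightarrow> 'k) \<Rightarrow> ('a \<Rightarrow> 'k)" where
  "fadd f g = (\<lambda>x. f x + g x)"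
definition fscale :: "'k::field \<Rightarrow> ('a \<Rightarrow> 'k) \<Rightarrow> ('a \<Rightarrow> 'k)" where
  "fscale c f = (\<lambda>x. c * f x)"

(* Z1/B1 \<cong> Z2/B2 as k-vector spaces: a k-linear map on cocycles inducing a bijection
   of the quotients (cocycles modulo coboundaries) *)
definition cohom_iso :: "'a set \<Rightarrow> 'a set \<Rightarrow> ('a \<Rightarrow> 'a \<Rightarrow> 'a) \<Rightarrow> ('k::field \<Rightarrow> 'a \<Rightarrow> 'a)
     \<Rightarrow> 'b set \<Rightarrow> 'b set \<Rightarrow> ('b \<Rightarrow> 'b \<Rightarrow> 'b) \<Rightarrow> ('k \<Rightarrow> 'b \<Rightarrow> 'b) \<Rightarrow> bool" where
  "cohom_iso Z1 B1 add1 scale1 Z2 B2 add2 scale2 \<longleftrightarrow>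
     (\<exists>f. (\<forall>x\<in>Z1. \<forall>y\<in>Z1. f (add1 x y) = add2 (f x) (f y)) \<and>
          (\<forall>c. \<forall>x\<in>Z1. f (scale1 c x) = scale2 c (f x)) \<and>
          f ` Z1 \<subseteq> Z2 \<and> f ` B1 \<subseteq> B2 \<and>
          (\<forall>x\<in>Z1. f x \<in> B2 \<longrightarrow> x \<in> B1) \<and>
          (\<forall>z\<in>Z2. \<exists>x\<in>Z1. add2 z (scale2 (-1) (f x)) \<in> B2))"

end

theory Submission
  imports Defs
begin

text \<open>A matrix entry of a Gerstenhaber--Schack cochain at basis elements is indexed by a string of
  \<open>[n]\<close>, a list of pairs of faces and one further pair of faces. Both differentials split along
  whether these pairs are composable. On the non-composable part, inserting an identity into the
  first gap contracts the Hochschild direction, compatibly with the simplicial direction. On the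
  composable part the coordinates are functions on flags of faces, on which \<open>[n]\<close> only acts by
  restriction, so appending \<open>n\<close> to a string contracts onto the cochains of the nerve of the face
  poset of \<open>\<Sigma>\<^sub>n\<close>. That nerve is the barycentric subdivision of \<open>\<Sigma>\<^sub>n\<close>, and the isomorphism
  evaluates a cocycle at the string \<open>n\<close> on the subdivided simplices; the last vertex map provides
  its inverse.\<close>

section \<open>Alternating sums over faces\<close>

text \<open>The face poset of each \<open>Sig i\<close> is a lower ideal in that of
  \<open>Sig n\<close>, and this drives the split. A composable list traverses a flag that ends in a
  face of the first complex \<open>c_0\<close>, so the whole flag lies there and the last object
  \<open>c_p\<close> imposes no further condition: appending \<open>n\<close> to the string is
  harmless. At a non-composable list a larger \<open>c_p\<close> can admit more arguments, so the
  string stays fixed and the contraction acts in the Hochschild direction. Cochains are neither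
  normalised nor relative to the span of the idempotents \<open>(x, x)\<close>; inserting such an
  idempotent does the work of passing to relative cochains. Accordingly flags may repeat faces,
  while simplicial cochains live on nondegenerate simplices, so the last vertex map assigns 0 to
  degenerate images. Coordinates are extended by 0 outside an index set that depends on the string.
  Identities between homotopies and differentials are proved for arbitrary functions first; that the
  index set is respected in both directions is checked separately.\<close>

definition bd :: "('a list \<Rightarrow> 'k::field) \<Rightarrow> 'a list \<Rightarrow> 'k" where
  "bd F c = (\<Sum>i<length c. (-1) ^ i * F (remove_nth i c))"

lemma length_remove_nth: "i < length c \<Longrightarrow> length (remove_nth i c) = length c - 1"
  by (simp add: remove_nth_def)

lemma set_remove_nth: "set (remove_nth i c) \<subseteq> set c"
  unfolding remove_nth_def by (auto dest: in_set_takeD in_set_dropD)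

lemma map_remove_nth: "map f (remove_nth i c) = remove_nth i (map f c)"
  by (simp add: remove_nth_def take_map drop_map)

lemma remove_nth_split: "remove_nth (length us) (us @ a # vs) = us @ vs"
  by (simp add: remove_nth_def)

lemma sorted_wrt_remove_nth: "sorted_wrt R c \<Longrightarrow> sorted_wrt R (remove_nth i c)"
  unfolding remove_nth_def
  by (cases "i < length c")
     (metis (no_types, lifting) Cons_eq_appendI id_take_nth_drop sorted_wrt.simps(2) sorted_wrt_append
       list.set_intros(2), simp)

lemma distinct_remove_nth: "distinct c \<Longrightarrow> distinct (remove_nth i c)"
  unfolding remove_nth_def
  by (simp add: set_take_disj_set_drop_if_distinct)

lemma bd_Nil: "bd F [] = 0"
  by (simp add: bd_def)

lemma bd_Cons: "bd F (x # c) = F c - bd (\<lambda>d. F (x # d)) c"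
  unfolding bd_def by (simp add: sum.lessThan_Suc_shift remove_nth_def sum_negf del: sum.lessThan_Suc)

text \<open>The cone formula with the apex in last position; \<open>(-1) ^ length c\<close> is the
  sign of the face that drops the apex. The homotopies that append a vertex take their signs from
  here.\<close>

lemma bd_snoc: "bd F (c @ [x]) = bd (\<lambda>d. F (d @ [x])) c + (-1) ^ length c * F c"
  unfolding bd_def by (simp add: remove_nth_def)

lemma bd_cong: "(\<And>i. i < length c \<Longrightarrow> F (remove_nth i c) = G (remove_nth i c)) \<Longrightarrow> bd F c = bd G c"
  unfolding bd_def by simp

lemma bd_diff: "bd (\<lambda>d. F d - G d) c = bd F c - bd G c"
  unfolding bd_def by (simp add: algebra_simps sum_subtractf)

lemma bd_add: "bd (\<lambda>d. F d + G d) c = bd F c + bd G c"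
  unfolding bd_def by (simp add: algebra_simps sum.distrib)

lemma bd_mult: "bd (\<lambda>d. a * F d) c = a * bd F c"
  unfolding bd_def by (simp add: algebra_simps sum_distrib_left)

text \<open>A singleton has the empty list as its face, so this is the augmented coboundary.
  Expanding along the head, \<open>bd F c\<close> occurs twice with opposite signs, and what remains
  is an instance for the tail.\<close>

lemma bd_bd: "bd (bd F) c = 0"
proof (induction c arbitrary: F)
  case Nil
  show ?case by (simp add: bd_Nil)
next
  case (Cons x c)
  have "bd (\<lambda>d. bd F (x # d)) c = bd F c - bd (bd (\<lambda>d. F (x # d))) c"
    by (simp add: bd_Cons bd_diff)
  then show ?case by (simp add: bd_Cons Cons.IH)
qed

text \<open>The two faces that delete one of two adjacent equal vertices cancel; all others are degenerate.\<close>

lemma bd_degenerate: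
  fixes ms :: "'v::linorder list" and F :: "'v list \<Rightarrow> 'k::field"
  assumes "sorted ms" "\<not> distinct ms" and F: "\<And>c. \<not> distinct c \<Longrightarrow> F c = 0"
  shows "bd F ms = 0"
  using assms
proof (induction ms arbitrary: F)
  case Nil
  then show ?case by simp
next
  case (Cons a ms)
  show ?case
  proof (cases "a \<in> set ms")
    case False
    then have "bd (\<lambda>d. F (a # d)) ms = 0"
      using Cons.prems by (intro Cons.IH) auto
    moreover have "F ms = 0"
      using Cons.prems False by auto
    ultimately show ?thesis by (simp add: bd_Cons)
  next
    case True
    then obtain ms' where ms: "ms = a # ms'"
      using Cons.prems(1) by (cases ms) auto
    have "bd (\<lambda>d. F (a # a # d)) ms' = 0"
      unfolding bd_def by (simp add: Cons.prems(3))
    then show ?thesis by (simp add: ms bd_Cons)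
  qed
qed

section \<open>Barycentric subdivision\<close>

text \<open>Dual of barycentric subdivision: subdivide the boundary of a simplex and cone off with
  its barycentre, here the face \<open>set ms\<close>. The apex goes last because flags increase,
  and \<open>(-1) ^ q\<close> is the sign of the face opposite to it. The index counts vertices, so
  it is the dimension plus one.\<close>

primrec subdiv :: "nat \<Rightarrow> ('v set list \<Rightarrow> 'k::field) \<Rightarrow> 'v list \<Rightarrow> 'k" where
  "subdiv 0 g ms = g []"
| "subdiv (Suc q) g ms = (-1) ^ q * bd (subdiv q (\<lambda>c. g (c @ [set ms]))) ms"

text \<open>Repeated faces are allowed: these are all simplices of the nerve, degenerate ones
  included, to match Hochschild cochains that are not normalised.\<close>

definition flags :: "'v set set \<Rightarrow> nat \<Rightarrow> 'v set list set" where
  "flags S l = {c. length c = l \<and> set c \<subseteq> S \<and> sorted_wrt (\<subseteq>) c}"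

lemma flags_remove_nth: "c \<in> flags S (Suc l) \<Longrightarrow> i < Suc l \<Longrightarrow> remove_nth i c \<in> flags S l"
  using set_remove_nth[of i c]
  by (auto simp: flags_def length_remove_nth sorted_wrt_remove_nth)

lemma flags_snoc:
  "c \<in> flags {y \<in> S. y \<subseteq> x} l \<Longrightarrow> x \<in> S \<Longrightarrow> c @ [x] \<in> flags {y \<in> S. y \<subseteq> x} (Suc l)"
  by (auto simp: flags_def sorted_wrt_append)

lemma flags_mono: "A \<subseteq> B \<Longrightarrow> flags A l \<subseteq> flags B l"
  by (auto simp: flags_def)

lemma flags_bounded: "c \<in> flags S (Suc l) \<Longrightarrow> c \<in> flags {y \<in> S. y \<subseteq> last c} (Suc l)"
  by (cases c rule: rev_cases) (auto simp: flags_def sorted_wrt_append)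

lemma flags_last: "c \<in> flags S (Suc l) \<Longrightarrow> last c \<in> S"
  by (cases c rule: rev_cases) (auto simp: flags_def)

lemma subdiv_add: "subdiv q (\<lambda>c. f c + g c) ms = subdiv q f ms + subdiv q g ms"
  by (induction q arbitrary: f g ms) (simp_all add: bd_def algebra_simps sum.distrib)

lemma subdiv_mult: "subdiv q (\<lambda>c. a * g c) ms = a * subdiv q g ms"
  by (induction q arbitrary: g ms) (simp_all add: bd_def algebra_simps sum_distrib_left)

lemma subdiv_zero: "subdiv q (\<lambda>c. 0) ms = 0"
  using subdiv_mult[of q 0 "\<lambda>_. 0" ms] by simp

text \<open>Every apex appended along the recursion is the vertex set of a nonempty face of
  \<open>ms\<close>, so only flags of such faces are ever evaluated.\<close>

lemma subdiv_cong:
  assumes "length ms = q" and "\<And>t. t \<subseteq> set ms \<Longrightarrow> t \<noteq> {} \<Longrightarrow> t \<in> S"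
    and "\<And>c. c \<in> flags {y \<in> S. y \<subseteq> set ms} q \<Longrightarrow> f c = g c"
  shows "subdiv q f ms = subdiv q g ms"
  using assms
proof (induction q arbitrary: f g ms)
  case 0
  then show ?case by (simp add: flags_def)
next
  case (Suc q)
  have "subdiv q (\<lambda>c. f (c @ [set ms])) (remove_nth i ms)
      = subdiv q (\<lambda>c. g (c @ [set ms])) (remove_nth i ms)" if i: "i < length ms" for i
  proof (rule Suc.IH)
    show "length (remove_nth i ms) = q"
      using Suc.prems(1) i by (simp add: length_remove_nth)
    show "t \<in> S" if "t \<subseteq> set (remove_nth i ms)" "t \<noteq> {}" for t
      using that set_remove_nth[of i ms] Suc.prems(2)[of t] by auto
    show "f (c @ [set ms]) = g (c @ [set ms])"
      if c: "c \<in> flags {y \<in> S. y \<subseteq> set (remove_nth i ms)} q" for c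
    proof (rule Suc.prems(3), rule flags_snoc)
      show "c \<in> flags {y \<in> S. y \<subseteq> set ms} q"
        using c flags_mono[of "{y \<in> S. y \<subseteq> set (remove_nth i ms)}" "{y \<in> S. y \<subseteq> set ms}"]
          set_remove_nth[of i ms] by blast
      show "set ms \<in> S"
        using Suc.prems(1) by (intro Suc.prems(2)) auto
    qed
  qed
  then show ?case by (simp add: bd_def)
qed

lemma subdiv_length_cong:
  assumes "\<And>c. length c = q \<Longrightarrow> f c = g c"
  shows "subdiv q f ms = subdiv q g ms"
  using assms
proof (induction q arbitrary: f g ms)
  case (Suc q)
  have "subdiv q (\<lambda>c. f (c @ [set ms])) d = subdiv q (\<lambda>c. g (c @ [set ms])) d" for d
    using Suc.prems by (intro Suc.IH) simp
  then show ?case by (simp add: bd_def)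
qed simp

text \<open>Subdivision is a cochain map. \<open>bd_snoc\<close> splits \<open>bd g\<close> at
  \<open>c @ [set ms]\<close> into the faces that keep the apex and the one that drops it. By
  induction the former contribute a \<open>bd\<close>, which the outer \<open>bd\<close> kills; the
  latter carries the right sign.\<close>

lemma subdiv_bd:
  assumes "length ms = Suc q"
  shows "subdiv (Suc q) (bd g) ms = bd (subdiv q g) ms"
  using assms
proof (induction q arbitrary: g ms)
  case 0
  then show ?case by (simp add: bd_def remove_nth_def)
next
  case (Suc q)
  let ?x = "set ms"
  have eq: "subdiv (Suc q) (\<lambda>c. bd g (c @ [?x])) d
      = bd (subdiv q (\<lambda>c. g (c @ [?x]))) d + (-1) ^ Suc q * subdiv (Suc q) g d"
    if "length d = Suc q" for d
  proof -
    have "subdiv (Suc q) (\<lambda>c. bd g (c @ [?x])) d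
        = subdiv (Suc q) (\<lambda>c. bd (\<lambda>c. g (c @ [?x])) c + (-1) ^ Suc q * g c) d"
      by (rule subdiv_length_cong) (simp add: bd_snoc)
    also have "\<dots> = subdiv (Suc q) (bd (\<lambda>c. g (c @ [?x]))) d + (-1) ^ Suc q * subdiv (Suc q) g d"
      by (simp only: subdiv_add subdiv_mult)
    finally show ?thesis using Suc.IH[OF that] by simp
  qed
  have "bd (subdiv (Suc q) (\<lambda>c. bd g (c @ [?x]))) ms
      = bd (\<lambda>d. bd (subdiv q (\<lambda>c. g (c @ [?x]))) d + (-1) ^ Suc q * subdiv (Suc q) g d) ms"
    by (rule bd_cong) (rule eq, simp add: length_remove_nth Suc.prems)
  also have "\<dots> = (-1) ^ Suc q * bd (subdiv (Suc q) g) ms"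
    by (simp only: bd_add bd_mult bd_bd add_0_left)
  finally show ?case by (subst subdiv.simps(2)) (simp add: power_add[symmetric] mult.assoc[symmetric])
qed

section \<open>The last vertex map\<close>

text \<open>Pullback along the map sending a face to its largest vertex. A flag in which two faces
  share their maximum has a degenerate image and gets the value 0.\<close>

definition last_vertex :: "('v::linorder list \<Rightarrow> 'k::field) \<Rightarrow> 'v set list \<Rightarrow> 'k" where
  "last_vertex F c = (if distinct (map Max c) then F (map Max c) else 0)"

lemma sorted_map_Max:
  assumes "c \<in> flags S l" and "\<And>x. x \<in> S \<Longrightarrow> finite x \<and> x \<noteq> {}"
  shows "sorted (map Max c)"
  unfolding sorted_map
proof (rule sorted_wrt_mono_rel)
  show "sorted_wrt (\<subseteq>) c"
    using assms(1) by (simp add: flags_def)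
  show "Max x \<le> Max y" if "x \<in> set c" "y \<in> set c" "x \<subseteq> y" for x y
    using that assms by (intro Max_mono) (auto simp: flags_def)
qed

text \<open>A flag with degenerate image can still have faces with nondegenerate image; these occur
  in pairs that cancel, which is \<open>bd_degenerate\<close>.\<close>

lemma last_vertex_bd:
  assumes "c \<in> flags S l" and "\<And>x. x \<in> S \<Longrightarrow> finite x \<and> x \<noteq> {}"
  shows "bd (last_vertex F) c = last_vertex (bd F) c"
proof -
  let ?F = "\<lambda>ms. if distinct ms then F ms else 0"
  have *: "bd (last_vertex F) c = bd ?F (map Max c)"
    unfolding bd_def last_vertex_def by (simp only: map_remove_nth length_map)
  show ?thesis
  proof (cases "distinct (map Max c)")
    case True
    then have "bd ?F (map Max c) = bd F (map Max c)"
      by (intro bd_cong) (simp add: distinct_remove_nth)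
    then show ?thesis using True * by (simp add: last_vertex_def)
  next
    case False
    then show ?thesis
      using bd_degenerate[OF sorted_map_Max[OF assms], of ?F] by (simp add: * last_vertex_def)
  qed
qed

text \<open>The last vertex map undoes subdivision on the nose. The apex has as maximum the last
  vertex \<open>v\<close> of \<open>ms\<close>; a face that keeps \<open>v\<close> then repeats it,
  so only the face dropping \<open>v\<close> survives. The suffix \<open>vs\<close> collects the
  maxima of the apexes appended so far.\<close>

lemma subdiv_Max:
  assumes "length ms = q" "sorted ms" "distinct ms"
    and F: "\<And>c. \<not> distinct c \<Longrightarrow> F c = (0::'k::field)"
  shows "subdiv q (\<lambda>c. F (map Max c @ vs)) ms = F (ms @ vs)"
  using assms(1-3)
proof (induction q arbitrary: ms vs)
  case 0
  then show ?case by simp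
next
  case (Suc q)
  then obtain ms' v where ms: "ms = ms' @ [v]" and len: "length ms' = q"
    by (metis length_Suc_conv_rev)
  have max: "Max (set ms) = v"
    using Suc.prems by (intro Max_eqI) (auto simp: ms sorted_append)
  have "bd (subdiv q (\<lambda>c. F (map Max (c @ [set ms]) @ vs))) ms = bd (\<lambda>d. F (d @ v # vs)) ms"
  proof (rule bd_cong)
    fix i assume "i < length ms"
    then show "subdiv q (\<lambda>c. F (map Max (c @ [set ms]) @ vs)) (remove_nth i ms)
        = F (remove_nth i ms @ v # vs)"
      using Suc.IH[of "remove_nth i ms" "v # vs"] Suc.prems
      by (simp add: length_remove_nth sorted_wrt_remove_nth distinct_remove_nth max)
  qed
  also have "\<dots> = bd (\<lambda>d. F (d @ v # v # vs)) ms' + (-1) ^ q * F (ms' @ v # vs)"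
    unfolding ms by (simp add: bd_snoc len)
  also have "bd (\<lambda>d. F (d @ v # v # vs)) ms' = 0"
    unfolding bd_def by (simp add: F)
  finally show ?case
    by (simp add: ms power_add[symmetric] mult.assoc[symmetric])
qed

section \<open>Subdivision and last vertex map are homotopy inverse\<close>

text \<open>The dual of \<open>id - sd \<circ> \<lambda>\<close>, where \<open>\<lambda>\<close> is the last vertex map.\<close>

definition sd_defect :: "nat \<Rightarrow> ('v::linorder set list \<Rightarrow> 'k::field) \<Rightarrow> 'v set list \<Rightarrow> 'k" where
  "sd_defect l g c = g c - last_vertex (subdiv l g) c"

text \<open>A flag \<open>c\<close> and its image under \<open>sd \<circ> \<lambda>\<close> lie in the cone with apex the last face of \<open>c\<close>; the
  homotopy is the dual of coning off.\<close>

primrec cone_htpy :: "nat \<Rightarrow> ('v::linorder set list \<Rightarrow> 'k::field) \<Rightarrow> 'v set list \<Rightarrow> 'k" where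
  "cone_htpy 0 g c = 0"
| "cone_htpy (Suc l) g c = (-1) ^ Suc l *
     (sd_defect (Suc l) (\<lambda>d. g (d @ [last c])) c - bd (cone_htpy l (\<lambda>d. g (d @ [last c]))) c)"

lemma sd_defect_add: "sd_defect l (\<lambda>c. f c + g c) c = sd_defect l f c + sd_defect l g c"
  by (simp add: sd_defect_def last_vertex_def subdiv_add)

lemma sd_defect_mult: "sd_defect l (\<lambda>c. a * g c) c = a * sd_defect l g c"
  by (simp add: sd_defect_def last_vertex_def subdiv_mult algebra_simps)

lemma cone_htpy_add: "cone_htpy l (\<lambda>c. f c + g c) c = cone_htpy l f c + cone_htpy l g c"
  by (induction l arbitrary: f g c) (simp_all add: bd_def sd_defect_add algebra_simps sum.distrib)

lemma cone_htpy_mult: "cone_htpy l (\<lambda>c. a * g c) c = a * cone_htpy l g c"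
  by (induction l arbitrary: g c) (simp_all add: bd_def sd_defect_mult algebra_simps sum_distrib_left)

lemma sd_defect_length_cong:
  assumes "\<And>c. length c = l \<Longrightarrow> f c = g c" "length c = l"
  shows "sd_defect l f c = sd_defect l g c"
  using assms subdiv_length_cong[of l f g] by (simp add: sd_defect_def last_vertex_def)

lemma cone_htpy_length_cong:
  assumes "\<And>c. length c = Suc l \<Longrightarrow> f c = g c" "length c = l"
  shows "cone_htpy l f c = cone_htpy l g c"
  using assms
proof (induction l arbitrary: f g c)
  case (Suc l)
  have "sd_defect (Suc l) (\<lambda>d. f (d @ [last c])) c = sd_defect (Suc l) (\<lambda>d. g (d @ [last c])) c"
    using Suc.prems by (intro sd_defect_length_cong) auto
  moreover have "bd (cone_htpy l (\<lambda>d. f (d @ [last c]))) c = bd (cone_htpy l (\<lambda>d. g (d @ [last c]))) c"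
    using Suc.prems by (intro bd_cong Suc.IH) (auto simp: length_remove_nth)
  ultimately show ?case by simp
qed simp

lemma sd_defect_bd:
  assumes "c \<in> flags S (Suc l)" and "\<And>x. x \<in> S \<Longrightarrow> finite x \<and> x \<noteq> {}"
  shows "sd_defect (Suc l) (bd g) c = bd (sd_defect l g) c"
proof -
  have "length c = Suc l"
    using assms(1) by (simp add: flags_def)
  then have "last_vertex (subdiv (Suc l) (bd g)) c = last_vertex (bd (subdiv l g)) c"
    unfolding last_vertex_def by (simp add: subdiv_bd del: subdiv.simps)
  then show ?thesis
    unfolding sd_defect_def by (simp add: bd_diff last_vertex_bd[OF assms])
qed

text \<open>A cochain homotopy from the identity to subdivision followed by the last vertex map. In
  the inductive step \<open>bd_bd\<close> removes the nested homotopy term, and the two copies of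
  the defect of \<open>bd ?gx\<close> cancel because \<open>sd_defect\<close> commutes with
  \<open>bd\<close>. The terms that drop the apex are left, and the sign in the definition
  normalises them.\<close>

lemma cone_htpy:
  assumes "c \<in> flags S l" and "\<And>x. x \<in> S \<Longrightarrow> finite x \<and> x \<noteq> {}"
  shows "cone_htpy l (bd g) c + bd (cone_htpy (l - 1) g) c = sd_defect l g c"
  using assms(1)
proof (induction l arbitrary: g c)
  case 0
  then show ?case by (simp add: flags_def bd_Nil sd_defect_def last_vertex_def)
next
  case (Suc l)
  let ?x = "last c" and ?gx = "\<lambda>d. g (d @ [last c])" and ?e = "(-1::'b) ^ Suc l"
  have len: "length c = Suc l" using Suc.prems by (simp add: flags_def)
  have ee: "?e * (?e * y) = y" for y :: 'b
    by (simp add: power_add[symmetric] mult.assoc[symmetric])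
  have A: "sd_defect (Suc l) (\<lambda>d. bd g (d @ [?x])) c
      = sd_defect (Suc l) (bd ?gx) c + ?e * sd_defect (Suc l) g c"
  proof -
    have "sd_defect (Suc l) (\<lambda>d. bd g (d @ [?x])) c
        = sd_defect (Suc l) (\<lambda>d. bd ?gx d + ?e * g d) c"
      by (rule sd_defect_length_cong) (simp_all add: bd_snoc len)
    then show ?thesis by (simp only: sd_defect_add sd_defect_mult)
  qed
  have "bd (cone_htpy l (\<lambda>d. bd g (d @ [?x]))) c
      = bd (\<lambda>d. sd_defect l ?gx d - bd (cone_htpy (l - 1) ?gx) d + ?e * cone_htpy l g d) c"
  proof (rule bd_cong)
    fix i assume i: "i < length c"
    let ?d = "remove_nth i c"
    have "cone_htpy l (\<lambda>d. bd g (d @ [?x])) ?d = cone_htpy l (\<lambda>d. bd ?gx d + ?e * g d) ?d"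
      using i len by (intro cone_htpy_length_cong) (simp_all add: bd_snoc length_remove_nth)
    also have "\<dots> = cone_htpy l (bd ?gx) ?d + ?e * cone_htpy l g ?d"
      by (simp only: cone_htpy_add cone_htpy_mult)
    finally show "cone_htpy l (\<lambda>d. bd g (d @ [?x])) ?d
      = sd_defect l ?gx ?d - bd (cone_htpy (l - 1) ?gx) ?d + ?e * cone_htpy l g ?d"
      unfolding Suc.IH[OF flags_remove_nth[OF Suc.prems i[unfolded len]], symmetric] by simp
  qed
  also have "\<dots> = sd_defect (Suc l) (bd ?gx) c + ?e * bd (cone_htpy l g) c"
    by (simp only: bd_add bd_diff bd_mult bd_bd sd_defect_bd[OF Suc.prems assms(2)] diff_0_right)
  finally have "cone_htpy (Suc l) (bd g) c = ?e * (?e * sd_defect (Suc l) g c - ?e * bd (cone_htpy l g) c)"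
    by (simp only: cone_htpy.simps A) simp
  then show ?case by (simp only: right_diff_distrib ee) simp
qed

text \<open>The maxima of a flag all lie in its last face, so subdividing the simplex they span only
  produces faces of \<open>last c\<close>.\<close>

lemma subdiv_map_Max_cong:
  assumes "c \<in> flags S l" and S: "\<And>x t. x \<in> S \<Longrightarrow> t \<subseteq> x \<Longrightarrow> t \<noteq> {} \<Longrightarrow> t \<in> S"
    and fin: "\<And>x. x \<in> S \<Longrightarrow> finite x \<and> x \<noteq> {}"
    and "\<And>d. d \<in> flags S l \<Longrightarrow> (d \<noteq> [] \<Longrightarrow> last d \<subseteq> last c) \<Longrightarrow> f d = g d"
  shows "subdiv l f (map Max c) = subdiv l g (map Max c)"
proof (cases l)
  case 0
  then show ?thesis using assms by (simp add: flags_def)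
next
  case (Suc l')
  then have cS: "c \<noteq> []" "last c \<in> S"
    using assms(1) flags_last[of c S] by (auto simp: flags_def)
  have sub: "set (map Max c) \<subseteq> last c"
  proof
    fix v assume "v \<in> set (map Max c)"
    then obtain x where x: "x \<in> set c" "v = Max x" by auto
    then have "x \<in> S" "x \<subseteq> last c"
      using flags_bounded[of c S l'] assms(1) Suc by (auto simp: flags_def)
    then show "v \<in> last c"
      using x fin[of x] Max_in[of x] by blast
  qed
  show ?thesis
  proof (rule subdiv_cong[where S = "{y \<in> S. y \<subseteq> last c}"])
    show "length (map Max c) = l" using assms(1) by (simp add: flags_def)
    show "t \<in> {y \<in> S. y \<subseteq> last c}" if "t \<subseteq> set (map Max c)" "t \<noteq> {}" for t
      using that sub S[OF cS(2), of t] by auto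
    fix d assume "d \<in> flags {y \<in> {y \<in> S. y \<subseteq> last c}. y \<subseteq> set (map Max c)} l"
    then have "d \<in> flags S l" "\<forall>y\<in>set d. y \<subseteq> last c"
      by (auto simp: flags_def)
    then show "f d = g d" using assms(4)[of d] by auto
  qed
qed

text \<open>The homotopy is carried by \<open>last c\<close>: it reads \<open>g\<close> only at
  flags of \<open>S\<close> below that face. This matters because the coboundary of a nerve cocycle
  is known to vanish on flags of \<open>S\<close> only, not on all lists of sets.\<close>

lemma cone_htpy_zero:
  assumes "c \<in> flags S l" and S: "\<And>x t. x \<in> S \<Longrightarrow> t \<subseteq> x \<Longrightarrow> t \<noteq> {} \<Longrightarrow> t \<in> S"
    and fin: "\<And>x. x \<in> S \<Longrightarrow> finite x \<and> x \<noteq> {}"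
    and "\<And>d. d \<in> flags S (Suc l) \<Longrightarrow> (c \<noteq> [] \<Longrightarrow> last d \<subseteq> last c) \<Longrightarrow> g d = 0"
  shows "cone_htpy l g c = 0"
  using assms(1,4)
proof (induction l arbitrary: g c)
  case (Suc l)
  let ?gx = "\<lambda>d. g (d @ [last c])"
  have c: "c \<noteq> []" "last c \<in> S" "length c = Suc l"
    using Suc.prems flags_last[of c S] by (auto simp: flags_def)
  have z: "?gx d = 0" if d: "d \<in> flags S (Suc l)" "last d \<subseteq> last c" for d
  proof (rule Suc.prems(2))
    have "d \<in> flags {y \<in> S. y \<subseteq> last c} (Suc l)"
      using flags_bounded[OF d(1)] d(2) flags_mono[of "{y \<in> S. y \<subseteq> last d}" "{y \<in> S. y \<subseteq> last c}"]
      by blast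
    then show "d @ [last c] \<in> flags S (Suc (Suc l))"
      using flags_snoc[of d S "last c"] c flags_mono[of "{y \<in> S. y \<subseteq> last c}" S] by blast
  qed simp
  have "sd_defect (Suc l) ?gx c = 0"
  proof -
    have "subdiv (Suc l) ?gx (map Max c) = subdiv (Suc l) (\<lambda>_. 0) (map Max c)"
    proof (rule subdiv_map_Max_cong[OF Suc.prems(1) S fin])
      fix d assume d: "d \<in> flags S (Suc l)" "d \<noteq> [] \<Longrightarrow> last d \<subseteq> last c"
      then have "d \<noteq> []" by (auto simp: flags_def)
      then show "?gx d = 0" using z d by blast
    qed
    moreover have "?gx c = 0"
      using z[OF Suc.prems(1)] by simp
    ultimately show ?thesis
      by (simp add: sd_defect_def last_vertex_def subdiv_zero del: subdiv.simps)
  qed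
  moreover have "cone_htpy l ?gx (remove_nth i c) = 0" if i: "i < length c" for i
  proof (cases "l = 0")
    case False
    have r: "remove_nth i c \<in> flags S l"
      using flags_remove_nth[OF Suc.prems(1)] i c by simp
    then have ne: "remove_nth i c \<noteq> []"
      using False by (auto simp: flags_def)
    then have "last (remove_nth i c) \<in> set c"
      using set_remove_nth[of i c] last_in_set by blast
    then have "last (remove_nth i c) \<subseteq> last c"
      using flags_bounded[OF Suc.prems(1)] by (auto simp: flags_def)
    then have "?gx d = 0" if "d \<in> flags S (Suc l)"
      "remove_nth i c \<noteq> [] \<Longrightarrow> last d \<subseteq> last (remove_nth i c)" for d
      using that ne by (intro z) blast+
    then show ?thesis
      by (rule Suc.IH[OF r])
  qed simp
  ultimately show ?case
    by (simp add: bd_def del: power_Suc)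
qed simp

section \<open>The Hochschild complex in coordinates\<close>

text \<open>A matrix entry at \<open>(x, z)\<close> of a Hochschild cochain evaluated at basis elements
  \<open>p\<^sub>1, \<dots>, p\<^sub>q\<close> is indexed by the list \<open>(\<star>, x), p\<^sub>1, \<dots>, p\<^sub>q, (z, \<star>)\<close>. Left and right multiplication
  and the inner products of the Hochschild differential then all become the composition of two
  adjacent pairs.\<close>

fun hoch :: "(('a \<times> 'a) list \<Rightarrow> 'k::field) \<Rightarrow> ('a \<times> 'a) list \<Rightarrow> 'k" where
  "hoch G (p # p' # L) =
     (if snd p = fst p' then G ((fst p, snd p') # L) else 0) - hoch (\<lambda>M. G (p # M)) (p' # L)"
| "hoch G _ = 0"

abbreviation composable :: "('a \<times> 'a) list \<Rightarrow> bool" where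
  "composable \<equiv> successively (\<lambda>p p'. snd p = fst p')"

fun fill_gap :: "(('a \<times> 'a) list \<Rightarrow> 'k::field) \<Rightarrow> ('a \<times> 'a) list \<Rightarrow> 'k" where
  "fill_gap G (p # p' # L) =
     (if snd p \<noteq> fst p' then G (p # (snd p, snd p) # p' # L) else - fill_gap (\<lambda>M. G (p # M)) (p' # L))"
| "fill_gap G _ = 0"

lemma hoch_cong:
  assumes "\<And>us p p' vs. L = us @ p # p' # vs \<Longrightarrow> snd p = fst p' \<Longrightarrow>
    F (us @ (fst p, snd p') # vs) = G (us @ (fst p, snd p') # vs)"
  shows "hoch F L = hoch G L"
  using assms
proof (induction F L arbitrary: G rule: hoch.induct)
  case (1 F p p' L)
  have "hoch (\<lambda>M. F (p # M)) (p' # L) = hoch (\<lambda>M. G (p # M)) (p' # L)"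
  proof (rule "1.IH")
    fix us q q' vs assume "p' # L = us @ q # q' # vs" "snd q = fst q'"
    then show "F (p # us @ (fst q, snd q') # vs) = G (p # us @ (fst q, snd q') # vs)"
      using "1.prems"[of "p # us" q q' vs] by simp
  qed
  then show ?case using "1.prems"[of "[]" p p' L] by simp
qed simp_all

lemma fill_gap_cong:
  assumes "\<And>us p p' vs. L = us @ p # p' # vs \<Longrightarrow> snd p \<noteq> fst p' \<Longrightarrow>
    F (us @ p # (snd p, snd p) # p' # vs) = G (us @ p # (snd p, snd p) # p' # vs)"
  shows "fill_gap F L = fill_gap G L"
  using assms
proof (induction F L arbitrary: G rule: fill_gap.induct)
  case (1 F p p' L)
  show ?case
  proof (cases "snd p = fst p'")
    case True
    have "fill_gap (\<lambda>M. F (p # M)) (p' # L) = fill_gap (\<lambda>M. G (p # M)) (p' # L)"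
    proof (rule "1.IH")
      fix us q q' vs assume "p' # L = us @ q # q' # vs" "snd q \<noteq> fst q'"
      then show "F (p # us @ q # (snd q, snd q) # q' # vs) = G (p # us @ q # (snd q, snd q) # q' # vs)"
        using "1.prems"[of "p # us" q q' vs] by simp
    qed (simp add: True)
    then show ?thesis using True by simp
  next
    case False
    then show ?thesis using "1.prems"[of "[]" p p' L] by simp
  qed
qed simp_all

lemma hoch_mult: "hoch (\<lambda>M. a * F M) L = a * hoch F L"
  by (induction F L rule: hoch.induct) (simp_all add: algebra_simps)

lemma hoch_zero: "hoch (\<lambda>_. 0) L = 0"
  using hoch_mult[of 0 "\<lambda>_. 0" L] by simp

lemma fill_gap_add: "fill_gap (\<lambda>M. F M + G M) L = fill_gap F L + fill_gap G L"
  by (induction F L arbitrary: G rule: fill_gap.induct) simp_all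

lemma fill_gap_mult: "fill_gap (\<lambda>M. a * F M) L = a * fill_gap F L"
  by (induction F L rule: fill_gap.induct) (simp_all add: algebra_simps)

lemma fill_gap_zero: "fill_gap (\<lambda>_. 0) L = 0"
  using fill_gap_mult[of 0 "\<lambda>_. 0" L] by simp

lemma fill_gap_bd: "fill_gap (\<lambda>M. bd (\<lambda>\<tau>. G \<tau> M) \<sigma>) L = bd (\<lambda>\<tau>. fill_gap (G \<tau>) L) \<sigma>"
proof -
  have "fill_gap (\<lambda>M. \<Sum>i\<in>I. (-1) ^ i * G (remove_nth i \<sigma>) M) L
      = (\<Sum>i\<in>I. (-1) ^ i * fill_gap (G (remove_nth i \<sigma>)) L)" if "finite I" for I
    using that
    by induction (simp_all add: fill_gap_zero fill_gap_add fill_gap_mult)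
  then show ?thesis unfolding bd_def by simp
qed

text \<open>\<open>fill_gap\<close> compares the second component of the head with its successor, so
  changing the first component of the head does not move the gap.\<close>

lemma fill_gap_compose_hd:
  "fill_gap (\<lambda>M. G ((a, snd (hd M)) # tl M)) (p' # L) = fill_gap G ((a, snd p') # L)"
  by (cases L) simp_all

lemma composable_join:
  "snd p = fst p' \<Longrightarrow> composable (us @ (fst p, snd p') # vs) \<longleftrightarrow> composable (us @ p # p' # vs)"
  by (auto simp: successively_append_iff successively_Cons)

text \<open>Inserting the idempotent of \<open>snd p\<close> after \<open>p\<close> at the first gap
  creates one new composite, \<open>p\<close> with the idempotent, and it restores \<open>L\<close>.
  The idempotent still does not compose with the next pair, and composites elsewhere leave the gap a
  gap, so all other terms cancel in the sum. Pairs before the gap are absorbed by induction, with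
  the alternating sign of \<open>fill_gap\<close>.\<close>

lemma hoch_fill_gap:
  "\<not> composable L \<Longrightarrow> hoch (fill_gap G) L + fill_gap (hoch G) L = G L"
proof (induction G L rule: hoch.induct)
  case (1 G p p' L)
  show ?case
  proof (cases "snd p = fst p'")
    case False
    let ?u = "(snd p, snd p)"
    have "hoch (\<lambda>M. fill_gap G (p # M)) (p' # L) = hoch (\<lambda>M. G (p # ?u # M)) (p' # L)"
    proof (rule hoch_cong)
      fix us q q' vs assume "p' # L = us @ q # q' # vs"
      then show "fill_gap G (p # us @ (fst q, snd q') # vs) = G (p # ?u # us @ (fst q, snd q') # vs)"
        using False by (cases us) auto
    qed
    then show ?thesis using False by simp
  next
    case True
    let ?G = "\<lambda>M. G (p # M)"
    have "hoch (\<lambda>M. fill_gap G (p # M)) (p' # L) = hoch (\<lambda>M. (-1) * fill_gap ?G M) (p' # L)"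
    proof (rule hoch_cong)
      fix us q q' vs assume "p' # L = us @ q # q' # vs"
      then show "fill_gap G (p # us @ (fst q, snd q') # vs) = (-1) * fill_gap ?G (us @ (fst q, snd q') # vs)"
        using True by (cases us) auto
    qed
    moreover have "fill_gap (\<lambda>M. hoch G (p # M)) (p' # L)
        = fill_gap (\<lambda>M. G ((fst p, snd (hd M)) # tl M) + (-1) * hoch ?G M) (p' # L)"
    proof (rule fill_gap_cong)
      fix us q q' vs assume "p' # L = us @ q # q' # vs"
      then show "hoch G (p # us @ q # (snd q, snd q) # q' # vs)
          = G ((fst p, snd (hd (us @ q # (snd q, snd q) # q' # vs))) # tl (us @ q # (snd q, snd q) # q' # vs))
            + (-1) * hoch ?G (us @ q # (snd q, snd q) # q' # vs)"
        using True by (cases us) auto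
    qed
    moreover have "hoch (fill_gap ?G) (p' # L) + fill_gap (hoch ?G) (p' # L) = G (p # p' # L)"
      using "1.IH" "1.prems" True by simp
    ultimately show ?thesis
      using True by (simp only: hoch.simps fill_gap.simps hoch_mult fill_gap_add fill_gap_mult
          fill_gap_compose_hd if_True simp_thms) (simp add: algebra_simps)
  qed
qed simp_all

text \<open>A composable list records the objects between consecutive pairs; composing two
  neighbours deletes the object between them. Thus \<open>hoch\<close> becomes the simplicial
  coboundary of the nerve.\<close>

lemma hoch_composable:
  assumes "composable L"
  shows "hoch (\<lambda>M. g (map snd (butlast M))) L = bd g (map snd (butlast L))"
  using assms
proof (induction L arbitrary: g)
  case (Cons p L)
  show ?case
  proof (cases L)
    case (Cons p' L')
    have "hoch (\<lambda>M. g (map snd (butlast (p # M)))) L = hoch (\<lambda>M. g (snd p # map snd (butlast M))) L"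
      by (rule hoch_cong) simp
    also have "\<dots> = bd (\<lambda>d. g (snd p # d)) (map snd (butlast L))"
      using Cons.IH[of "\<lambda>d. g (snd p # d)"] Cons.prems by (simp add: Cons)
    finally show ?thesis
      using Cons.prems by (cases L') (simp_all add: Cons bd_Cons bd_Nil)
  qed (simp add: bd_Nil)
qed (simp add: bd_Nil)

section \<open>The total complex in coordinates\<close>

text \<open>With \<open>length \<sigma> = p + 1\<close>, the sign of the first term is the
  \<open>(-1) ^ p\<close> of the total complex. The guard removes the augmentation that
  \<open>bd\<close> would contribute on one-object strings.\<close>

definition total_diff ::
    "(nat list \<Rightarrow> ('a \<times> 'a) list \<Rightarrow> 'k::field) \<Rightarrow> nat list \<Rightarrow> ('a \<times> 'a) list \<Rightarrow> 'k" where
  "total_diff G \<sigma> L = - ((-1) ^ length \<sigma> * hoch (G \<sigma>) L)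
     + (if 2 \<le> length \<sigma> then bd (\<lambda>\<tau>. G \<tau> L) \<sigma> else 0)"

text \<open>On composable lists only the nerve of \<open>[n]\<close> matters, which is contracted to its terminal
  object by appending \<open>n\<close>; the other lists are contracted in the Hochschild direction.\<close>

definition total_htpy ::
    "nat \<Rightarrow> (nat list \<Rightarrow> ('a \<times> 'a) list \<Rightarrow> 'k::field) \<Rightarrow> nat list \<Rightarrow> ('a \<times> 'a) list \<Rightarrow> 'k" where
  "total_htpy n G \<sigma> L = (if composable L then (-1) ^ length \<sigma> * G (\<sigma> @ [n]) L
     else - ((-1) ^ length \<sigma> * fill_gap (G \<sigma>) L))"

text \<open>Embeds nerve cochains in simplicial degree 0 with the same value at every object of
  \<open>[n]\<close>; the two faces of a two-object string then cancel.\<close>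

definition total_incl :: "('a list \<Rightarrow> 'k::field) \<Rightarrow> nat list \<Rightarrow> ('a \<times> 'a) list \<Rightarrow> 'k" where
  "total_incl g \<sigma> L = (if length \<sigma> = 1 \<and> composable L then g (map snd (butlast L)) else 0)"

lemma total_diff_incl: "\<sigma> \<noteq> [] \<Longrightarrow> total_diff (total_incl g) \<sigma> L = total_incl (bd g) \<sigma> L"
proof -
  assume ne: "\<sigma> \<noteq> []"
  have "hoch (total_incl g \<sigma>) L = total_incl (bd g) \<sigma> L"
  proof (cases "length \<sigma> = 1 \<and> composable L")
    case True
    have "hoch (total_incl g \<sigma>) L = hoch (\<lambda>M. g (map snd (butlast M))) L"
      using True by (intro hoch_cong) (simp add: total_incl_def composable_join)
    then show ?thesis using True by (simp add: hoch_composable total_incl_def)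
  next
    case False
    then have "hoch (total_incl g \<sigma>) L = hoch (\<lambda>_. 0) L"
      by (intro hoch_cong) (auto simp: total_incl_def composable_join)
    then show ?thesis using False by (auto simp: hoch_zero total_incl_def)
  qed
  moreover have "bd (\<lambda>\<tau>. total_incl g \<tau> L) \<sigma> = 0" if l: "2 \<le> length \<sigma>"
  proof (cases "length \<sigma> = 2")
    case True
    then obtain a b where "\<sigma> = [a, b]"
      by (metis One_nat_def Suc_1 length_0_conv length_Suc_conv)
    then show ?thesis by (simp add: bd_Cons bd_Nil total_incl_def)
  next
    case False
    then have "length \<sigma> - 1 \<noteq> 1" using l by linarith
    then show ?thesis
      by (simp add: bd_def total_incl_def length_remove_nth)
  qed
  ultimately show ?thesis
    using ne by (cases "length \<sigma> = 1") (auto simp: total_diff_def total_incl_def)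
qed

text \<open>On non-composable lists the signs cancel the simplicial terms and leave
  \<open>hoch_fill_gap\<close>. On composable lists the Hochschild terms cancel and the face
  dropping the appended \<open>n\<close> returns \<open>G \<sigma> L\<close>. The correction
  \<open>G [n] L\<close> arises for a one-object string: the face of the extended string that drops
  the original object has no partner, since \<open>total_diff\<close> has no simplicial term
  there.\<close>

lemma total_htpy:
  fixes G :: "nat list \<Rightarrow> ('a \<times> 'a) list \<Rightarrow> 'k::field"
  assumes "\<sigma> \<noteq> []"
  shows "total_diff (total_htpy n G) \<sigma> L + total_htpy n (total_diff G) \<sigma> L
    = G \<sigma> L - (if length \<sigma> = 1 \<and> composable L then G [n] L else 0)"
proof -
  let ?e = "(-1::'k) ^ length \<sigma>" and ?b = "2 \<le> length \<sigma>"
  have ee: "?e * (?e * x) = x" for x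
    by (simp add: power_add[symmetric] mult.assoc[symmetric])
  have sgn: "(-1) ^ length (remove_nth i \<sigma>) = - ?e" if "i < length \<sigma>" for i
    using that by (cases "length \<sigma>") (auto simp: length_remove_nth)
  show ?thesis
  proof (cases "composable L")
    case False
    have "hoch (total_htpy n G \<sigma>) L = hoch (\<lambda>M. (- ?e) * fill_gap (G \<sigma>) M) L"
      using False by (intro hoch_cong) (simp add: total_htpy_def composable_join)
    then have h: "hoch (total_htpy n G \<sigma>) L = (- ?e) * hoch (fill_gap (G \<sigma>)) L"
      by (simp only: hoch_mult)
    have "bd (\<lambda>\<tau>. total_htpy n G \<tau> L) \<sigma> = bd (\<lambda>\<tau>. ?e * fill_gap (G \<tau>) L) \<sigma>"
      using False by (intro bd_cong) (simp add: total_htpy_def sgn)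
    then have s: "bd (\<lambda>\<tau>. total_htpy n G \<tau> L) \<sigma> = ?e * bd (\<lambda>\<tau>. fill_gap (G \<tau>) L) \<sigma>"
      by (simp only: bd_mult)
    \<comment> \<open>The guard is rewritten as a scalar factor so that the linearity rules of
      \<open>fill_gap\<close> apply.\<close>
    have "total_diff G \<sigma> = (\<lambda>M. (- ?e) * hoch (G \<sigma>) M + (if ?b then 1 else 0) * bd (\<lambda>\<tau>. G \<tau> M) \<sigma>)"
      by (auto simp: total_diff_def fun_eq_iff)
    then have f: "fill_gap (total_diff G \<sigma>) L
        = (- ?e) * fill_gap (hoch (G \<sigma>)) L + (if ?b then 1 else 0) * bd (\<lambda>\<tau>. fill_gap (G \<tau>) L) \<sigma>"
      by (simp only: fill_gap_add fill_gap_mult fill_gap_bd)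
    have "total_diff (total_htpy n G) \<sigma> L + total_htpy n (total_diff G) \<sigma> L
        = hoch (fill_gap (G \<sigma>)) L + fill_gap (hoch (G \<sigma>)) L"
      using False by (simp add: total_diff_def[of "total_htpy n G"] total_htpy_def[of n "total_diff G"]
          h s f ee distrib_left right_diff_distrib)
    then show ?thesis using False hoch_fill_gap[OF False] by simp
  next
    case True
    let ?G = "\<lambda>\<tau>. G (\<tau> @ [n])"
    have h: "hoch (total_htpy n G \<sigma>) L = hoch (\<lambda>M. ?e * ?G \<sigma> M) L"
      using True by (intro hoch_cong) (simp add: total_htpy_def composable_join)
    have "bd (\<lambda>\<tau>. total_htpy n G \<tau> L) \<sigma> = bd (\<lambda>\<tau>. (- ?e) * ?G \<tau> L) \<sigma>"
      using True by (intro bd_cong) (simp add: total_htpy_def sgn)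
    then have s: "bd (\<lambda>\<tau>. total_htpy n G \<tau> L) \<sigma> = (- ?e) * bd (\<lambda>\<tau>. ?G \<tau> L) \<sigma>"
      by (simp only: bd_mult)
    have "total_diff G (\<sigma> @ [n]) L = ?e * hoch (?G \<sigma>) L + bd (\<lambda>\<tau>. ?G \<tau> L) \<sigma> + ?e * G \<sigma> L"
      using assms by (cases \<sigma>) (simp_all add: total_diff_def bd_snoc[of _ "a # b" for a b, simplified])
    then have "total_diff (total_htpy n G) \<sigma> L + total_htpy n (total_diff G) \<sigma> L
        = G \<sigma> L + (if ?b then 0 else ?e * bd (\<lambda>\<tau>. ?G \<tau> L) \<sigma>)"
      using True by (simp add: total_diff_def[of "total_htpy n G"] total_htpy_def[of n "total_diff G"]
          h s hoch_mult ee algebra_simps)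
    moreover have "length \<sigma> = 1 \<or> ?b"
      using assms by (cases \<sigma>) (auto simp: Suc_le_eq)
    moreover have "?e * bd (\<lambda>\<tau>. ?G \<tau> L) \<sigma> = - G [n] L" if "length \<sigma> = 1"
      using that by (auto simp: length_Suc_conv bd_Cons bd_Nil)
    ultimately show ?thesis
      using True by auto
  qed
qed

section \<open>Multilinear maps\<close>

text \<open>The linearity clause of \<open>multilinear\<close> for a single coordinate, with the
  slot exposed by splitting the list rather than by list update.\<close>

definition multilin_form :: "nat \<Rightarrow> ('v, 'k::field) ielt set \<Rightarrow> (('v, 'k) ielt list \<Rightarrow> 'k) \<Rightarrow> bool" where
  "multilin_form q A f \<longleftrightarrow> (\<forall>us a b vs c. length us + Suc (length vs) = q \<longrightarrow>
     set us \<subseteq> A \<longrightarrow> set vs \<subseteq> A \<longrightarrow> a \<in> A \<longrightarrow> b \<in> A \<longrightarrow>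
     f (us @ eadd (escale c a) b # vs) = c * f (us @ a # vs) + f (us @ b # vs))"

definition linear_on :: "('v, 'k::field) ielt set \<Rightarrow> (('v, 'k) ielt \<Rightarrow> 'k) \<Rightarrow> bool" where
  "linear_on A l \<longleftrightarrow> (\<forall>a\<in>A. \<forall>b\<in>A. \<forall>c. l (eadd (escale c a) b) = c * l a + l b)"

definition basis_elt :: "'v set \<times> 'v set \<Rightarrow> ('v, 'k::field) ielt" where
  "basis_elt p = (\<lambda>p'. if p' = p then 1 else 0)"

lemma multilin_formD:
  assumes "multilin_form q A f" "length us + Suc (length vs) = q" "set us \<subseteq> A" "set vs \<subseteq> A" "a \<in> A" "b \<in> A"
  shows "f (us @ eadd (escale c a) b # vs) = c * f (us @ a # vs) + f (us @ b # vs)"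
  using assms unfolding multilin_form_def by blast

lemma multilin_formI:
  assumes "\<And>us a b vs c. length us + Suc (length vs) = q \<Longrightarrow> set us \<subseteq> A \<Longrightarrow> set vs \<subseteq> A \<Longrightarrow>
    a \<in> A \<Longrightarrow> b \<in> A \<Longrightarrow> f (us @ eadd (escale c a) b # vs) = c * f (us @ a # vs) + f (us @ b # vs)"
  shows "multilin_form q A f"
  using assms unfolding multilin_form_def by blast

lemma multilinear_iff:
  "multilinear q A B F \<longleftrightarrow>
     (\<forall>as. length as = q \<and> set as \<subseteq> A \<longrightarrow> F as \<in> B) \<and>
     (\<forall>as. \<not> (length as = q \<and> set as \<subseteq> A) \<longrightarrow> F as = ezero) \<and>
     (\<forall>r. multilin_form q A (\<lambda>as. F as r))"
proof -
  have "(\<forall>as i b c. length as = q \<and> set as \<subseteq> A \<and> i < q \<and> b \<in> A \<longrightarrow>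
        F (as[i := eadd (escale c (as ! i)) b]) = eadd (escale c (F as)) (F (as[i := b])))
    \<longleftrightarrow> (\<forall>r. multilin_form q A (\<lambda>as. F as r))" (is "?L = ?R")
  proof
    assume L: ?L
    show ?R
    proof (intro allI multilin_formI)
      fix r us a b vs c
      assume *: "length us + Suc (length vs) = q" "set us \<subseteq> A" "set vs \<subseteq> A" "a \<in> A" "b \<in> A"
      then have "F ((us @ a # vs)[length us := eadd (escale c ((us @ a # vs) ! length us)) b])
          = eadd (escale c (F (us @ a # vs))) (F ((us @ a # vs)[length us := b]))"
        by (intro L[rule_format]) auto
      then show "F (us @ eadd (escale c a) b # vs) r = c * F (us @ a # vs) r + F (us @ b # vs) r"
        by (simp add: eadd_def escale_def)
    qed
  next
    assume R: ?R
    show ?L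
    proof (intro allI impI ext)
      fix as i b c r
      assume *: "length as = q \<and> set as \<subseteq> A \<and> i < q \<and> b \<in> A"
      have "F (take i as @ eadd (escale c (as ! i)) b # drop (Suc i) as) r
          = c * F (take i as @ as ! i # drop (Suc i) as) r + F (take i as @ b # drop (Suc i) as) r"
        using * by (intro multilin_formD[OF R[rule_format]])
          (auto dest: in_set_takeD in_set_dropD)
      then show "F (as[i := eadd (escale c (as ! i)) b]) r
          = eadd (escale c (F as)) (F (as[i := b])) r"
        using * by (simp add: upd_conv_take_nth_drop id_take_nth_drop[symmetric] eadd_def escale_def)
    qed
  qed
  then show ?thesis unfolding multilinear_def by simp
qed

lemma multilinearD: "multilinear q A B F \<Longrightarrow> multilin_form q A (\<lambda>as. F as r)"
  unfolding multilinear_iff by blast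

lemma multilin_form_add:
  "multilin_form q A f \<Longrightarrow> multilin_form q A g \<Longrightarrow> multilin_form q A (\<lambda>as. f as + g as)"
  unfolding multilin_form_def by (simp add: algebra_simps)

lemma multilin_form_mult: "multilin_form q A f \<Longrightarrow> multilin_form q A (\<lambda>as. x * f as)"
  unfolding multilin_form_def by (simp add: algebra_simps)

lemma multilin_form_zero: "multilin_form q A (\<lambda>as. 0)"
  unfolding multilin_form_def by simp

lemma multilin_form_sum:
  "(\<And>i. i \<in> I \<Longrightarrow> multilin_form q A (f i)) \<Longrightarrow> multilin_form q A (\<lambda>as. \<Sum>i\<in>I. f i as)"
  by (induction I rule: infinite_finite_induct)
    (simp_all add: multilin_form_zero multilin_form_add)

lemma multilin_form_hd_tl:
  assumes "linear_on A l" "multilin_form q A g"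
  shows "multilin_form (Suc q) A (\<lambda>as. l (hd as) * g (tl as))"
proof (rule multilin_formI)
  fix us a b vs c
  assume *: "length us + Suc (length vs) = Suc q" "set us \<subseteq> A" "set vs \<subseteq> A" "a \<in> A" "b \<in> A"
  show "l (hd (us @ eadd (escale c a) b # vs)) * g (tl (us @ eadd (escale c a) b # vs))
      = c * (l (hd (us @ a # vs)) * g (tl (us @ a # vs))) + l (hd (us @ b # vs)) * g (tl (us @ b # vs))"
  proof (cases us)
    case Nil
    then show ?thesis using * assms(1) by (simp add: linear_on_def algebra_simps)
  next
    case (Cons u us')
    then show ?thesis using * multilin_formD[OF assms(2), of us' vs a b c] by (simp add: algebra_simps)
  qed
qed

lemma multilin_form_butlast_last:
  assumes "linear_on A l" "multilin_form q A g"
  shows "multilin_form (Suc q) A (\<lambda>as. g (butlast as) * l (last as))"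
proof (rule multilin_formI)
  fix us a b vs c
  assume *: "length us + Suc (length vs) = Suc q" "set us \<subseteq> A" "set vs \<subseteq> A" "a \<in> A" "b \<in> A"
  show "g (butlast (us @ eadd (escale c a) b # vs)) * l (last (us @ eadd (escale c a) b # vs))
      = c * (g (butlast (us @ a # vs)) * l (last (us @ a # vs)))
        + g (butlast (us @ b # vs)) * l (last (us @ b # vs))"
  proof (cases vs rule: rev_cases)
    case Nil
    then show ?thesis using * assms(1) by (simp add: butlast_append linear_on_def algebra_simps)
  next
    case (snoc vs' v)
    then show ?thesis using * multilin_formD[OF assms(2), of us vs' a b c]
      by (simp add: butlast_append algebra_simps)
  qed
qed

definition mult_at :: "('a \<Rightarrow> 'a \<Rightarrow> 'a) \<Rightarrow> nat \<Rightarrow> 'a list \<Rightarrow> 'a list" where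
  "mult_at mu j as = take j as @ [mu (as ! j) (as ! Suc j)] @ drop (Suc (Suc j)) as"

lemma mult_at_append: "length us = j \<Longrightarrow> mult_at mu j (us @ a # b # vs) = us @ mu a b # vs"
  by (auto simp: mult_at_def nth_append)

lemma list_split_two:
  assumes "Suc j < length as"
  obtains us a b vs where "as = us @ a # b # vs" "length us = j"
proof
  show "as = take j as @ as ! j # as ! Suc j # drop (Suc (Suc j)) as"
    using assms by (simp add: Cons_nth_drop_Suc)
qed (use assms in simp)

lemma multilin_form_mult_at:
  assumes f: "multilin_form q A f" and j: "Suc j \<le> q"
    and closed: "\<And>a b. a \<in> A \<Longrightarrow> b \<in> A \<Longrightarrow> mu a b \<in> A"
    and left: "\<And>a b c d. a \<in> A \<Longrightarrow> b \<in> A \<Longrightarrow> d \<in> A \<Longrightarrow>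
      mu (eadd (escale c a) b) d = eadd (escale c (mu a d)) (mu b d)"
    and right: "\<And>a b c d. a \<in> A \<Longrightarrow> b \<in> A \<Longrightarrow> d \<in> A \<Longrightarrow>
      mu d (eadd (escale c a) b) = eadd (escale c (mu d a)) (mu d b)"
  shows "multilin_form (Suc q) A (\<lambda>as. f (mult_at mu j as))"
proof (rule multilin_formI)
  fix us a b vs c
  assume *: "length us + Suc (length vs) = Suc q" "set us \<subseteq> A" "set vs \<subseteq> A" "a \<in> A" "b \<in> A"
  \<comment> \<open>The varied slot lies left of the two multiplied entries, is the left factor, is
    the right factor, or lies right of them.\<close>
  consider "length us < j" | "length us = j" | "length us = Suc j" | "Suc j < length us" by linarith
  then show "f (mult_at mu j (us @ eadd (escale c a) b # vs))
      = c * f (mult_at mu j (us @ a # vs)) + f (mult_at mu j (us @ b # vs))"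
  proof cases
    case 1
    then have "Suc (j - Suc (length us)) < length vs" using *(1) j by linarith
    then obtain v1 p p' v2 where v: "vs = v1 @ p # p' # v2" "length v1 = j - Suc (length us)"
      by (rule list_split_two)
    have m: "mult_at mu j (us @ x # vs) = us @ x # v1 @ mu p p' # v2" for x
      using mult_at_append[of "us @ x # v1" j mu p p' v2] v 1 by simp
    have "f (us @ eadd (escale c a) b # (v1 @ mu p p' # v2))
        = c * f (us @ a # (v1 @ mu p p' # v2)) + f (us @ b # (v1 @ mu p p' # v2))"
      using * v closed by (intro multilin_formD[OF f]) auto
    then show ?thesis by (simp add: m)
  next
    case 2
    then obtain p' v2 where v: "vs = p' # v2" using *(1) j by (cases vs) auto
    have "f (us @ eadd (escale c (mu a p')) (mu b p') # v2)
        = c * f (us @ mu a p' # v2) + f (us @ mu b p' # v2)"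
      using * v closed by (intro multilin_formD[OF f]) auto
    then show ?thesis using 2 * left v by (simp add: mult_at_append)
  next
    case 3
    then obtain u1 p where u: "us = u1 @ [p]" "length u1 = j" by (auto simp: length_Suc_conv_rev)
    have "f (u1 @ eadd (escale c (mu p a)) (mu p b) # vs)
        = c * f (u1 @ mu p a # vs) + f (u1 @ mu p b # vs)"
      using * u closed by (intro multilin_formD[OF f]) auto
    then show ?thesis using u * right by (simp add: mult_at_append)
  next
    case 4
    then obtain u1 p p' u2 where u: "us = u1 @ p # p' # u2" "length u1 = j"
      by (rule list_split_two)
    have "f ((u1 @ mu p p' # u2) @ eadd (escale c a) b # vs)
        = c * f ((u1 @ mu p p' # u2) @ a # vs) + f ((u1 @ mu p p' # u2) @ b # vs)"
      using * u closed by (intro multilin_formD[OF f]) auto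
    then show ?thesis by (simp add: u mult_at_append)
  qed
qed

lemma multilin_form_map:
  assumes "multilin_form q A' f" "\<And>a. a \<in> A \<Longrightarrow> h a \<in> A'"
    and "\<And>a b c. a \<in> A \<Longrightarrow> b \<in> A \<Longrightarrow> h (eadd (escale c a) b) = eadd (escale c (h a)) (h b)"
  shows "multilin_form q A (\<lambda>as. f (map h as))"
proof (rule multilin_formI)
  fix us a b vs c
  assume *: "length us + Suc (length vs) = q" "set us \<subseteq> A" "set vs \<subseteq> A" "a \<in> A" "b \<in> A"
  have "f (map h us @ eadd (escale c (h a)) (h b) # map h vs)
      = c * f (map h us @ h a # map h vs) + f (map h us @ h b # map h vs)"
    using * assms(2) by (intro multilin_formD[OF assms(1)]) auto
  then show "f (map h (us @ eadd (escale c a) b # vs))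
      = c * f (map h (us @ a # vs)) + f (map h (us @ b # vs))"
    using * assms(3) by simp
qed

lemma ezero_in_inc_alg [simp]: "ezero \<in> inc_alg S"
  by (simp add: inc_alg_def ezero_def)

lemma eadd_in_inc_alg [simp]: "a \<in> inc_alg S \<Longrightarrow> b \<in> inc_alg S \<Longrightarrow> eadd a b \<in> inc_alg S"
  by (simp add: inc_alg_def eadd_def)

lemma escale_in_inc_alg [simp]: "a \<in> inc_alg S \<Longrightarrow> escale c a \<in> inc_alg S"
  by (simp add: inc_alg_def escale_def)

lemma esum_in_inc_alg: "(\<And>i. i \<in> I \<Longrightarrow> f i \<in> inc_alg S) \<Longrightarrow> esum f I \<in> inc_alg S"
  by (simp add: inc_alg_def esum_def)

lemma inc_mult_in_inc_alg [simp]: "inc_mult S a b \<in> inc_alg S"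
  by (auto simp: inc_alg_def inc_mult_def)

lemma inc_restr_in_inc_alg [simp]: "inc_restr S f a \<in> inc_alg S"
  by (auto simp: inc_alg_def inc_restr_def)

lemma basis_elt_in_inc_alg [simp]: "basis_elt p \<in> inc_alg S \<longleftrightarrow> p \<in> face_pairs S"
  by (cases p) (auto simp: inc_alg_def basis_elt_def)

lemma inc_mult_left_linear:
  "inc_mult S (eadd (escale c a) b) d = eadd (escale c (inc_mult S a d)) (inc_mult S b d)"
  by (auto simp: inc_mult_def eadd_def escale_def fun_eq_iff algebra_simps sum.distrib sum_distrib_left)

lemma inc_mult_right_linear:
  "inc_mult S d (eadd (escale c a) b) = eadd (escale c (inc_mult S d a)) (inc_mult S d b)"
  by (auto simp: inc_mult_def eadd_def escale_def fun_eq_iff algebra_simps sum.distrib sum_distrib_left)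

lemma inc_restr_linear:
  "inc_restr S f (eadd (escale c a) b) = eadd (escale c (inc_restr S f a)) (inc_restr S f b)"
  by (auto simp: inc_restr_def eadd_def escale_def fun_eq_iff)

lemma finite_face_pairs: "finite S \<Longrightarrow> finite (face_pairs S)"
  by (rule finite_subset[of _ "S \<times> S"]) (auto simp: face_pairs_def)

lemma multilin_form_zero_slot:
  assumes "multilin_form q (inc_alg S) f" "length us + Suc (length vs) = q"
    "set us \<subseteq> inc_alg S" "set vs \<subseteq> inc_alg S"
  shows "f (us @ ezero # vs) = 0"
proof -
  \<comment> \<open>Writing zero as \<open>-1\<close> times zero plus zero turns linearity into a
    value plus its negative.\<close>
  have "eadd (escale (-1) ezero) ezero = (ezero :: ('a, 'b) ielt)"
    by (simp add: eadd_def escale_def ezero_def)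
  then show ?thesis
    using multilin_formD[OF assms, of ezero ezero "-1"] by simp
qed

section \<open>Expansion in the standard basis\<close>

text \<open>The multilinear form whose values on lists of basis elements are prescribed by
  \<open>g\<close>.\<close>

primrec expand :: "'p set \<Rightarrow> ('p list \<Rightarrow> 'k::field) \<Rightarrow> ('p \<Rightarrow> 'k) list \<Rightarrow> 'k" where
  "expand P g [] = g []"
| "expand P g (a # as) = (\<Sum>p\<in>P. a p * expand P (\<lambda>ps. g (p # ps)) as)"

lemma multilin_form_expand: "multilin_form q A (expand P g)"
proof (rule multilin_formI)
  fix us vs :: "('a, 'b) ielt list" and a b :: "('a, 'b) ielt" and c
  show "expand P g (us @ eadd (escale c a) b # vs) = c * expand P g (us @ a # vs) + expand P g (us @ b # vs)"
    by (induction us arbitrary: g)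
      (simp_all add: eadd_def escale_def algebra_simps sum.distrib sum_distrib_left)
qed

lemma expand_basis:
  "finite P \<Longrightarrow> set ps \<subseteq> P \<Longrightarrow> expand P g (map basis_elt ps) = g ps"
proof (induction ps arbitrary: g)
  case (Cons p ps)
  then show ?case by (simp add: basis_elt_def if_distrib[of "\<lambda>x. x * _"] cong: if_cong)
qed simp

lemma expand_cong:
  "(\<And>ps. length ps = length as \<Longrightarrow> set ps \<subseteq> P \<Longrightarrow> f ps = g ps) \<Longrightarrow> expand P f as = expand P g as"
proof (induction as arbitrary: f g)
  case (Cons a as)
  have "expand P (\<lambda>ps. f (p # ps)) as = expand P (\<lambda>ps. g (p # ps)) as" if "p \<in> P" for p
    using that Cons.prems by (intro Cons.IH) simp
  then show ?case by simp
qed simp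

lemma multilin_form_eq_expand:
  fixes f :: "('v, 'k::field) ielt list \<Rightarrow> 'k"
  assumes "multilin_form q (inc_alg S) f" "finite S" "length as = q" "set as \<subseteq> inc_alg S"
  shows "f as = expand (face_pairs S) (\<lambda>ps. f (map basis_elt ps)) as"
  using assms(1,3,4)
proof (induction as arbitrary: q f)
  case (Cons a as)
  let ?P = "face_pairs S"
  have f: "multilin_form (Suc (length as)) (inc_alg S) f" using Cons.prems by simp
  \<comment> \<open>Linearity in a slot handles two summands at a time, so the basis expansion of
    \<open>a\<close> is built up over finite sets of indices.\<close>
  have *: "f ((\<lambda>p. if p \<in> P then a p else 0) # as) = (\<Sum>p\<in>P. a p * f (basis_elt p # as))"
    if "finite P" "P \<subseteq> ?P" for P
    using that
  proof (induction P)
    case empty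
    then show ?case
      using multilin_form_zero_slot[OF f, of "[]" as] Cons.prems by (simp add: ezero_def)
  next
    case (insert p P)
    let ?a = "\<lambda>p. if p \<in> P then a p else 0"
    have eq: "(\<lambda>p'. if p' \<in> insert p P then a p' else 0) = eadd (escale (a p) (basis_elt p)) ?a"
      using insert.hyps by (auto simp: eadd_def escale_def basis_elt_def)
    have "?a \<in> inc_alg S"
      using insert.prems by (auto simp: inc_alg_def)
    then have "f (eadd (escale (a p) (basis_elt p)) ?a # as) = a p * f (basis_elt p # as) + f (?a # as)"
      using multilin_formD[OF f, of "[]" as "basis_elt p" ?a "a p"] Cons.prems insert.prems by simp
    then show ?case using insert unfolding eq by simp
  qed
  have "(\<lambda>p. if p \<in> ?P then a p else 0) = a"
    using Cons.prems by (auto simp: inc_alg_def)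
  then have "f (a # as) = (\<Sum>p\<in>?P. a p * f (basis_elt p # as))"
    using *[of ?P] finite_face_pairs[OF assms(2)] by simp
  also have "\<dots> = (\<Sum>p\<in>?P. a p * expand ?P (\<lambda>ps. f (basis_elt p # map basis_elt ps)) as)"
  proof (rule sum.cong)
    fix p assume p: "p \<in> ?P"
    have "multilin_form (length as) (inc_alg S) (\<lambda>as. f (basis_elt p # as))"
    proof (rule multilin_formI)
      fix us vs :: "('v, 'k) ielt list" and x y :: "('v, 'k) ielt" and c
      assume "length us + Suc (length vs) = length as" "set us \<subseteq> inc_alg S" "set vs \<subseteq> inc_alg S"
        "x \<in> inc_alg S" "y \<in> inc_alg S"
      then show "f (basis_elt p # us @ eadd (escale c x) y # vs)
          = c * f (basis_elt p # us @ x # vs) + f (basis_elt p # us @ y # vs)"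
        using multilin_formD[OF f, of "basis_elt p # us" vs x y c] p by simp
    qed
    then show "a p * f (basis_elt p # as)
        = a p * expand ?P (\<lambda>ps. f (basis_elt p # map basis_elt ps)) as"
      using Cons.IH[of "length as" "\<lambda>as. f (basis_elt p # as)"] Cons.prems by simp
  qed simp
  finally show ?case by simp
qed simp

lemma multilinear_eqI:
  assumes F: "multilinear q (inc_alg S) B F" and G: "multilinear q (inc_alg S) B' G" and "finite S"
    and eq: "\<And>ps. length ps = q \<Longrightarrow> set ps \<subseteq> face_pairs S \<Longrightarrow> F (map basis_elt ps) = G (map basis_elt ps)"
  shows "F = G"
proof (intro ext)
  fix as r
  show "F as r = G as r"
  proof (cases "length as = q \<and> set as \<subseteq> inc_alg S")
    case True
    have "F as r = expand (face_pairs S) (\<lambda>ps. F (map basis_elt ps) r) as"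
      using F True \<open>finite S\<close>
      unfolding multilinear_iff by (intro multilin_form_eq_expand[of q S "\<lambda>as. F as r"]) blast+
    also have "\<dots> = expand (face_pairs S) (\<lambda>ps. G (map basis_elt ps) r) as"
      using True by (intro expand_cong) (simp add: eq)
    also have "\<dots> = G as r"
      using G True \<open>finite S\<close>
      unfolding multilinear_iff
      by (intro multilin_form_eq_expand[of q S "\<lambda>as. G as r", symmetric]) blast+
    finally show ?thesis .
  next
    case False
    then show ?thesis using F G by (simp add: multilinear_iff)
  qed
qed

section \<open>The Gerstenhaber--Schack differential preserves multilinearity\<close>

lemma chains_remove_nth:
  assumes "\<sigma> \<in> chains n (Suc p)" "r \<le> Suc p"
  shows "remove_nth r \<sigma> \<in> chains n p"
  using assms set_remove_nth[of r \<sigma>]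
  by (auto simp: chains_def length_remove_nth sorted_wrt_remove_nth)

lemma tl_eq_remove_nth: "tl xs = remove_nth 0 xs"
  by (simp add: remove_nth_def drop_Suc)

lemma butlast_eq_remove_nth: "butlast xs = remove_nth (length xs - 1) xs"
  by (simp add: remove_nth_def butlast_conv_take)

lemma hd_remove_nth: "0 < r \<Longrightarrow> r < length xs \<Longrightarrow> hd (remove_nth r xs) = hd xs"
  by (cases xs; cases r) (simp_all add: remove_nth_def)

lemma last_remove_nth: "Suc r < length xs \<Longrightarrow> last (remove_nth r xs) = last xs"
  by (simp add: remove_nth_def)

lemma GS_cochains_multilinear:
  assumes "\<Gamma> \<in> GS_cochains n Sig m" "\<sigma> \<in> chains n p" "p \<le> m"
  shows "multilinear (m - p) (inc_alg (Sig (last \<sigma>))) (inc_alg (Sig (hd \<sigma>))) (\<Gamma> \<sigma>)"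
proof -
  have "multilinear (Suc m - length \<sigma>) (inc_alg (Sig (last \<sigma>))) (inc_alg (Sig (hd \<sigma>))) (\<Gamma> \<sigma>)"
  proof -
    have "\<exists>p\<le>m. \<sigma> \<in> chains n p" using assms(2,3) by blast
    moreover have "if \<exists>p\<le>m. \<sigma> \<in> chains n p
      then multilinear (Suc m - length \<sigma>) (inc_alg (Sig (last \<sigma>))) (inc_alg (Sig (hd \<sigma>))) (\<Gamma> \<sigma>)
      else \<Gamma> \<sigma> = (\<lambda>_. ezero)"
      using assms(1) unfolding GS_cochains_def by blast
    ultimately show ?thesis by (simp only: if_True)
  qed
  then show ?thesis using assms(2) by (simp add: chains_def)
qed

lemma GS_cochains_values:
  assumes "\<Gamma> \<in> GS_cochains n Sig m"
  shows "\<Gamma> \<sigma> as \<in> inc_alg (Sig (hd \<sigma>))"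
proof (cases "\<exists>p\<le>m. \<sigma> \<in> chains n p")
  case True
  then obtain p where "p \<le> m" "\<sigma> \<in> chains n p" by blast
  then have "multilinear (m - p) (inc_alg (Sig (last \<sigma>))) (inc_alg (Sig (hd \<sigma>))) (\<Gamma> \<sigma>)"
    using GS_cochains_multilinear[OF assms] by blast
  then show ?thesis
    unfolding multilinear_iff by (cases "length as = m - p \<and> set as \<subseteq> inc_alg (Sig (last \<sigma>))") auto
next
  case False
  moreover have "if \<exists>p\<le>m. \<sigma> \<in> chains n p
      then multilinear (Suc m - length \<sigma>) (inc_alg (Sig (last \<sigma>))) (inc_alg (Sig (hd \<sigma>))) (\<Gamma> \<sigma>)
      else \<Gamma> \<sigma> = (\<lambda>_. ezero)"
    using assms(1) unfolding GS_cochains_def by blast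
  ultimately have "\<Gamma> \<sigma> = (\<lambda>_. ezero)" by (simp only: if_False)
  then show ?thesis by simp
qed

lemma inc_mult_apply:
  "inc_mult S a b (x, z) = (if (x, z) \<in> face_pairs S
     then (\<Sum>y\<in>{y \<in> S. x \<subseteq> y \<and> y \<subseteq> z}. a (x, y) * b (y, z)) else 0)"
  by (simp add: inc_mult_def)

lemma inc_restr_apply:
  "inc_restr S f a (x, y) = (if (x, y) \<in> face_pairs S then a (f ` x, f ` y) else 0)"
  by (simp add: inc_restr_def)

lemma hoch_part_eq:
  "hoch_part Sig phi \<Gamma> \<sigma> as (x, z) =
    (if (x, z) \<in> face_pairs (Sig (hd \<sigma>)) then
      (\<Sum>y\<in>{y \<in> Sig (hd \<sigma>). x \<subseteq> y \<and> y \<subseteq> z}.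
         inc_restr (Sig (hd \<sigma>)) (phi (hd \<sigma>) (last \<sigma>)) (hd as) (x, y) * \<Gamma> \<sigma> (tl as) (y, z)) else 0)
    + ((\<Sum>i\<in>{1..<length as}. (-1) ^ i * \<Gamma> \<sigma> (mult_at (inc_mult (Sig (last \<sigma>))) (i - 1) as) (x, z))
    + (-1) ^ length as * (if (x, z) \<in> face_pairs (Sig (hd \<sigma>)) then
      (\<Sum>y\<in>{y \<in> Sig (hd \<sigma>). x \<subseteq> y \<and> y \<subseteq> z}.
         \<Gamma> \<sigma> (butlast as) (x, y) * inc_restr (Sig (hd \<sigma>)) (phi (hd \<sigma>) (last \<sigma>)) (last as) (y, z)) else 0))"
proof -
  have "(\<Sum>i\<in>{1..<length as}. (-1) ^ i * \<Gamma> \<sigma> (take (i - 1) as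
        @ [inc_mult (Sig (last \<sigma>)) (as ! (i - 1)) (as ! i)] @ drop (Suc i) as) (x, z))
      = (\<Sum>i\<in>{1..<length as}. (-1) ^ i * \<Gamma> \<sigma> (mult_at (inc_mult (Sig (last \<sigma>))) (i - 1) as) (x, z))"
    by (rule sum.cong) (simp_all add: mult_at_def)
  then show ?thesis
    unfolding hoch_part_def Let_def eadd_def esum_def escale_def inc_mult_apply by (simp only:)
qed

lemma simp_part_eq:
  assumes "2 \<le> length \<sigma>"
  shows "simp_part Sig phi \<Gamma> \<sigma> as (x, z) =
    (if (x, z) \<in> face_pairs (Sig (hd \<sigma>))
     then \<Gamma> (tl \<sigma>) as (phi (hd \<sigma>) (hd (tl \<sigma>)) ` x, phi (hd \<sigma>) (hd (tl \<sigma>)) ` z) else 0)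
    + ((\<Sum>r\<in>{1..<length \<sigma> - 1}. (-1) ^ r * \<Gamma> (remove_nth r \<sigma>) as (x, z))
    + (-1) ^ (length \<sigma> - 1) * \<Gamma> (butlast \<sigma>)
       (map (inc_restr (Sig (last (butlast \<sigma>))) (phi (last (butlast \<sigma>)) (last \<sigma>))) as) (x, z))"
proof -
  have "\<sigma> ! 0 = hd \<sigma>" "\<sigma> ! 1 = hd (tl \<sigma>)" "\<sigma> ! (length \<sigma> - 1) = last \<sigma>"
    "\<sigma> ! (length \<sigma> - 1 - 1) = last (butlast \<sigma>)"
  proof -
    obtain a b \<tau> where s: "\<sigma> = a # b # \<tau>"
      using assms by (auto simp: Suc_le_length_iff numeral_2_eq_2)
    then show "\<sigma> ! 0 = hd \<sigma>" "\<sigma> ! 1 = hd (tl \<sigma>)" by simp_all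
    have "\<sigma> \<noteq> []" "butlast \<sigma> \<noteq> []" using s by simp_all
    then show "\<sigma> ! (length \<sigma> - 1) = last \<sigma>" "\<sigma> ! (length \<sigma> - 1 - 1) = last (butlast \<sigma>)"
      using assms nth_butlast[of "length \<sigma> - 1 - 1" \<sigma>] by (simp_all add: last_conv_nth)
  qed
  then show ?thesis
    unfolding simp_part_def Let_def eadd_def esum_def escale_def
    by (simp only: inc_restr_apply)
qed

lemma linear_on_inc_restr: "linear_on A (\<lambda>a. inc_restr S f a r)"
  by (simp add: linear_on_def inc_restr_linear) (simp add: eadd_def escale_def)

lemma multilin_form_cong:
  assumes "multilin_form q A f"
    and "\<And>as. length as = q \<Longrightarrow> set as \<subseteq> inc_alg S \<Longrightarrow> f as = g as" "A = inc_alg S"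
  shows "multilin_form q A g"
proof (rule multilin_formI)
  fix us a b vs c
  assume *: "length us + Suc (length vs) = q" "set us \<subseteq> A" "set vs \<subseteq> A" "a \<in> A" "b \<in> A"
  then show "g (us @ eadd (escale c a) b # vs) = c * g (us @ a # vs) + g (us @ b # vs)"
    using multilin_formD[OF assms(1) *, of c] by (simp add: assms(2,3))
qed

lemma multilin_form_hoch_part:
  assumes F: "\<And>r. multilin_form q (inc_alg (Sig (last \<sigma>))) (\<lambda>as. \<Gamma> \<sigma> as r)"
  shows "multilin_form (Suc q) (inc_alg (Sig (last \<sigma>))) (\<lambda>as. hoch_part Sig phi \<Gamma> \<sigma> as r)"
proof (cases r)
  case (Pair x z)
  let ?A = "inc_alg (Sig (last \<sigma>))" and ?S = "Sig (hd \<sigma>)"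
  let ?r = "inc_restr ?S (phi (hd \<sigma>) (last \<sigma>))"
  have "multilin_form (Suc q) ?A (\<lambda>as. (if (x, z) \<in> face_pairs ?S then
      (\<Sum>y\<in>{y \<in> ?S. x \<subseteq> y \<and> y \<subseteq> z}. ?r (hd as) (x, y) * \<Gamma> \<sigma> (tl as) (y, z)) else 0)
    + ((\<Sum>i\<in>{1..<Suc q}. (-1) ^ i * \<Gamma> \<sigma> (mult_at (inc_mult (Sig (last \<sigma>))) (i - 1) as) (x, z))
    + (-1) ^ Suc q * (if (x, z) \<in> face_pairs ?S then
      (\<Sum>y\<in>{y \<in> ?S. x \<subseteq> y \<and> y \<subseteq> z}. \<Gamma> \<sigma> (butlast as) (x, y) * ?r (last as) (y, z)) else 0)))"
  proof (intro multilin_form_add multilin_form_mult)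
    show "multilin_form (Suc q) ?A (\<lambda>as. if (x, z) \<in> face_pairs ?S then
      (\<Sum>y\<in>{y \<in> ?S. x \<subseteq> y \<and> y \<subseteq> z}. ?r (hd as) (x, y) * \<Gamma> \<sigma> (tl as) (y, z)) else 0)"
      by (cases "(x, z) \<in> face_pairs ?S")
        (simp_all add: multilin_form_zero multilin_form_sum multilin_form_hd_tl[OF linear_on_inc_restr F])
    show "multilin_form (Suc q) ?A (\<lambda>as. if (x, z) \<in> face_pairs ?S then
      (\<Sum>y\<in>{y \<in> ?S. x \<subseteq> y \<and> y \<subseteq> z}. \<Gamma> \<sigma> (butlast as) (x, y) * ?r (last as) (y, z)) else 0)"
      by (cases "(x, z) \<in> face_pairs ?S")
        (simp_all add: multilin_form_zero multilin_form_sum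
          multilin_form_butlast_last[OF linear_on_inc_restr F])
    show "multilin_form (Suc q) ?A
      (\<lambda>as. \<Sum>i\<in>{1..<Suc q}. (-1) ^ i * \<Gamma> \<sigma> (mult_at (inc_mult (Sig (last \<sigma>))) (i - 1) as) (x, z))"
      by (intro multilin_form_sum multilin_form_mult multilin_form_mult_at[OF F])
        (auto simp: inc_mult_left_linear inc_mult_right_linear)
  qed
  then show ?thesis
    by (rule multilin_form_cong) (simp_all only: Pair hoch_part_eq)
qed

lemma multilin_form_simp_part:
  assumes len: "2 \<le> length \<sigma>"
    and F: "\<And>i r. i < length \<sigma> \<Longrightarrow>
      multilin_form q (inc_alg (Sig (last (remove_nth i \<sigma>)))) (\<lambda>as. \<Gamma> (remove_nth i \<sigma>) as r)"
  shows "multilin_form q (inc_alg (Sig (last \<sigma>))) (\<lambda>as. simp_part Sig phi \<Gamma> \<sigma> as r)"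
proof (cases r)
  case (Pair x z)
  have F': "multilin_form q (inc_alg (Sig (last \<sigma>))) (\<lambda>as. \<Gamma> (remove_nth i \<sigma>) as r)"
    if "Suc i < length \<sigma>" for i r
    using F[of i] that by (simp add: last_remove_nth)
  have tl: "multilin_form q (inc_alg (Sig (last \<sigma>))) (\<lambda>as. \<Gamma> (tl \<sigma>) as r)" for r
    using F'[of 0] len by (simp add: tl_eq_remove_nth)
  have butlast: "multilin_form q (inc_alg (Sig (last (butlast \<sigma>)))) (\<lambda>as. \<Gamma> (butlast \<sigma>) as r)" for r
    using F[of "length \<sigma> - 1"] len by (simp add: butlast_eq_remove_nth)
  show ?thesis
    unfolding Pair simp_part_eq[OF len]
  proof (intro multilin_form_add multilin_form_mult)
    show "multilin_form q (inc_alg (Sig (last \<sigma>))) (\<lambda>as. if (x, z) \<in> face_pairs (Sig (hd \<sigma>))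
        then \<Gamma> (tl \<sigma>) as (phi (hd \<sigma>) (hd (tl \<sigma>)) ` x, phi (hd \<sigma>) (hd (tl \<sigma>)) ` z) else 0)"
      by (cases "(x, z) \<in> face_pairs (Sig (hd \<sigma>))") (simp_all add: tl multilin_form_zero)
    show "multilin_form q (inc_alg (Sig (last \<sigma>)))
       (\<lambda>as. \<Sum>r\<in>{1..<length \<sigma> - 1}. (-1) ^ r * \<Gamma> (remove_nth r \<sigma>) as (x, z))"
      by (intro multilin_form_sum multilin_form_mult F') auto
    show "multilin_form q (inc_alg (Sig (last \<sigma>)))
       (\<lambda>as. \<Gamma> (butlast \<sigma>)
         (map (inc_restr (Sig (last (butlast \<sigma>))) (phi (last (butlast \<sigma>)) (last \<sigma>))) as) (x, z))"
      by (rule multilin_form_map[OF butlast]) (simp_all add: inc_restr_linear)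
  qed
qed

text \<open>Cochains are compared later through their values on basis elements, which is legitimate
  only for multilinear families; this admits differentials to that comparison.\<close>

lemma GS_diff_cochains:
  fixes \<Gamma> :: "('v, 'k::field) gs_cochain"
  assumes \<Gamma>: "\<Gamma> \<in> GS_cochains n Sig m"
  shows "GS_diff n Sig phi m \<Gamma> \<in> GS_cochains n Sig (Suc m)"
proof -
  have "multilinear (Suc (Suc m) - length \<sigma>) (inc_alg (Sig (last \<sigma>))) (inc_alg (Sig (hd \<sigma>)))
      (GS_diff n Sig phi m \<Gamma> \<sigma>)" if p: "p \<le> Suc m" "\<sigma> \<in> chains n p" for \<sigma> p
  proof -
    let ?A = "inc_alg (Sig (last \<sigma>))" and ?B = "inc_alg (Sig (hd \<sigma>))"
    define q where "q = Suc (Suc m) - length \<sigma>"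
    have len: "length \<sigma> = Suc p" using p(2) unfolding chains_def by blast
    let ?h = "\<lambda>as. if 1 \<le> q then escale ((-1) ^ (length \<sigma> - 1)) (hoch_part Sig phi \<Gamma> \<sigma> as) else ezero"
    let ?s = "\<lambda>as. if 2 \<le> length \<sigma> then simp_part Sig phi \<Gamma> \<sigma> as else ezero"
    have ex: "\<exists>p\<le>Suc m. \<sigma> \<in> chains n p" using p by blast
    have eq: "GS_diff n Sig phi m \<Gamma> \<sigma> as
        = (if length as = q \<and> set as \<subseteq> ?A then eadd (?h as) (?s as) else ezero)" for as
      unfolding GS_diff_def q_def[symmetric] by (simp only: ex simp_thms cong: if_cong)
    have vals: "\<Gamma> \<tau> as \<in> inc_alg (Sig (hd \<tau>))" for \<tau> as
      by (rule GS_cochains_values[OF \<Gamma>])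
    have "hoch_part Sig phi \<Gamma> \<sigma> as \<in> ?B" for as
      unfolding hoch_part_def Let_def
      by (intro eadd_in_inc_alg escale_in_inc_alg esum_in_inc_alg inc_mult_in_inc_alg vals)
    moreover have "simp_part Sig phi \<Gamma> \<sigma> as \<in> ?B" if l: "2 \<le> length \<sigma>" for as
    proof -
      have 1: "\<sigma> ! 0 = hd \<sigma>" using l by (cases \<sigma>) auto
      have 2: "\<Gamma> (remove_nth r \<sigma>) as \<in> ?B" if "0 < r" "r < length \<sigma>" for r as
        using vals[of "remove_nth r \<sigma>" as] that by (simp add: hd_remove_nth)
      have 3: "\<Gamma> (butlast \<sigma>) as \<in> ?B" for as
        using 2[of "length \<sigma> - 1"] l by (simp add: butlast_eq_remove_nth)
      show ?thesis
        unfolding simp_part_def Let_def 1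
        by (intro eadd_in_inc_alg escale_in_inc_alg esum_in_inc_alg inc_restr_in_inc_alg 2 3) auto
    qed
    ultimately have val: "eadd (?h as) (?s as) \<in> ?B" for as
      by simp
    have form: "multilin_form q ?A (\<lambda>as. eadd (?h as) (?s as) r)" for r
    proof -
      have "multilin_form q ?A (\<lambda>as. ?h as r)"
      proof (cases q)
        case 0
        then show ?thesis by (simp add: ezero_def multilin_form_zero)
      next
        case (Suc q')
        then have qp: "q = Suc (m - p)" using len by (simp add: q_def)
        have "multilin_form (m - p) ?A (\<lambda>as. \<Gamma> \<sigma> as r)" for r
          using multilinearD[OF GS_cochains_multilinear[OF \<Gamma> p(2)]] Suc len unfolding q_def by auto
        then show ?thesis
          using multilin_form_hoch_part[of "m - p" Sig \<sigma> \<Gamma> phi r] qp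
          by (simp add: escale_def multilin_form_mult)
      qed
      moreover have "multilin_form q ?A (\<lambda>as. ?s as r)"
      proof (cases "2 \<le> length \<sigma>")
        case True
        then obtain p' where p': "p = Suc p'" using len by (cases p) auto
        have "multilin_form q (inc_alg (Sig (last (remove_nth i \<sigma>)))) (\<lambda>as. \<Gamma> (remove_nth i \<sigma>) as r)"
          if "i < length \<sigma>" for i r
        proof -
          have "remove_nth i \<sigma> \<in> chains n p'" using p(2) that len p' chains_remove_nth by simp
          from multilinearD[OF GS_cochains_multilinear[OF \<Gamma> this]] show ?thesis
            using p p' len unfolding q_def by simp
        qed
        then have "multilin_form q ?A (\<lambda>as. simp_part Sig phi \<Gamma> \<sigma> as r)"
          by (rule multilin_form_simp_part[OF True])
        then show ?thesis using True by simp
      qed (simp add: ezero_def multilin_form_zero)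
      ultimately show ?thesis
        unfolding eadd_def by (rule multilin_form_add)
    qed
    show ?thesis
      unfolding q_def[symmetric] multilinear_iff
    proof (intro conjI allI impI)
      fix r
      show "multilin_form q ?A (\<lambda>as. GS_diff n Sig phi m \<Gamma> \<sigma> as r)"
        using form[of r] by (rule multilin_form_cong) (simp_all only: eq simp_thms if_True)
    next
      fix as :: "('v, 'k) ielt list"
      assume "length as = q \<and> set as \<subseteq> ?A"
      then show "GS_diff n Sig phi m \<Gamma> \<sigma> as \<in> ?B"
        unfolding eq using val[of as] by (simp only: simp_thms if_True)
    next
      fix as :: "('v, 'k) ielt list"
      assume "\<not> (length as = q \<and> set as \<subseteq> ?A)"
      then show "GS_diff n Sig phi m \<Gamma> \<sigma> as = ezero"
        unfolding eq by (simp only: if_False)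
    qed
  qed
  moreover have "GS_diff n Sig phi m \<Gamma> \<sigma> = (\<lambda>_. ezero)" if "\<not> (\<exists>p\<le>Suc m. \<sigma> \<in> chains n p)" for \<sigma>
    unfolding GS_diff_def by (rule ext, rule if_not_P) (use that in blast)
  ultimately show ?thesis
    unfolding GS_cochains_def mem_Collect_eq if_bool_eq_conj by blast
qed

section \<open>The Hochschild differential on lists with end pairs\<close>

definition compose :: "'a \<times> 'a \<Rightarrow> 'a \<times> 'a \<Rightarrow> 'a \<times> 'a" where
  "compose p p' = (fst p, snd p')"

lemma mult_at_Cons: "mult_at mu (Suc j) (a # as) = a # mult_at mu j as"
  by (simp add: mult_at_def)

lemma mult_at_Cons_Cons: "mult_at mu 0 (a # b # as) = mu a b # as"
  by (simp add: mult_at_def)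

lemma hoch_eq_sum:
  "hoch G L = (\<Sum>i<length L - 1. (-1) ^ i *
     (if snd (L ! i) = fst (L ! Suc i) then G (mult_at compose i L) else 0))"
proof (induction G L rule: hoch.induct)
  case (1 G p p' L)
  have "(\<Sum>i<length (p # p' # L) - 1. (-1) ^ i *
      (if snd ((p # p' # L) ! i) = fst ((p # p' # L) ! Suc i) then G (mult_at compose i (p # p' # L)) else 0))
    = (if snd p = fst p' then G (compose p p' # L) else 0)
      + (\<Sum>i<length L. (-1) ^ Suc i * (if snd ((p' # L) ! i) = fst ((p' # L) ! Suc i)
          then G (p # mult_at compose i (p' # L)) else 0))"
    by (simp add: sum.lessThan_Suc_shift mult_at_Cons mult_at_Cons_Cons cong: if_cong
        del: sum.lessThan_Suc)
  also have "\<dots> = hoch G (p # p' # L)"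
    using "1.IH" by (simp add: compose_def sum_negf)
  finally show ?case by simp
qed simp_all

lemma ex_map_conv_subset: "set ys \<subseteq> f ` A \<Longrightarrow> \<exists>xs. ys = map f xs \<and> set xs \<subseteq> A"
proof -
  assume "set ys \<subseteq> f ` A"
  then have "ys \<in> lists (f ` A)" by auto
  then show ?thesis unfolding lists_image by auto
qed

text \<open>The two \<open>{}\<close> play the role of the star: they are dummies at the outer ends,
  where composability compares nothing.\<close>

definition wrap :: "'v set \<Rightarrow> ('v set \<times> 'v set) list \<Rightarrow> 'v set \<Rightarrow> ('v set \<times> 'v set) list" where
  "wrap X ps Z = ({}, X) # ps @ [(Z, {})]"

lemma wrap_eq_iff [simp]: "wrap X ps Z = wrap X' ps' Z' \<longleftrightarrow> X = X' \<and> ps = ps' \<and> Z = Z'"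
  by (auto simp: wrap_def)

text \<open>Joining the first end pair to the list is left multiplication, joining the last one is
  right multiplication. They are separated from the inner products to match the three parts of
  \<open>hoch_part\<close>.\<close>

lemma hoch_wrap:
  assumes "ps \<noteq> []"
  shows "hoch G (wrap X ps Z) =
    (if X = fst (hd ps) then G (wrap (snd (hd ps)) (tl ps) Z) else 0)
    + ((\<Sum>i\<in>{1..<length ps}. (-1) ^ i * (if snd (ps ! (i - 1)) = fst (ps ! i)
          then G (wrap X (mult_at compose (i - 1) ps) Z) else 0))
    + (-1) ^ length ps * (if snd (last ps) = Z then G (wrap X (butlast ps) (fst (last ps))) else 0))"
proof -
  let ?L = "wrap X ps Z" and ?q = "length ps"
  define t where "t i = (-1) ^ i *
    (if snd (?L ! i) = fst (?L ! Suc i) then G (mult_at compose i ?L) else 0)" for i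
  have "hoch G ?L = sum t {..<Suc ?q}"
    unfolding hoch_eq_sum t_def by (simp add: wrap_def)
  also have "{..<Suc ?q} = insert 0 (insert ?q {1..<?q})"
    using assms by (auto simp: Suc_le_eq)
  also have "sum t \<dots> = t 0 + (sum t {1..<?q} + t ?q)"
    using assms by simp
  also have "t 0 = (if X = fst (hd ps) then G (wrap (snd (hd ps)) (tl ps) Z) else 0)"
    using assms by (cases ps) (simp_all add: t_def wrap_def mult_at_Cons_Cons compose_def)
  also have "t ?q = (-1) ^ ?q * (if snd (last ps) = Z then G (wrap X (butlast ps) (fst (last ps))) else 0)"
  proof -
    obtain ps' p where ps: "ps = ps' @ [p]" using assms by (metis rev_exhaust)
    have "mult_at compose ?q ?L = wrap X ps' (fst p)"
      using mult_at_append[of "({}, X) # ps'" ?q compose p "(Z, {})" "[]"]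
      by (simp add: wrap_def ps compose_def)
    then show ?thesis
      by (simp add: t_def ps wrap_def nth_append)
  qed
  also have "sum t {1..<?q} = (\<Sum>i\<in>{1..<?q}. (-1) ^ i * (if snd (ps ! (i - 1)) = fst (ps ! i)
          then G (wrap X (mult_at compose (i - 1) ps) Z) else 0))"
  proof (rule sum.cong)
    fix i assume "i \<in> {1..<?q}"
    then obtain j where i: "i = Suc j" "Suc j < ?q" by (cases i) auto
    then obtain us p p' vs where ps: "ps = us @ p # p' # vs" "length us = j"
      by (metis list_split_two)
    have "mult_at compose i ?L = wrap X (mult_at compose j ps) Z"
      using mult_at_append[of "({}, X) # us" i compose p p' "vs @ [(Z, {})]"] ps i
      by (simp add: mult_at_append wrap_def)
    then show "t i = (-1) ^ i * (if snd (ps ! (i - 1)) = fst (ps ! i)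
          then G (wrap X (mult_at compose (i - 1) ps) Z) else 0)"
      by (simp add: t_def i ps wrap_def nth_append)
  qed simp
  finally show ?thesis .
qed

lemma hoch_wrap_Nil: "hoch G (wrap X [] Z) = (if X = Z then G [({}, {})] else 0)"
  by (simp add: wrap_def)

lemma inc_mult_basis_elt:
  assumes "finite S" "(a, b) \<in> face_pairs S" "(b', c) \<in> face_pairs S"
  shows "inc_mult S (basis_elt (a, b)) (basis_elt (b', c))
    = (if b = b' then basis_elt (a, c) else (ezero :: ('v, 'k::field) ielt))"
proof (rule ext, clarify)
  fix x z
  have "(\<Sum>y\<in>{y \<in> S. x \<subseteq> y \<and> y \<subseteq> z}. basis_elt (a, b) (x, y) * basis_elt (b', c) (y, z))
      = (\<Sum>y\<in>{y \<in> S. x \<subseteq> y \<and> y \<subseteq> z}. if y = b then (if x = a \<and> b = b' \<and> z = c then 1 else 0) else (0::'k))"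
    by (rule sum.cong) (auto simp: basis_elt_def)
  also have "\<dots> = (if b \<in> S \<and> x \<subseteq> b \<and> b \<subseteq> z \<and> x = a \<and> b = b' \<and> z = c then 1 else 0)"
    using assms(1) by auto
  finally have sum: "(\<Sum>y\<in>{y \<in> S. x \<subseteq> y \<and> y \<subseteq> z}. basis_elt (a, b) (x, y) * basis_elt (b', c) (y, z))
      = (if b \<in> S \<and> x \<subseteq> b \<and> b \<subseteq> z \<and> x = a \<and> b = b' \<and> z = c then 1 else (0::'k))" .
  show "inc_mult S (basis_elt (a, b)) (basis_elt (b', c)) (x, z)
      = (if b = b' then basis_elt (a, c) else (ezero :: ('v, 'k) ielt)) (x, z)"
    unfolding inc_mult_apply sum
    using assms(2,3) by (cases "x = a \<and> z = c") (auto simp: basis_elt_def ezero_def face_pairs_def)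
qed

section \<open>Faces of the filtration inside the top complex\<close>

locale filtered_complex =
  fixes n :: nat and Sig :: "nat \<Rightarrow> 'v set set" and phi :: "nat \<Rightarrow> nat \<Rightarrow> 'v \<Rightarrow> 'v"
  assumes filtration: "filtration n Sig phi"
begin

text \<open>All faces are pushed into \<open>\<Sigma>\<^sub>n\<close>, so that coordinates for different strings of \<open>[n]\<close> can
  be compared. The restriction of a basis element of \<open>I(\<Sigma>\<^sub>n)\<close> to \<open>\<Sigma>\<^sub>i\<close> is the corresponding basis
  element, or \<open>0\<close> if its faces do not lie in the image of \<open>\<Sigma>\<^sub>i\<close>.\<close>

definition img :: "nat \<Rightarrow> 'v set \<Rightarrow> 'v set" where
  "img i x = phi i n ` x"

definition faces_in :: "nat \<Rightarrow> 'v set set" where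
  "faces_in i = img i ` Sig i"

definition restr_basis :: "nat \<Rightarrow> 'v set \<times> 'v set \<Rightarrow> ('v, 'k::field) ielt" where
  "restr_basis i p = inc_restr (Sig i) (phi i n) (basis_elt p)"

lemma simplicial_complex: "i \<le> n \<Longrightarrow> simplicial_complex (Sig i)"
  using filtration unfolding filtration_def by blast

lemma inj_simplicial_map: "i \<le> j \<Longrightarrow> j \<le> n \<Longrightarrow> inj_simplicial_map (Sig i) (Sig j) (phi i j)"
  using filtration unfolding filtration_def by blast

lemma finite_Sig: "i \<le> n \<Longrightarrow> finite (Sig i)"
  using simplicial_complex unfolding simplicial_complex_def by blast

lemma face_finite: "i \<le> n \<Longrightarrow> x \<in> Sig i \<Longrightarrow> finite x \<and> x \<noteq> {}"
  using simplicial_complex unfolding simplicial_complex_def by blast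

lemma face_subset: "i \<le> n \<Longrightarrow> x \<in> Sig i \<Longrightarrow> t \<subseteq> x \<Longrightarrow> t \<noteq> {} \<Longrightarrow> t \<in> Sig i"
  using simplicial_complex unfolding simplicial_complex_def by blast

lemma phi_face: "i \<le> j \<Longrightarrow> j \<le> n \<Longrightarrow> x \<in> Sig i \<Longrightarrow> phi i j ` x \<in> Sig j"
  using inj_simplicial_map unfolding inj_simplicial_map_def by blast

lemma inj_on_phi: "i \<le> j \<Longrightarrow> j \<le> n \<Longrightarrow> inj_on (phi i j) (\<Union>(Sig i))"
  using inj_simplicial_map unfolding inj_simplicial_map_def by blast

lemma phi_subset_iff:
  "i \<le> j \<Longrightarrow> j \<le> n \<Longrightarrow> x \<in> Sig i \<Longrightarrow> y \<in> Sig i \<Longrightarrow> phi i j ` x \<subseteq> phi i j ` y \<longleftrightarrow> x \<subseteq> y"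
proof
  assume *: "i \<le> j" "j \<le> n" "x \<in> Sig i" "y \<in> Sig i" "phi i j ` x \<subseteq> phi i j ` y"
  show "x \<subseteq> y"
  proof
    fix v assume "v \<in> x"
    then have "v \<in> \<Union>(Sig i)" "phi i j v \<in> phi i j ` y" using * by auto
    then show "v \<in> y"
      using inj_on_image_mem_iff[OF inj_on_phi[OF *(1,2)], of v y] *(4) by auto
  qed
qed (rule image_mono)

lemma img_subset_iff: "i \<le> n \<Longrightarrow> x \<in> Sig i \<Longrightarrow> y \<in> Sig i \<Longrightarrow> img i x \<subseteq> img i y \<longleftrightarrow> x \<subseteq> y"
  by (simp add: img_def phi_subset_iff)

lemma img_eq_iff: "i \<le> n \<Longrightarrow> x \<in> Sig i \<Longrightarrow> y \<in> Sig i \<Longrightarrow> img i x = img i y \<longleftrightarrow> x = y"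
  by (simp add: set_eq_subset img_subset_iff)

lemma img_phi: "i \<le> j \<Longrightarrow> j \<le> n \<Longrightarrow> x \<in> Sig i \<Longrightarrow> img j (phi i j ` x) = img i x"
proof -
  assume *: "i \<le> j" "j \<le> n" "x \<in> Sig i"
  then have "\<forall>v\<in>\<Union>(Sig i). phi j n (phi i j v) = phi i n v"
    using filtration unfolding filtration_def by blast
  then show ?thesis
    unfolding img_def image_image using *(3) by (intro image_cong) auto
qed

lemma img_n: "x \<in> Sig n \<Longrightarrow> img n x = x"
proof -
  assume x: "x \<in> Sig n"
  have "\<forall>v\<in>\<Union>(Sig n). phi n n v = v"
    using filtration unfolding filtration_def by blast
  then have "img n x = id ` x"
    unfolding img_def using x by (intro image_cong) auto
  then show ?thesis by simp
qed

lemma faces_in_n: "faces_in n = Sig n"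
  unfolding faces_in_def using img_n by simp

lemma faces_in_mono: "i \<le> j \<Longrightarrow> j \<le> n \<Longrightarrow> faces_in i \<subseteq> faces_in j"
  unfolding faces_in_def
proof (rule image_subsetI)
  fix x assume "i \<le> j" "j \<le> n" "x \<in> Sig i"
  then have "phi i j ` x \<in> Sig j" "img i x = img j (phi i j ` x)"
    by (simp_all only: phi_face img_phi)
  then show "img i x \<in> img j ` Sig j" by (rule rev_image_eqI)
qed

text \<open>This is the lower ideal property, which confines a flag to any complex of the filtration
  that contains its last face.\<close>

lemma faces_in_lower:
  "i \<le> n \<Longrightarrow> X \<in> faces_in i \<Longrightarrow> Y \<subseteq> X \<Longrightarrow> Y \<noteq> {} \<Longrightarrow> Y \<in> faces_in i"
proof -
  assume i: "i \<le> n" and "X \<in> faces_in i" and Y: "Y \<subseteq> X" "Y \<noteq> {}"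
  then obtain x where x: "x \<in> Sig i" "X = img i x" by (auto simp: faces_in_def)
  then obtain y where "y \<subseteq> x" "Y = img i y"
    using Y by (auto simp: img_def elim: subset_imageE)
  then show ?thesis using i x Y(2) face_subset[of i x y] by (auto simp: faces_in_def img_def)
qed

lemma face_pairs_mono: "A \<subseteq> B \<Longrightarrow> face_pairs A \<subseteq> face_pairs B"
  by (auto simp: face_pairs_def)

lemma face_pairs_faces_in:
  "i \<le> n \<Longrightarrow> face_pairs (faces_in i) = map_prod (img i) (img i) ` face_pairs (Sig i)"
proof (intro equalityI subsetI)
  fix p assume i: "i \<le> n" and "p \<in> face_pairs (faces_in i)"
  then obtain x y where "x \<in> Sig i" "y \<in> Sig i" "p = (img i x, img i y)" "img i x \<subseteq> img i y"
    by (auto simp: face_pairs_def faces_in_def)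
  then show "p \<in> map_prod (img i) (img i) ` face_pairs (Sig i)"
    using i by (intro image_eqI[of _ _ "(x, y)"]) (auto simp: face_pairs_def img_subset_iff)
next
  fix p assume "i \<le> n" and "p \<in> map_prod (img i) (img i) ` face_pairs (Sig i)"
  then obtain x y where "x \<in> Sig i" "y \<in> Sig i" "x \<subseteq> y" "p = (img i x, img i y)"
    by (auto simp: face_pairs_def)
  then show "p \<in> face_pairs (faces_in i)"
    by (simp add: face_pairs_def faces_in_def img_subset_iff \<open>i \<le> n\<close>)
qed

lemma img_face_pairs:
  "i \<le> n \<Longrightarrow> (x, z) \<in> face_pairs (Sig i) \<Longrightarrow> (img i x, img i z) \<in> face_pairs (faces_in i)"
  unfolding face_pairs_faces_in by (rule image_eqI[of _ _ "(x, z)"]) (simp_all only: map_prod_simp)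

lemma restr_basis_apply:
  "restr_basis i p (x, y) = (if (x, y) \<in> face_pairs (Sig i) \<and> p = (img i x, img i y) then 1 else 0)"
  by (auto simp: restr_basis_def inc_restr_apply basis_elt_def img_def)

lemma restr_basis_img:
  assumes "i \<le> n" "p \<in> face_pairs (Sig i)"
  shows "restr_basis i (map_prod (img i) (img i) p) = basis_elt p"
proof (rule ext, clarify)
  fix x y
  obtain a b where p: "p = (a, b)" "a \<in> Sig i" "b \<in> Sig i"
    using assms(2) by (auto simp: face_pairs_def)
  show "restr_basis i (map_prod (img i) (img i) p) (x, y) = basis_elt p (x, y)"
  proof (cases "(x, y) \<in> face_pairs (Sig i)")
    case True
    then have "x \<in> Sig i" "y \<in> Sig i" by (auto simp: face_pairs_def)
    then show ?thesis
      using True assms(1) p by (auto simp only: restr_basis_apply basis_elt_def map_prod_simp img_eq_iff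
          prod.inject split: if_splits)
  next
    case False
    then have "(x, y) \<noteq> p" using assms(2) by blast
    then show ?thesis using False by (simp only: restr_basis_apply basis_elt_def simp_thms if_False)
  qed
qed

lemma restr_basis_zero: "i \<le> n \<Longrightarrow> p \<notin> face_pairs (faces_in i) \<Longrightarrow> restr_basis i p = ezero"
proof (rule ext, clarify)
  fix x y assume "i \<le> n" "p \<notin> face_pairs (faces_in i)"
  then have "\<not> ((x, y) \<in> face_pairs (Sig i) \<and> p = (img i x, img i y))"
    using img_face_pairs by blast
  then show "restr_basis i p (x, y) = ezero (x, y)"
    by (simp only: restr_basis_apply if_False ezero_def)
qed

lemma restr_basis_in [simp]: "restr_basis i p \<in> inc_alg (Sig i)"
  by (simp add: restr_basis_def)

text \<open>Thanks to this compatibility the last simplicial face, which restricts the arguments,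
  leaves the list of pairs unchanged.\<close>

lemma inc_restr_restr_basis:
  assumes "i \<le> j" "j \<le> n"
  shows "inc_restr (Sig i) (phi i j) (restr_basis j p) = restr_basis i p"
proof (rule ext, clarify)
  fix x y
  have "(phi i j ` x, phi i j ` y) \<in> face_pairs (Sig j)
      \<and> img j (phi i j ` x) = img i x \<and> img j (phi i j ` y) = img i y" if "(x, y) \<in> face_pairs (Sig i)"
  proof -
    have *: "x \<in> Sig i" "y \<in> Sig i" "x \<subseteq> y" using that by (auto simp: face_pairs_def)
    then show ?thesis
      using phi_face[OF assms] img_phi[OF assms] by (simp add: face_pairs_def image_mono)
  qed
  then show "inc_restr (Sig i) (phi i j) (restr_basis j p) (x, y) = restr_basis i p (x, y)"
    by (cases "(x, y) \<in> face_pairs (Sig i)") (simp_all add: inc_restr_apply restr_basis_apply)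
qed

lemma inc_mult_restr_basis:
  assumes "i \<le> n" "p \<in> face_pairs (faces_in i)" "p' \<in> face_pairs (faces_in i)"
  shows "inc_mult (Sig i) (restr_basis i p) (restr_basis i p')
    = (if snd p = fst p' then restr_basis i (compose p p') else (ezero :: ('v, 'k::field) ielt))"
proof -
  let ?f = "map_prod (img i) (img i)"
  obtain a b where ab: "(a, b) \<in> face_pairs (Sig i)" "p = ?f (a, b)"
    using assms by (auto simp: face_pairs_faces_in)
  obtain b' c where bc: "(b', c) \<in> face_pairs (Sig i)" "p' = ?f (b', c)"
    using assms by (auto simp: face_pairs_faces_in)
  have 1: "snd p = fst p' \<longleftrightarrow> b = b'"
    using ab bc assms(1) by (auto simp: face_pairs_def img_eq_iff)
  have 2: "restr_basis i (compose p p') = (basis_elt (a, c) :: ('v, 'k) ielt)" if "b = b'"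
    using restr_basis_img[of i "(a, c)"] that ab bc assms(1) by (auto simp: face_pairs_def compose_def)
  have 3: "restr_basis i p = basis_elt (a, b)" "restr_basis i p' = basis_elt (b', c)"
    unfolding ab(2) bc(2) by (simp_all only: restr_basis_img[OF assms(1)] ab(1) bc(1))
  show ?thesis
    unfolding 3 inc_mult_basis_elt[OF finite_Sig[OF assms(1)] ab(1) bc(1)]
    using 1 2 by (cases "b = b'") simp_all
qed

section \<open>Coordinates of Gerstenhaber--Schack cochains\<close>

text \<open>Index set of the matrix entries in total degree \<open>m = p + q\<close>. Values lie in
  the algebra of \<open>hd \<sigma>\<close>, which restricts the end faces; arguments lie in the
  algebra of \<open>last \<sigma>\<close>, which restricts \<open>ps\<close>.\<close>

definition valid :: "nat \<Rightarrow> nat list \<Rightarrow> ('v set \<times> 'v set) list \<Rightarrow> bool" where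
  "valid m \<sigma> L \<longleftrightarrow> (\<exists>X ps Z. L = wrap X ps Z \<and> \<sigma> \<in> chains n (length \<sigma> - 1) \<and>
     (X, Z) \<in> face_pairs (faces_in (hd \<sigma>)) \<and> set ps \<subseteq> face_pairs (faces_in (last \<sigma>)) \<and>
     length \<sigma> + length ps = Suc m)"

lemma valid_wrap:
  "valid m \<sigma> (wrap X ps Z) \<longleftrightarrow> \<sigma> \<in> chains n (length \<sigma> - 1) \<and>
     (X, Z) \<in> face_pairs (faces_in (hd \<sigma>)) \<and> set ps \<subseteq> face_pairs (faces_in (last \<sigma>)) \<and>
     length \<sigma> + length ps = Suc m"
  by (auto simp: valid_def)

text \<open>The end faces are pulled back to \<open>Sig (hd \<sigma>)\<close>, where the values
  live. The default 0 agrees with the terms of the differential that vanish because a restricted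
  basis element is 0.\<close>

definition coords :: "nat \<Rightarrow> ('v, 'k::field) gs_cochain \<Rightarrow> nat list \<Rightarrow> ('v set \<times> 'v set) list \<Rightarrow> 'k" where
  "coords m \<Gamma> \<sigma> L = (if valid m \<sigma> L
     then \<Gamma> \<sigma> (map (restr_basis (last \<sigma>)) (butlast (tl L)))
       (inv_into (Sig (hd \<sigma>)) (img (hd \<sigma>)) (snd (hd L)), inv_into (Sig (hd \<sigma>)) (img (hd \<sigma>)) (fst (last L)))
     else 0)"

lemma chains_le: "\<sigma> \<in> chains n p \<Longrightarrow> hd \<sigma> \<le> n \<and> last \<sigma> \<le> n \<and> \<sigma> \<noteq> [] \<and> length \<sigma> = Suc p"
  by (cases \<sigma>) (auto simp: chains_def)

lemma chains_hd_le: "\<sigma> \<in> chains n p \<Longrightarrow> i \<in> set \<sigma> \<Longrightarrow> hd \<sigma> \<le> i \<and> i \<le> last \<sigma> \<and> i \<le> n"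
proof (intro conjI)
  assume *: "\<sigma> \<in> chains n p" "i \<in> set \<sigma>"
  show "hd \<sigma> \<le> i" using * by (cases \<sigma>) (auto simp: chains_def)
  show "i \<le> last \<sigma>" using * by (cases \<sigma> rule: rev_cases) (auto simp: chains_def sorted_append)
  show "i \<le> n" using * by (simp add: chains_def)
qed

lemma coords_wrap:
  assumes "\<sigma> \<in> chains n p" "(x, z) \<in> face_pairs (Sig (hd \<sigma>))"
    "set ps \<subseteq> face_pairs (faces_in (last \<sigma>))" "p + length ps = m"
  shows "coords m \<Gamma> \<sigma> (wrap (img (hd \<sigma>) x) ps (img (hd \<sigma>) z))
    = \<Gamma> \<sigma> (map (restr_basis (last \<sigma>)) ps) (x, z)"
proof -
  have le: "hd \<sigma> \<le> n" "length \<sigma> = Suc p" using chains_le[OF assms(1)] by simp_all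
  have "inj_on (img (hd \<sigma>)) (Sig (hd \<sigma>))"
    by (rule inj_onI) (simp only: img_eq_iff[OF le(1)])
  then have "inv_into (Sig (hd \<sigma>)) (img (hd \<sigma>)) (img (hd \<sigma>) y) = y" if "y \<in> Sig (hd \<sigma>)" for y
    using that by (rule inv_into_f_f)
  moreover have "x \<in> Sig (hd \<sigma>)" "z \<in> Sig (hd \<sigma>)"
    using assms(2) by (simp_all add: face_pairs_def)
  moreover have "valid m \<sigma> (wrap (img (hd \<sigma>) x) ps (img (hd \<sigma>) z))"
    using assms le img_face_pairs[OF le(1) assms(2)] by (simp add: valid_wrap)
  ultimately show ?thesis
    by (simp only: coords_def if_True) (simp add: wrap_def)
qed

lemma validE:
  assumes "valid m \<sigma> L"
  obtains p x z ps where "\<sigma> \<in> chains n p" "(x, z) \<in> face_pairs (Sig (hd \<sigma>))"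
    "set ps \<subseteq> face_pairs (faces_in (last \<sigma>))" "p + length ps = m"
    "L = wrap (img (hd \<sigma>) x) ps (img (hd \<sigma>) z)"
proof -
  obtain X ps Z where *: "L = wrap X ps Z" "\<sigma> \<in> chains n (length \<sigma> - 1)"
     "(X, Z) \<in> face_pairs (faces_in (hd \<sigma>))" "set ps \<subseteq> face_pairs (faces_in (last \<sigma>))"
     "length \<sigma> + length ps = Suc m"
    using assms unfolding valid_def by blast
  have le: "hd \<sigma> \<le> n" "0 < length \<sigma>" using chains_le[OF *(2)] by simp_all
  from *(3)[unfolded face_pairs_faces_in[OF le(1)]]
  obtain r where r: "(X, Z) = map_prod (img (hd \<sigma>)) (img (hd \<sigma>)) r" "r \<in> face_pairs (Sig (hd \<sigma>))"
    by (rule imageE)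
  obtain x z where "r = (x, z)" by (cases r)
  with r have "(x, z) \<in> face_pairs (Sig (hd \<sigma>))" "X = img (hd \<sigma>) x" "Z = img (hd \<sigma>) z"
    by simp_all
  moreover have "length \<sigma> - 1 + length ps = m" using *(5) le(2) by linarith
  ultimately show thesis
    using that[of "length \<sigma> - 1" x z ps] *(1,2,4) by blast
qed

lemma GS_cochains_eqI:
  assumes \<Gamma>: "\<Gamma> \<in> GS_cochains n Sig m" and \<Delta>: "\<Delta> \<in> GS_cochains n Sig m"
    and eq: "\<And>\<sigma> L. valid m \<sigma> L \<Longrightarrow> coords m \<Gamma> \<sigma> L = coords m \<Delta> \<sigma> L"
  shows "\<Gamma> = \<Delta>"
proof
  fix \<sigma>
  show "\<Gamma> \<sigma> = \<Delta> \<sigma>"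
  proof (cases "\<exists>p\<le>m. \<sigma> \<in> chains n p")
    case True
    then obtain p where p: "p \<le> m" "\<sigma> \<in> chains n p" by blast
    have le: "hd \<sigma> \<le> n" "last \<sigma> \<le> n" using chains_le[OF p(2)] by auto
    let ?f = "map_prod (img (last \<sigma>)) (img (last \<sigma>))"
    show ?thesis
    proof (rule multilinear_eqI[OF GS_cochains_multilinear[OF \<Gamma> p(2,1)]
            GS_cochains_multilinear[OF \<Delta> p(2,1)] finite_Sig[OF le(2)]], rule ext, clarify)
      fix ps x z
      assume ps: "length ps = m - p" "set ps \<subseteq> face_pairs (Sig (last \<sigma>))"
      show "\<Gamma> \<sigma> (map basis_elt ps) (x, z) = \<Delta> \<sigma> (map basis_elt ps) (x, z)"
      proof (cases "(x, z) \<in> face_pairs (Sig (hd \<sigma>))")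
        case True
        have m: "map (restr_basis (last \<sigma>)) (map ?f ps) = map basis_elt ps"
          using ps le by (auto simp: restr_basis_img simp del: map_prod_simp)
        have sub: "set (map ?f ps) \<subseteq> face_pairs (faces_in (last \<sigma>))"
          using ps le by (auto simp: face_pairs_faces_in simp del: map_prod_simp)
        have len: "p + length (map ?f ps) = m" using p ps by simp
        have "valid m \<sigma> (wrap (img (hd \<sigma>) x) (map ?f ps) (img (hd \<sigma>) z))"
          using sub p ps chains_le[OF p(2)] img_face_pairs[OF le(1) True]
          by (simp add: valid_wrap)
        from eq[OF this] show ?thesis
          unfolding coords_wrap[OF p(2) True sub len] m .
      next
        case False
        then show ?thesis
          using GS_cochains_values[OF \<Gamma>, of \<sigma>] GS_cochains_values[OF \<Delta>, of \<sigma>]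
          by (simp add: inc_alg_def)
      qed
    qed
  next
    case False
    then have "\<Gamma> \<sigma> = (\<lambda>_. ezero)" "\<Delta> \<sigma> = (\<lambda>_. ezero)"
      using \<Gamma> \<Delta> unfolding GS_cochains_def mem_Collect_eq if_bool_eq_conj by blast+
    then show ?thesis by simp
  qed
qed

definition of_coords ::
    "nat \<Rightarrow> (nat list \<Rightarrow> ('v set \<times> 'v set) list \<Rightarrow> 'k::field) \<Rightarrow> ('v, 'k) gs_cochain" where
  "of_coords m G = (\<lambda>\<sigma> as.
     if (\<exists>p\<le>m. \<sigma> \<in> chains n p) \<and> length as = Suc m - length \<sigma> \<and> set as \<subseteq> inc_alg (Sig (last \<sigma>))
     then (\<lambda>(x, z). if (x, z) \<in> face_pairs (Sig (hd \<sigma>))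
       then expand (face_pairs (Sig (last \<sigma>))) (\<lambda>ps. G \<sigma> (wrap (img (hd \<sigma>) x)
         (map (map_prod (img (last \<sigma>)) (img (last \<sigma>))) ps) (img (hd \<sigma>) z))) as
       else 0)
     else ezero)"

lemma of_coords_cochains: "of_coords m G \<in> GS_cochains n Sig m"
proof -
  have "multilinear (Suc m - length \<sigma>) (inc_alg (Sig (last \<sigma>))) (inc_alg (Sig (hd \<sigma>)))
    (of_coords m G \<sigma>)" if ex: "\<exists>p\<le>m. \<sigma> \<in> chains n p" for \<sigma>
    unfolding multilinear_iff
  proof (intro conjI allI impI)
    fix r :: "'v set \<times> 'v set"
    obtain x z where r: "r = (x, z)" by (cases r)
    have "multilin_form (Suc m - length \<sigma>) (inc_alg (Sig (last \<sigma>)))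
       (\<lambda>as. if (x, z) \<in> face_pairs (Sig (hd \<sigma>))
       then expand (face_pairs (Sig (last \<sigma>))) (\<lambda>ps. G \<sigma> (wrap (img (hd \<sigma>) x)
         (map (map_prod (img (last \<sigma>)) (img (last \<sigma>))) ps) (img (hd \<sigma>) z))) as
       else 0)"
      by (cases "(x, z) \<in> face_pairs (Sig (hd \<sigma>))") (simp_all add: multilin_form_zero multilin_form_expand)
    then show "multilin_form (Suc m - length \<sigma>) (inc_alg (Sig (last \<sigma>))) (\<lambda>as. of_coords m G \<sigma> as r)"
      by (rule multilin_form_cong) (simp_all only: of_coords_def ex r simp_thms if_True split_conv)
  next
    fix as :: "('v, 'a) ielt list"
    assume "\<not> (length as = Suc m - length \<sigma> \<and> set as \<subseteq> inc_alg (Sig (last \<sigma>)))"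
    then show "of_coords m G \<sigma> as = ezero"
      unfolding of_coords_def by (intro if_not_P) blast
  qed (auto simp: of_coords_def inc_alg_def ezero_def)
  moreover have "of_coords m G \<sigma> = (\<lambda>_. ezero)" if "\<not> (\<exists>p\<le>m. \<sigma> \<in> chains n p)" for \<sigma>
    unfolding of_coords_def by (rule ext, rule if_not_P) (use that in blast)
  ultimately show ?thesis
    unfolding GS_cochains_def mem_Collect_eq if_bool_eq_conj by blast
qed

lemma coords_of_coords:
  fixes G :: "nat list \<Rightarrow> ('v set \<times> 'v set) list \<Rightarrow> 'k::field"
  assumes "valid m \<sigma> L"
  shows "coords m (of_coords m G) \<sigma> L = G \<sigma> L"
  using assms
proof (cases rule: validE)
  case (1 p x z ps)
  have le: "last \<sigma> \<le> n" "length \<sigma> = Suc p" using chains_le[OF 1(1)] by auto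
  let ?f = "map_prod (img (last \<sigma>)) (img (last \<sigma>))"
  have "\<exists>ps'. ps = map ?f ps' \<and> set ps' \<subseteq> face_pairs (Sig (last \<sigma>))"
    using 1(3) unfolding face_pairs_faces_in[OF le(1)]
    by (rule ex_map_conv_subset)
  then obtain ps' where ps': "ps = map ?f ps'" "set ps' \<subseteq> face_pairs (Sig (last \<sigma>))" by blast
  have m: "map (restr_basis (last \<sigma>)) ps = (map basis_elt ps' :: ('v, 'k) ielt list)"
    using ps' le by (auto simp: restr_basis_img simp del: map_prod_simp)
  have ex: "\<exists>p\<le>m. \<sigma> \<in> chains n p" using 1(1,4) by (intro exI[of _ p]) simp
  have "length (map basis_elt ps') = Suc m - length \<sigma>"
    using 1 le ps' by auto
  moreover have "set (map basis_elt ps') \<subseteq> (inc_alg (Sig (last \<sigma>)) :: ('v, 'k) ielt set)"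
    using ps' by auto
  ultimately have "of_coords m G \<sigma> (map basis_elt ps') (x, z) = G \<sigma> L"
    unfolding of_coords_def using ex 1(2)
    by (simp add: expand_basis[OF finite_face_pairs[OF finite_Sig[OF le(1)]] ps'(2)] ps' 1(5))
  then show ?thesis
    using coords_wrap[OF 1(1-4), of "of_coords m G"] 1(5) m by simp
qed

section \<open>The Gerstenhaber--Schack differential in coordinates\<close>

lemma GS_zero_slot:
  assumes "\<Gamma> \<in> GS_cochains n Sig m" "\<sigma> \<in> chains n p" "p \<le> m"
    and "length as = m - p" "set as \<subseteq> inc_alg (Sig (last \<sigma>))" "ezero \<in> set as"
  shows "\<Gamma> \<sigma> as r = 0"
proof -
  obtain us vs where as: "as = us @ ezero # vs" using split_list[OF assms(6)] by blast
  have "multilin_form (m - p) (inc_alg (Sig (last \<sigma>))) (\<lambda>as. \<Gamma> \<sigma> as r)"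
    using multilinearD[OF GS_cochains_multilinear[OF assms(1-3)]] .
  from multilin_form_zero_slot[OF this, of us vs] show ?thesis
    using assms(4,5) by (simp add: as)
qed

text \<open>At most one \<open>y\<close> contributes, the one whose image is \<open>snd p1\<close>.
  If there is no such face of \<open>Sig (hd \<sigma>)\<close> below \<open>z\<close>, then the
  right-hand index is not valid whenever its condition holds, and the default 0 applies.\<close>

lemma coords_hoch_left:
  assumes \<sigma>: "\<sigma> \<in> chains n p" and xz: "(x, z) \<in> face_pairs (Sig (hd \<sigma>))"
    and ps: "set (p1 # ps) \<subseteq> face_pairs (faces_in (last \<sigma>))" and len: "p + length ps = m"
  shows "(\<Sum>y\<in>{y \<in> Sig (hd \<sigma>). x \<subseteq> y \<and> y \<subseteq> z}.
      inc_restr (Sig (hd \<sigma>)) (phi (hd \<sigma>) (last \<sigma>)) (restr_basis (last \<sigma>) p1) (x, y)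
      * \<Gamma> \<sigma> (map (restr_basis (last \<sigma>)) ps) (y, z))
    = (if img (hd \<sigma>) x = fst p1 then coords m \<Gamma> \<sigma> (wrap (snd p1) ps (img (hd \<sigma>) z)) else 0)"
    (is "?L = ?R")
proof -
  let ?S = "Sig (hd \<sigma>)" and ?i = "img (hd \<sigma>)"
  have le: "hd \<sigma> \<le> last \<sigma>" "last \<sigma> \<le> n" "hd \<sigma> \<le> n"
    using chains_hd_le[OF \<sigma>, of "last \<sigma>"] chains_le[OF \<sigma>] by auto
  have L: "?L = (\<Sum>y\<in>{y \<in> ?S. x \<subseteq> y \<and> y \<subseteq> z}. (if p1 = (?i x, ?i y) then 1 else 0)
      * \<Gamma> \<sigma> (map (restr_basis (last \<sigma>)) ps) (y, z))"
    unfolding inc_restr_restr_basis[OF le(1,2)] restr_basis_apply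
    using xz by (intro sum.cong) (simp_all add: face_pairs_def)
  show ?thesis
  proof (cases "\<exists>y\<in>?S. y \<subseteq> z \<and> p1 = (?i x, ?i y)")
    case True
    then obtain y0 where y0: "y0 \<in> ?S" "y0 \<subseteq> z" "p1 = (?i x, ?i y0)" by blast
    have x: "x \<in> ?S" "z \<in> ?S" using xz by (simp_all add: face_pairs_def)
    have "?i x \<subseteq> ?i y0" using ps y0(3) by (simp add: face_pairs_def)
    then have xy0: "x \<subseteq> y0" using img_subset_iff[OF le(3) x(1) y0(1)] by simp
    have "?L = (\<Sum>y\<in>{y \<in> ?S. x \<subseteq> y \<and> y \<subseteq> z}.
        if y = y0 then \<Gamma> \<sigma> (map (restr_basis (last \<sigma>)) ps) (y0, z) else 0)"
      unfolding L using img_eq_iff[OF le(3) y0(1)] by (intro sum.cong) (auto simp: y0(3))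
    also have "\<dots> = \<Gamma> \<sigma> (map (restr_basis (last \<sigma>)) ps) (y0, z)"
      using y0 xy0 finite_Sig[OF le(3)] by simp
    also have "\<dots> = coords m \<Gamma> \<sigma> (wrap (?i y0) ps (?i z))"
      using y0 x ps len by (intro coords_wrap[OF \<sigma>, symmetric]) (simp_all add: face_pairs_def)
    finally show ?thesis by (simp add: y0(3))
  next
    case False
    have "?L = 0" unfolding L using False by (intro sum.neutral) auto
    moreover have "?R = 0"
    proof (cases "?i x = fst p1 \<and> valid m \<sigma> (wrap (snd p1) ps (?i z))")
      case True
      then have "(snd p1, ?i z) \<in> face_pairs (faces_in (hd \<sigma>))" by (simp add: valid_wrap)
      then obtain y where y: "y \<in> ?S" "snd p1 = ?i y" "?i y \<subseteq> ?i z"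
        by (auto simp: face_pairs_def faces_in_def)
      have "y \<subseteq> z" using y xz img_subset_iff[OF le(3) y(1), of z] by (simp add: face_pairs_def)
      then show ?thesis using False True y by (metis prod.collapse)
    next
      case False
      then show ?thesis by (auto simp: coords_def)
    qed
    ultimately show ?thesis by simp
  qed
qed

lemma coords_hoch_right:
  assumes \<sigma>: "\<sigma> \<in> chains n p" and xz: "(x, z) \<in> face_pairs (Sig (hd \<sigma>))"
    and ps: "set (ps @ [p1]) \<subseteq> face_pairs (faces_in (last \<sigma>))" and len: "p + length ps = m"
  shows "(\<Sum>y\<in>{y \<in> Sig (hd \<sigma>). x \<subseteq> y \<and> y \<subseteq> z}.
      \<Gamma> \<sigma> (map (restr_basis (last \<sigma>)) ps) (x, y)
      * inc_restr (Sig (hd \<sigma>)) (phi (hd \<sigma>) (last \<sigma>)) (restr_basis (last \<sigma>) p1) (y, z))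
    = (if snd p1 = img (hd \<sigma>) z then coords m \<Gamma> \<sigma> (wrap (img (hd \<sigma>) x) ps (fst p1)) else 0)"
    (is "?L = ?R")
proof -
  let ?S = "Sig (hd \<sigma>)" and ?i = "img (hd \<sigma>)"
  have le: "hd \<sigma> \<le> last \<sigma>" "last \<sigma> \<le> n" "hd \<sigma> \<le> n"
    using chains_hd_le[OF \<sigma>, of "last \<sigma>"] chains_le[OF \<sigma>] by auto
  have L: "?L = (\<Sum>y\<in>{y \<in> ?S. x \<subseteq> y \<and> y \<subseteq> z}. \<Gamma> \<sigma> (map (restr_basis (last \<sigma>)) ps) (x, y)
      * (if p1 = (?i y, ?i z) then 1 else 0))"
    unfolding inc_restr_restr_basis[OF le(1,2)] restr_basis_apply
    using xz by (intro sum.cong) (simp_all add: face_pairs_def)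
  show ?thesis
  proof (cases "\<exists>y\<in>?S. x \<subseteq> y \<and> p1 = (?i y, ?i z)")
    case True
    then obtain y0 where y0: "y0 \<in> ?S" "x \<subseteq> y0" "p1 = (?i y0, ?i z)" by blast
    have x: "x \<in> ?S" "z \<in> ?S" using xz by (simp_all add: face_pairs_def)
    have "?i y0 \<subseteq> ?i z" using ps y0(3) by (simp add: face_pairs_def)
    then have y0z: "y0 \<subseteq> z" using img_subset_iff[OF le(3) y0(1) x(2)] by simp
    have "?L = (\<Sum>y\<in>{y \<in> ?S. x \<subseteq> y \<and> y \<subseteq> z}.
        if y = y0 then \<Gamma> \<sigma> (map (restr_basis (last \<sigma>)) ps) (x, y0) else 0)"
      unfolding L using img_eq_iff[OF le(3) y0(1)] by (intro sum.cong) (auto simp: y0(3))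
    also have "\<dots> = \<Gamma> \<sigma> (map (restr_basis (last \<sigma>)) ps) (x, y0)"
      using y0 y0z finite_Sig[OF le(3)] by simp
    also have "\<dots> = coords m \<Gamma> \<sigma> (wrap (?i x) ps (?i y0))"
      using y0 x ps len by (intro coords_wrap[OF \<sigma>, symmetric]) (simp_all add: face_pairs_def)
    finally show ?thesis by (simp add: y0(3))
  next
    case False
    have "?L = 0" unfolding L using False by (intro sum.neutral) auto
    moreover have "?R = 0"
    proof (cases "snd p1 = ?i z \<and> valid m \<sigma> (wrap (?i x) ps (fst p1))")
      case True
      then have "(?i x, fst p1) \<in> face_pairs (faces_in (hd \<sigma>))" by (simp add: valid_wrap)
      then obtain y where y: "y \<in> ?S" "fst p1 = ?i y" "?i x \<subseteq> ?i y"
        by (auto simp: face_pairs_def faces_in_def)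
      have "x \<subseteq> y" using y xz img_subset_iff[OF le(3) _ y(1), of x] by (simp add: face_pairs_def)
      then show ?thesis using False True y by (metis prod.collapse)
    next
      case False
      then show ?thesis by (auto simp: coords_def)
    qed
    ultimately show ?thesis by simp
  qed
qed

text \<open>Neighbours that do not compose multiply to \<open>ezero\<close>, and a multilinear map
  vanishes on a list with a zero entry.\<close>

lemma coords_hoch_middle:
  assumes \<Gamma>: "\<Gamma> \<in> GS_cochains n Sig m"
    and \<sigma>: "\<sigma> \<in> chains n p" and xz: "(x, z) \<in> face_pairs (Sig (hd \<sigma>))"
    and ps: "set ps \<subseteq> face_pairs (faces_in (last \<sigma>))" and len: "p + length ps = Suc m"
    and j: "Suc j < length ps"
  shows "\<Gamma> \<sigma> (mult_at (inc_mult (Sig (last \<sigma>))) j (map (restr_basis (last \<sigma>)) ps)) (x, z)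
    = (if snd (ps ! j) = fst (ps ! Suc j)
       then coords m \<Gamma> \<sigma> (wrap (img (hd \<sigma>) x) (mult_at compose j ps) (img (hd \<sigma>) z)) else 0)"
proof -
  let ?E = "restr_basis (last \<sigma>)"
  obtain us p1 p2 vs where s: "ps = us @ p1 # p2 # vs" "length us = j"
    using j by (rule list_split_two)
  have le: "last \<sigma> \<le> n" using chains_le[OF \<sigma>] by simp
  have p12: "p1 \<in> face_pairs (faces_in (last \<sigma>))" "p2 \<in> face_pairs (faces_in (last \<sigma>))"
    using ps s by simp_all
  have m: "mult_at (inc_mult (Sig (last \<sigma>))) j (map ?E ps)
      = map ?E us @ (if snd p1 = fst p2 then ?E (compose p1 p2) else ezero) # map ?E vs"
    using s by (simp add: mult_at_append inc_mult_restr_basis[OF le p12])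
  have c: "mult_at compose j ps = us @ compose p1 p2 # vs"
    using s by (simp add: mult_at_append)
  have nth: "ps ! j = p1" "ps ! Suc j = p2"
    using s by (simp_all add: nth_append)
  show ?thesis
  proof (cases "snd p1 = fst p2")
    case True
    then have "compose p1 p2 \<in> face_pairs (faces_in (last \<sigma>))"
      using p12 by (auto simp: compose_def face_pairs_def; blast)
    then have "coords m \<Gamma> \<sigma> (wrap (img (hd \<sigma>) x) (us @ compose p1 p2 # vs) (img (hd \<sigma>) z))
        = \<Gamma> \<sigma> (map ?E (us @ compose p1 p2 # vs)) (x, z)"
      using ps s len by (intro coords_wrap[OF \<sigma> xz]) auto
    then show ?thesis using True by (simp add: m c nth)
  next
    case False
    have "\<Gamma> \<sigma> (map ?E us @ ezero # map ?E vs) (x, z) = 0"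
      using s len by (intro GS_zero_slot[OF \<Gamma> \<sigma>]) auto
    then show ?thesis using False by (simp add: m nth)
  qed
qed

lemma hoch_part_coords:
  assumes \<Gamma>: "\<Gamma> \<in> GS_cochains n Sig m"
    and \<sigma>: "\<sigma> \<in> chains n p" and xz: "(x, z) \<in> face_pairs (Sig (hd \<sigma>))"
    and ps: "set ps \<subseteq> face_pairs (faces_in (last \<sigma>))" and len: "p + length ps = Suc m" and ne: "ps \<noteq> []"
  shows "hoch_part Sig phi \<Gamma> \<sigma> (map (restr_basis (last \<sigma>)) ps) (x, z)
    = hoch (coords m \<Gamma> \<sigma>) (wrap (img (hd \<sigma>) x) ps (img (hd \<sigma>) z))"
proof -
  let ?E = "restr_basis (last \<sigma>)" and ?G = "coords m \<Gamma> \<sigma>" and ?X = "img (hd \<sigma>) x" and ?Z = "img (hd \<sigma>) z"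
  obtain p1 qs where p1: "ps = p1 # qs" using ne by (cases ps) auto
  obtain p2 rs where p2: "ps = rs @ [p2]" using ne by (cases ps rule: rev_cases) auto
  have left: "(\<Sum>y\<in>{y \<in> Sig (hd \<sigma>). x \<subseteq> y \<and> y \<subseteq> z}.
      inc_restr (Sig (hd \<sigma>)) (phi (hd \<sigma>) (last \<sigma>)) (hd (map ?E ps)) (x, y) * \<Gamma> \<sigma> (tl (map ?E ps)) (y, z))
    = (if ?X = fst (hd ps) then ?G (wrap (snd (hd ps)) (tl ps) ?Z) else 0)"
    using coords_hoch_left[OF \<sigma> xz, of p1 qs m \<Gamma>] ps len by (simp add: p1)
  have right: "(\<Sum>y\<in>{y \<in> Sig (hd \<sigma>). x \<subseteq> y \<and> y \<subseteq> z}.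
      \<Gamma> \<sigma> (butlast (map ?E ps)) (x, y) * inc_restr (Sig (hd \<sigma>)) (phi (hd \<sigma>) (last \<sigma>)) (last (map ?E ps)) (y, z))
    = (if snd (last ps) = ?Z then ?G (wrap ?X (butlast ps) (fst (last ps))) else 0)"
    using coords_hoch_right[OF \<sigma> xz, of rs p2 m \<Gamma>] ps len by (simp add: p2)
  have middle: "(\<Sum>i\<in>{1..<length (map ?E ps)}. (-1) ^ i *
        \<Gamma> \<sigma> (mult_at (inc_mult (Sig (last \<sigma>))) (i - 1) (map ?E ps)) (x, z))
    = (\<Sum>i\<in>{1..<length ps}. (-1) ^ i * (if snd (ps ! (i - 1)) = fst (ps ! i)
          then ?G (wrap ?X (mult_at compose (i - 1) ps) ?Z) else 0))"
  proof (rule sum.cong)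
    fix i assume "i \<in> {1..<length ps}"
    then show "(-1) ^ i * \<Gamma> \<sigma> (mult_at (inc_mult (Sig (last \<sigma>))) (i - 1) (map ?E ps)) (x, z)
      = (-1) ^ i * (if snd (ps ! (i - 1)) = fst (ps ! i)
          then ?G (wrap ?X (mult_at compose (i - 1) ps) ?Z) else 0)"
      using coords_hoch_middle[OF \<Gamma> \<sigma> xz ps len, of "i - 1"] by simp
  qed simp
  show ?thesis
    unfolding hoch_part_eq hoch_wrap[OF ne] left middle right using xz by simp
qed

text \<open>Deleting the first object pushes the end faces forward, which is invisible after
  \<open>img\<close>. Deleting the last object restricts the arguments; a pair outside the smaller
  complex becomes \<open>ezero\<close>, which matches the default value of
  \<open>coords\<close>.\<close>

lemma simp_part_coords:
  fixes \<Gamma> :: "('v, 'k::field) gs_cochain"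
  assumes \<Gamma>: "\<Gamma> \<in> GS_cochains n Sig m"
    and \<sigma>: "\<sigma> \<in> chains n (Suc p)" and xz: "(x, z) \<in> face_pairs (Sig (hd \<sigma>))"
    and ps: "set ps \<subseteq> face_pairs (faces_in (last \<sigma>))" and len: "p + length ps = m"
  shows "simp_part Sig phi \<Gamma> \<sigma> (map (restr_basis (last \<sigma>)) ps) (x, z)
    = bd (\<lambda>\<tau>. coords m \<Gamma> \<tau> (wrap (img (hd \<sigma>) x) ps (img (hd \<sigma>) z))) \<sigma>"
proof -
  let ?L = "wrap (img (hd \<sigma>) x) ps (img (hd \<sigma>) z)" and ?E = "restr_basis (last \<sigma>)"
  define t where "t r = (-1) ^ r * coords m \<Gamma> (remove_nth r \<sigma>) ?L" for r
  have l: "length \<sigma> = Suc (Suc p)" using chains_le[OF \<sigma>] by simp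
  have ch: "remove_nth r \<sigma> \<in> chains n p" if "r \<le> Suc p" for r
    using chains_remove_nth[OF \<sigma> that] .
  have "bd (\<lambda>\<tau>. coords m \<Gamma> \<tau> ?L) \<sigma> = sum t {..<Suc (Suc p)}"
    unfolding bd_def l by (rule sum.cong) (simp_all only: t_def)
  also have "{..<Suc (Suc p)} = insert 0 (insert (Suc p) {1..<Suc p})"
    by (auto simp: Suc_le_eq)
  also have "sum t \<dots> = t 0 + (sum t {1..<Suc p} + t (Suc p))"
    by simp
  also have "t 0 = \<Gamma> (tl \<sigma>) (map ?E ps) (phi (hd \<sigma>) (hd (tl \<sigma>)) ` x, phi (hd \<sigma>) (hd (tl \<sigma>)) ` z)"
  proof -
    obtain a b \<tau> where s: "\<sigma> = a # b # \<tau>"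
      using l by (auto simp: length_Suc_conv)
    have ab: "a \<le> b" "b \<le> n" using \<sigma> by (auto simp: s chains_def)
    have tl: "tl \<sigma> \<in> chains n p" using ch[of 0] by (simp add: tl_eq_remove_nth)
    have x: "x \<in> Sig a" "z \<in> Sig a" "x \<subseteq> z" using xz by (simp_all add: s face_pairs_def)
    have "(phi a b ` x, phi a b ` z) \<in> face_pairs (Sig b)"
      using phi_face[OF ab x(1)] phi_face[OF ab x(2)] x(3) by (simp add: face_pairs_def image_mono)
    then have "coords m \<Gamma> (tl \<sigma>) (wrap (img b (phi a b ` x)) ps (img b (phi a b ` z)))
        = \<Gamma> (tl \<sigma>) (map ?E ps) (phi a b ` x, phi a b ` z)"
      using coords_wrap[OF tl, of "phi a b ` x" "phi a b ` z" ps m \<Gamma>] ps len by (simp add: s)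
    then show ?thesis
      by (simp add: t_def tl_eq_remove_nth[symmetric] img_phi[OF ab x(1)] img_phi[OF ab x(2)] s)
  qed
  also have "sum t {1..<Suc p} = (\<Sum>r\<in>{1..<length \<sigma> - 1}. (-1) ^ r * \<Gamma> (remove_nth r \<sigma>) (map ?E ps) (x, z))"
  proof (rule sum.cong)
    fix r assume "r \<in> {1..<length \<sigma> - 1}"
    then have r: "0 < r" "Suc r < length \<sigma>" "r \<le> Suc p" using l by auto
    then have hl: "hd (remove_nth r \<sigma>) = hd \<sigma>" "last (remove_nth r \<sigma>) = last \<sigma>"
      by (simp_all add: hd_remove_nth last_remove_nth)
    show "t r = (-1) ^ r * \<Gamma> (remove_nth r \<sigma>) (map ?E ps) (x, z)"
      using coords_wrap[OF ch[OF r(3)], of x z ps m \<Gamma>] xz ps len by (simp add: t_def hl)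
  qed (simp add: l)
  also have "t (Suc p) = (-1) ^ (length \<sigma> - 1) * \<Gamma> (butlast \<sigma>)
       (map (inc_restr (Sig (last (butlast \<sigma>))) (phi (last (butlast \<sigma>)) (last \<sigma>))) (map ?E ps)) (x, z)"
  proof -
    let ?d = "last (butlast \<sigma>)"
    have b: "remove_nth (Suc p) \<sigma> = butlast \<sigma>"
      using l by (simp add: butlast_eq_remove_nth)
    have bch: "butlast \<sigma> \<in> chains n p" using ch[of "Suc p"] by (simp add: b)
    have hb: "hd (butlast \<sigma>) = hd \<sigma>" using hd_remove_nth[of "Suc p" \<sigma>] l by (simp add: b)
    have "butlast \<sigma> \<noteq> []" using chains_le[OF bch] by simp
    then have "?d \<in> set \<sigma>" using last_in_set[of "butlast \<sigma>"] in_set_butlastD by metis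
    then have d: "?d \<le> last \<sigma>" "last \<sigma> \<le> n" "?d \<le> n"
      using chains_hd_le[OF \<sigma>] chains_le[OF \<sigma>] by auto
    have m: "map (inc_restr (Sig ?d) (phi ?d (last \<sigma>))) (map ?E ps) = map (restr_basis ?d) ps"
      by (simp add: inc_restr_restr_basis[OF d(1,2)])
    have "coords m \<Gamma> (butlast \<sigma>) ?L = \<Gamma> (butlast \<sigma>) (map (restr_basis ?d) ps) (x, z)"
    proof (cases "set ps \<subseteq> face_pairs (faces_in ?d)")
      case True
      then show ?thesis
        using coords_wrap[OF bch, of x z ps m \<Gamma>] xz len by (simp add: hb)
    next
      case False
      then obtain r where r: "r \<in> set ps" "r \<notin> face_pairs (faces_in ?d)" by blast
      have "ezero \<in> set (map (restr_basis ?d) ps :: ('v, 'k) ielt list)"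
        unfolding set_map by (rule image_eqI, rule restr_basis_zero[OF d(3) r(2), symmetric], rule r(1))
      then have "\<Gamma> (butlast \<sigma>) (map (restr_basis ?d) ps) (x, z) = 0"
        using len by (intro GS_zero_slot[OF \<Gamma> bch]) auto
      moreover have "\<not> valid m (butlast \<sigma>) ?L"
        using False by (simp add: valid_wrap)
      ultimately show ?thesis by (simp add: coords_def)
    qed
    then show ?thesis unfolding m t_def b using l by simp
  qed
  finally show ?thesis
    using xz l by (subst simp_part_eq) simp_all
qed

lemma not_valid_singleton: "\<not> valid m \<sigma> [p]"
  by (auto simp: valid_def wrap_def)

text \<open>The bridge to the combinatorial total complex. It is claimed at valid indices only;
  elsewhere \<open>total_diff\<close> of coordinates need not vanish.\<close>

lemma coords_GS_diff:
  fixes \<Gamma> :: "('v, 'k::field) gs_cochain"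
  assumes \<Gamma>: "\<Gamma> \<in> GS_cochains n Sig m" and L: "valid (Suc m) \<sigma> L"
  shows "coords (Suc m) (GS_diff n Sig phi m \<Gamma>) \<sigma> L = total_diff (coords m \<Gamma>) \<sigma> L"
  using L
proof (cases rule: validE)
  case (1 p x z ps)
  let ?as = "map (restr_basis (last \<sigma>)) ps :: ('v, 'k) ielt list"
  have l: "length \<sigma> = Suc p" using chains_le[OF 1(1)] by simp
  have sgn: "- ((-1) ^ length \<sigma> * y) = (-1) ^ p * y" for y :: 'k
    by (simp add: l)
  have "p \<le> Suc m" using 1(4) by simp
  then have ex: "\<exists>p\<le>Suc m. \<sigma> \<in> chains n p" using 1(1) by blast
  have as: "length ?as = Suc (Suc m) - length \<sigma>" "set ?as \<subseteq> inc_alg (Sig (last \<sigma>))"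
    using 1(4) l by auto
  have "GS_diff n Sig phi m \<Gamma> \<sigma> ?as
      = eadd (if 1 \<le> length ?as then escale ((-1) ^ (length \<sigma> - 1)) (hoch_part Sig phi \<Gamma> \<sigma> ?as) else ezero)
             (if 2 \<le> length \<sigma> then simp_part Sig phi \<Gamma> \<sigma> ?as else ezero)"
    unfolding GS_diff_def by (rule if_P) (intro conjI ex as)
  then have D: "GS_diff n Sig phi m \<Gamma> \<sigma> ?as (x, z)
      = (if ps \<noteq> [] then (-1) ^ p * hoch_part Sig phi \<Gamma> \<sigma> ?as (x, z) else 0)
        + (if 2 \<le> length \<sigma> then simp_part Sig phi \<Gamma> \<sigma> ?as (x, z) else 0)"
    by (cases ps) (simp_all add: eadd_def escale_def ezero_def l)
  have h: "(if ps \<noteq> [] then (-1) ^ p * hoch_part Sig phi \<Gamma> \<sigma> ?as (x, z) else 0)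
      = - ((-1) ^ length \<sigma> * hoch (coords m \<Gamma> \<sigma>) L)"
  proof (cases "ps = []")
    \<comment> \<open>Without arguments \<open>hoch\<close> could only join the two end pairs to
      \<open>[({}, {})]\<close>, which is never valid; this matches the missing Hochschild term in
      degree \<open>q = 0\<close>.\<close>
    case True
    then show ?thesis
      by (simp add: 1(5) hoch_wrap_Nil coords_def not_valid_singleton)
  next
    case False
    then show ?thesis
      unfolding sgn 1(5) using hoch_part_coords[OF \<Gamma> 1(1-4) False] by simp
  qed
  have s: "(if 2 \<le> length \<sigma> then simp_part Sig phi \<Gamma> \<sigma> ?as (x, z) else 0)
      = (if 2 \<le> length \<sigma> then bd (\<lambda>\<tau>. coords m \<Gamma> \<tau> L) \<sigma> else 0)"
  proof (cases p)
    case 0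
    then show ?thesis by (simp add: l)
  next
    case (Suc p')
    then show ?thesis
      using simp_part_coords[OF \<Gamma> 1(1)[unfolded Suc] 1(2,3)] 1(4) by (simp add: 1(5))
  qed
  show ?thesis
    unfolding total_diff_def h[symmetric] s[symmetric] D[symmetric]
    using coords_wrap[OF 1(1-4), of "GS_diff n Sig phi m \<Gamma>"] by (simp add: 1(5))
qed

end

section \<open>Flags and composable lists\<close>

lemma composable_wrapD:
  assumes "composable ((W, X) # ps @ [(Z, W')])" "\<forall>p\<in>set ps. fst p \<subseteq> snd p"
  shows "sorted_wrt (\<subseteq>) (X # map snd ps) \<and> last (X # map snd ps) = Z"
  using assms
proof (induction ps arbitrary: W X)
  case (Cons p ps)
  have X: "X = fst p" using Cons.prems(1) by simp
  have IH: "sorted_wrt (\<subseteq>) (snd p # map snd ps) \<and> last (snd p # map snd ps) = Z"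
    using Cons.prems by (intro Cons.IH[of "fst p"]) simp_all
  have "X \<subseteq> snd p" using Cons.prems(2) X by simp
  then show ?case using IH by auto
qed simp

lemma composable_wrapI:
  assumes "composable ((W, X) # ps @ [(Z, W')])" "sorted_wrt (\<subseteq>) (X # map snd ps)"
    "set (X # map snd ps) \<subseteq> F"
  shows "set ps \<subseteq> face_pairs F \<and> last (X # map snd ps) = Z"
  using assms
proof (induction ps arbitrary: W X)
  case (Cons p ps)
  have X: "X = fst p" using Cons.prems(1) by simp
  have IH: "set ps \<subseteq> face_pairs F \<and> last (snd p # map snd ps) = Z"
    using Cons.prems by (intro Cons.IH[of "fst p"]) simp_all
  have "p \<in> face_pairs F"
    using Cons.prems(2,3) X by (cases p) (simp add: face_pairs_def)
  then show ?case using IH by simp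
qed simp

lemma ends_split:
  assumes "2 \<le> length L"
  obtains a ps b where "L = a # ps @ [b]"
proof -
  obtain a L' where L: "L = a # L'" using assms by (cases L) auto
  moreover have "L' \<noteq> []" using assms L by auto
  then obtain ps b where "L' = ps @ [b]" by (metis rev_exhaust)
  with L that show thesis by blast
qed

text \<open>Inverse of \<open>map snd (butlast L)\<close> on nonempty composable lists with dummy
  ends.\<close>

definition path :: "'v set list \<Rightarrow> ('v set \<times> 'v set) list" where
  "path c = zip ({} # c) (c @ [{}])"

lemma path_Cons_aux:
  "zip (a # c) (c @ [b]) \<noteq> [] \<and> fst (hd (zip (a # c) (c @ [b]))) = a \<and> snd (last (zip (a # c) (c @ [b]))) = b
    \<and> composable (zip (a # c) (c @ [b])) \<and> map snd (butlast (zip (a # c) (c @ [b]))) = c"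
  by (induction c arbitrary: a) (auto simp: successively_Cons)

lemma path_simps:
  "fst (hd (path c)) = {}" "snd (last (path c)) = {}" "composable (path c)"
  "map snd (butlast (path c)) = c" "length (path c) = Suc (length c)"
  using path_Cons_aux[of "{}" c "{}"] by (simp_all add: path_def)

lemma path_map_snd_aux:
  "composable L \<Longrightarrow> L \<noteq> [] \<Longrightarrow>
    zip (fst (hd L) # map snd (butlast L)) (map snd (butlast L) @ [snd (last L)]) = L"
proof (induction L)
  case (Cons p L)
  then show ?case by (cases L) (auto simp: successively_Cons)
qed simp

lemma path_map_snd:
  "composable L \<Longrightarrow> L \<noteq> [] \<Longrightarrow> fst (hd L) = {} \<Longrightarrow> snd (last L) = {} \<Longrightarrow>
    path (map snd (butlast L)) = L"
  using path_map_snd_aux[of L] by (simp add: path_def)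

lemma map_snd_join:
  "map snd (butlast (us @ (fst p, snd p') # vs)) = remove_nth (length us) (map snd (butlast (us @ p # p' # vs)))"
  by (cases vs rule: rev_cases)
    (simp_all add: butlast_append remove_nth_split[of "map snd us", simplified] remove_nth_def)

lemma ends_join:
  "fst (hd (us @ (fst p, snd p') # vs)) = fst (hd (us @ p # p' # vs))"
  "snd (last (us @ (fst p, snd p') # vs)) = snd (last (us @ p # p' # vs))"
  by (cases us; simp) simp

lemma total_diff_add:
  "total_diff (\<lambda>\<sigma> L. F \<sigma> L + G \<sigma> L) \<sigma> L = total_diff F \<sigma> L + total_diff G \<sigma> L"
proof -
  have "hoch (\<lambda>M. F \<sigma> M + G \<sigma> M) L = hoch (F \<sigma>) L + hoch (G \<sigma>) L"
    unfolding hoch_eq_sum by (simp add: sum.distrib[symmetric] algebra_simps if_distrib cong: if_cong)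
  then show ?thesis by (simp add: total_diff_def bd_add algebra_simps)
qed

lemma total_diff_cong:
  assumes "\<sigma> \<noteq> []"
    and "\<And>us p p' vs. L = us @ p # p' # vs \<Longrightarrow> snd p = fst p' \<Longrightarrow>
      F \<sigma> (us @ (fst p, snd p') # vs) = G \<sigma> (us @ (fst p, snd p') # vs)"
    and "\<And>i. i < length \<sigma> \<Longrightarrow> 2 \<le> length \<sigma> \<Longrightarrow> F (remove_nth i \<sigma>) L = G (remove_nth i \<sigma>) L"
  shows "total_diff F \<sigma> L = total_diff G \<sigma> L"
  unfolding total_diff_def
  using hoch_cong[of L "F \<sigma>" "G \<sigma>", OF assms(2)] bd_cong[of \<sigma> "\<lambda>\<tau>. F \<tau> L" "\<lambda>\<tau>. G \<tau> L"] assms(3)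
  by (cases "2 \<le> length \<sigma>") simp_all

section \<open>The index set under the two contractions\<close>

context filtered_complex
begin

text \<open>The faces along a composable list form a flag from \<open>X\<close> to \<open>Z\<close>.
  As \<open>Z\<close> lies in the lower ideal \<open>faces_in (hd \<sigma>)\<close>, so does the
  flag, and the condition at \<open>last \<sigma>\<close> becomes automatic. The number
  \<open>m + 3\<close> is \<open>Suc m\<close> plus the two end pairs.\<close>

lemma valid_composable_iff:
  assumes "composable L"
  shows "valid m \<sigma> L \<longleftrightarrow> \<sigma> \<in> chains n (length \<sigma> - 1) \<and> 2 \<le> length L \<and> fst (hd L) = {} \<and> snd (last L) = {} \<and>
    length \<sigma> + length L = m + 3 \<and> map snd (butlast L) \<in> flags (faces_in (hd \<sigma>)) (length L - 1)"
    (is "_ \<longleftrightarrow> ?R")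
proof
  assume "valid m \<sigma> L"
  then obtain X ps Z where *: "L = wrap X ps Z" "\<sigma> \<in> chains n (length \<sigma> - 1)"
     "(X, Z) \<in> face_pairs (faces_in (hd \<sigma>))" "set ps \<subseteq> face_pairs (faces_in (last \<sigma>))"
     "length \<sigma> + length ps = Suc m"
    unfolding valid_def by blast
  have le: "hd \<sigma> \<le> n" "last \<sigma> \<le> n" using chains_le[OF *(2)] by simp_all
  have "fst p \<subseteq> snd p" if "p \<in> set ps" for p
  proof -
    have "p \<in> face_pairs (faces_in (last \<sigma>))" using that *(4) by blast
    then show ?thesis by (cases p) (simp add: face_pairs_def)
  qed
  then have s: "sorted_wrt (\<subseteq>) (X # map snd ps)" "last (X # map snd ps) = Z"
    using composable_wrapD[of "{}" X ps Z "{}"] assms by (simp_all add: *(1) wrap_def)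
  have XZ: "X \<in> faces_in (hd \<sigma>)" "Z \<in> faces_in (hd \<sigma>)" using *(3) by (simp_all add: face_pairs_def)
  have "y \<in> faces_in (hd \<sigma>)" if y: "y \<in> set (X # map snd ps)" for y
  proof (rule faces_in_lower[OF le(1) XZ(2)])
    \<comment> \<open>Viewed as a flag in \<open>UNIV\<close>, the list is bounded by its last
      member before membership in \<open>faces_in (hd \<sigma>)\<close> is known.\<close>
    have "X # map snd ps \<in> flags UNIV (Suc (length ps))" using s(1) by (simp add: flags_def)
    from flags_bounded[OF this] show "y \<subseteq> Z" using y s(2) by (auto simp: flags_def)
    have "y = X \<or> y \<in> faces_in (last \<sigma>)"
      using y *(4) by (auto simp: face_pairs_def)
    then have "y \<in> faces_in (hd \<sigma>) \<union> faces_in (last \<sigma>)" using XZ by blast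
    then show "y \<noteq> {}" using face_finite[OF le(1)] face_finite[OF le(2)]
      by (auto simp: faces_in_def img_def)
  qed
  then have "X # map snd ps \<in> flags (faces_in (hd \<sigma>)) (length L - 1)"
    using s(1) by (simp add: flags_def *(1) wrap_def subset_iff)
  moreover have "map snd (butlast L) = X # map snd ps"
    by (simp add: *(1) wrap_def)
  ultimately show ?R using *(1,2,5) by (simp add: wrap_def)
next
  assume R: ?R
  then obtain a ps b where L: "L = a # ps @ [b]" using ends_split[of L] by blast
  define X Z where "X = snd a" and "Z = fst b"
  have w: "L = wrap X ps Z"
    using R by (cases a; cases b) (simp add: L wrap_def X_def Z_def)
  have fl: "X # map snd ps \<in> flags (faces_in (hd \<sigma>)) (Suc (length ps))"
    using R by (simp add: w wrap_def)
  have ch: "\<sigma> \<in> chains n (length \<sigma> - 1)" using R by simp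
  have le: "hd \<sigma> \<le> last \<sigma>" "last \<sigma> \<le> n"
    using chains_hd_le[OF ch, of "last \<sigma>"] chains_le[OF ch] by auto
  have "set ps \<subseteq> face_pairs (faces_in (hd \<sigma>)) \<and> last (X # map snd ps) = Z"
    using fl assms by (intro composable_wrapI[of "{}" X ps Z "{}"]) (simp_all add: flags_def w wrap_def)
  then have ps: "set ps \<subseteq> face_pairs (faces_in (hd \<sigma>))" and Z: "last (X # map snd ps) = Z" by simp_all
  have "X \<in> faces_in (hd \<sigma>)" using fl by (simp add: flags_def)
  moreover have "Z \<in> faces_in (hd \<sigma>)" using flags_last[OF fl] Z by simp
  moreover have "X \<subseteq> Z" using flags_bounded[OF fl] Z by (auto simp: flags_def)
  ultimately have "(X, Z) \<in> face_pairs (faces_in (hd \<sigma>))" by (simp add: face_pairs_def)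
  moreover have "set ps \<subseteq> face_pairs (faces_in (last \<sigma>))"
    using ps face_pairs_mono[OF faces_in_mono[OF le]] by blast
  ultimately show "valid m \<sigma> L"
    using R by (simp add: w valid_wrap) (simp add: wrap_def)
qed

lemma chains_snoc: "\<sigma> \<noteq> [] \<Longrightarrow>
  \<sigma> @ [n] \<in> chains n (length (\<sigma> @ [n]) - 1) \<longleftrightarrow> \<sigma> \<in> chains n (length \<sigma> - 1)"
  by (cases \<sigma>) (auto simp: chains_def sorted_append)

text \<open>Appending \<open>n\<close> changes neither \<open>hd \<sigma>\<close> nor the flag. For
  non-composable lists the direction from left to right can fail, as a larger last complex may admit
  more pairs.\<close>

lemma valid_snoc:
  assumes "composable L" "\<sigma> \<noteq> []"
  shows "valid (Suc m) (\<sigma> @ [n]) L \<longleftrightarrow> valid m \<sigma> L"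
  unfolding valid_composable_iff[OF assms(1)] chains_snoc[OF assms(2)]
  using assms(2) by auto

text \<open>The inserted pair is an admissible argument: \<open>p\<close> is either an argument
  itself or the first end pair, and in the latter case \<open>X\<close> lies in
  \<open>faces_in (hd \<sigma>)\<close>, which is contained in
  \<open>faces_in (last \<sigma>)\<close>.\<close>

lemma valid_insert:
  assumes "valid m \<sigma> (us @ p # p' # vs)"
  shows "valid (Suc m) \<sigma> (us @ p # (snd p, snd p) # p' # vs)"
proof -
  obtain X ps Z where *: "us @ p # p' # vs = wrap X ps Z" "\<sigma> \<in> chains n (length \<sigma> - 1)"
     "(X, Z) \<in> face_pairs (faces_in (hd \<sigma>))" "set ps \<subseteq> face_pairs (faces_in (last \<sigma>))"
     "length \<sigma> + length ps = Suc m"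
    using assms unfolding valid_def by blast
  have le: "hd \<sigma> \<le> last \<sigma>" "last \<sigma> \<le> n"
    using chains_hd_le[OF *(2), of "last \<sigma>"] chains_le[OF *(2)] by auto
  have "\<exists>as bs. ps = as @ bs \<and> us @ [p] = ({}, X) # as \<and> p' # vs = bs @ [(Z, {})]"
  proof (cases us)
    case Nil
    then show ?thesis using *(1) by (simp add: wrap_def)
  next
    case (Cons u us')
    then have u: "u = ({}, X)" "us' @ p # p' # vs = ps @ [(Z, {})]" using *(1) by (simp_all add: wrap_def)
    obtain bs b where "p' # vs = bs @ [b]" by (metis rev_exhaust list.distinct(1))
    then show ?thesis using u Cons by auto
  qed
  then obtain as bs where ab: "ps = as @ bs" "us @ [p] = ({}, X) # as" "p' # vs = bs @ [(Z, {})]" by blast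
  have w: "us @ p # (snd p, snd p) # p' # vs = wrap X (as @ (snd p, snd p) # bs) Z"
    using ab(2,3) by (metis (no_types) Cons_eq_appendI append.assoc append_eq_Cons_conv wrap_def append_Nil)
  have "p = ({}, X) \<or> p \<in> set as"
    using ab(2) by (metis last_in_set last_snoc list.discI set_ConsD)
  then have "snd p \<in> faces_in (last \<sigma>)"
    using *(3,4) ab(1) faces_in_mono[OF le] by (auto simp: face_pairs_def)
  then show ?thesis
    using * ab(1) unfolding w valid_wrap by (auto simp: face_pairs_def)
qed

lemma valid_insertD:
  assumes "valid (Suc m) \<sigma> (us @ p # (snd p, snd p) # p' # vs)"
  shows "valid m \<sigma> (us @ p # p' # vs)"
proof -
  obtain X ps Z where *: "us @ p # (snd p, snd p) # p' # vs = wrap X ps Z" "\<sigma> \<in> chains n (length \<sigma> - 1)"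
     "(X, Z) \<in> face_pairs (faces_in (hd \<sigma>))" "set ps \<subseteq> face_pairs (faces_in (last \<sigma>))"
     "length \<sigma> + length ps = Suc (Suc m)"
    using assms unfolding valid_def by blast
  obtain bs b where vs: "p' # vs = bs @ [b]" by (metis rev_exhaust list.distinct(1))
  have "\<exists>as. us @ p # p' # vs = wrap X (as @ bs) Z \<and> ps = as @ (snd p, snd p) # bs"
    using *(1) vs by (cases us) (auto simp: wrap_def)
  then obtain as where "us @ p # p' # vs = wrap X (as @ bs) Z" "ps = as @ (snd p, snd p) # bs" by blast
  then show ?thesis using * by (simp add: valid_wrap)
qed

text \<open>Hence the homotopy applied to coordinates agrees with the coordinates of a genuine
  cochain one degree lower.\<close>

lemma total_htpy_support:
  assumes G: "\<And>\<tau> M. \<not> valid (Suc m) \<tau> M \<Longrightarrow> G \<tau> M = 0" and "\<sigma> \<noteq> []" "\<not> valid m \<sigma> L"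
  shows "total_htpy n G \<sigma> L = 0"
proof (cases "composable L")
  case True
  then show ?thesis
    using assms valid_snoc[OF True assms(2)] by (simp add: total_htpy_def)
next
  case False
  have "fill_gap (G \<sigma>) L = fill_gap (\<lambda>_. 0) L"
    using valid_insertD assms by (intro fill_gap_cong) blast
  then show ?thesis using False by (simp add: total_htpy_def fill_gap_zero)
qed

text \<open>At a valid index the homotopy reads only valid indices. The differential of a cocycle is
  known to vanish just there, and that is enough.\<close>

lemma total_htpy_vanishes:
  assumes G: "\<And>\<tau> M. valid (Suc m) \<tau> M \<Longrightarrow> G \<tau> M = 0" and L: "valid m \<sigma> L"
  shows "total_htpy n G \<sigma> L = 0"
proof (cases "composable L")
  case True
  have "\<sigma> \<noteq> []" using L chains_le by (auto simp: valid_def)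
  then show ?thesis
    using assms valid_snoc[OF True] True by (simp add: total_htpy_def)
next
  case False
  have "fill_gap (G \<sigma>) L = fill_gap (\<lambda>_. 0) L"
    using valid_insert L G by (intro fill_gap_cong) blast
  then show ?thesis using False by (simp add: total_htpy_def fill_gap_zero)
qed

section \<open>Reduction of cocycles to the nerve of the top face poset\<close>

definition nerve_part :: "nat \<Rightarrow> ('v, 'k::field) gs_cochain \<Rightarrow> 'v set list \<Rightarrow> 'k" where
  "nerve_part m \<Gamma> c = coords m \<Gamma> [n] (path c)"

lemma valid_path:
  "c \<in> flags (Sig n) (Suc m) \<Longrightarrow> valid m [n] (path c)"
  unfolding valid_composable_iff[OF path_simps(3)] path_simps
  by (auto simp: chains_def faces_in_n flags_def)

lemma valid_flag:
  assumes "valid m \<sigma> L" "composable L"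
  shows "map snd (butlast L) \<in> flags (Sig n) (length L - 1)" "path (map snd (butlast L)) = L"
proof -
  have v: "\<sigma> \<in> chains n (length \<sigma> - 1)" "2 \<le> length L" "fst (hd L) = {}" "snd (last L) = {}"
    "map snd (butlast L) \<in> flags (faces_in (hd \<sigma>)) (length L - 1)"
    using assms valid_composable_iff by blast+
  then show "map snd (butlast L) \<in> flags (Sig n) (length L - 1)"
    using flags_mono[OF faces_in_mono, of "hd \<sigma>" n] chains_le[OF v(1)] by (auto simp: faces_in_n)
  show "path (map snd (butlast L)) = L"
    using v by (intro path_map_snd[OF assms(2)]) auto
qed

text \<open>A one-object string has no simplicial term, and on composable lists the Hochschild term
  is the coboundary of the nerve.\<close>

lemma nerve_part_GS_diff:
  assumes "\<Gamma> \<in> GS_cochains n Sig m" "c \<in> flags (Sig n) (Suc (Suc m))"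
  shows "nerve_part (Suc m) (GS_diff n Sig phi m \<Gamma>) c = bd (nerve_part m \<Gamma>) c"
proof -
  have "nerve_part (Suc m) (GS_diff n Sig phi m \<Gamma>) c = hoch (coords m \<Gamma> [n]) (path c)"
    unfolding nerve_part_def coords_GS_diff[OF assms(1) valid_path[OF assms(2)]]
    by (simp add: total_diff_def)
  also have "\<dots> = hoch (\<lambda>M. nerve_part m \<Gamma> (map snd (butlast M))) (path c)"
  proof (rule hoch_cong)
    fix us p p' vs assume L: "path c = us @ p # p' # vs" "snd p = fst p'"
    have "path (map snd (butlast (us @ (fst p, snd p') # vs))) = us @ (fst p, snd p') # vs"
    proof (rule path_map_snd)
      show "composable (us @ (fst p, snd p') # vs)"
        using path_simps(3)[of c] unfolding L(1) composable_join[OF L(2)] .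
      show "fst (hd (us @ (fst p, snd p') # vs)) = {}" "snd (last (us @ (fst p, snd p') # vs)) = {}"
        using path_simps(1,2)[of c] unfolding L(1) ends_join .
    qed simp
    then show "coords m \<Gamma> [n] (us @ (fst p, snd p') # vs)
        = nerve_part m \<Gamma> (map snd (butlast (us @ (fst p, snd p') # vs)))"
      by (simp add: nerve_part_def)
  qed
  also have "\<dots> = bd (nerve_part m \<Gamma>) c"
    using hoch_composable[OF path_simps(3), of "nerve_part m \<Gamma>" c] by (simp add: path_simps)
  finally show ?thesis .
qed

text \<open>\<open>of_coords\<close> forgets \<open>total_incl g\<close> at invalid indices. The
  differential at a valid index reads it only where the index is valid again or
  \<open>total_incl g\<close> is 0 anyway, so \<open>total_diff_incl\<close> survives the
  truncation.\<close>

lemma coords_GS_diff_incl: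
  assumes L: "valid (Suc m) \<sigma> L"
  shows "coords (Suc m) (GS_diff n Sig phi m (of_coords m (total_incl g))) \<sigma> L = total_incl (bd g) \<sigma> L"
proof -
  let ?G = "coords m (of_coords m (total_incl g))"
  have ch: "\<sigma> \<in> chains n (length \<sigma> - 1)" using L by (auto simp: valid_def)
  then have ne: "\<sigma> \<noteq> []" using chains_le by blast
  have G: "?G \<tau> M = total_incl g \<tau> M" if "length \<tau> = 1 \<Longrightarrow> composable M \<Longrightarrow> valid m \<tau> M" for \<tau> M
  proof (cases "valid m \<tau> M")
    case True
    then show ?thesis by (rule coords_of_coords)
  next
    case False
    then show ?thesis using that by (auto simp: coords_def total_incl_def)
  qed
  have "total_diff ?G \<sigma> L = total_diff (total_incl g) \<sigma> L"
  proof (rule total_diff_cong[OF ne])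
    fix us p p' vs assume s: "L = us @ p # p' # vs" "snd p = fst p'"
    let ?M = "us @ (fst p, snd p') # vs"
    show "?G \<sigma> ?M = total_incl g \<sigma> ?M"
    proof (rule G)
      assume 1: "length \<sigma> = 1" and M: "composable ?M"
      then have c: "composable L" using s composable_join by blast
      have v: "2 \<le> length L" "fst (hd L) = {}" "snd (last L) = {}" "length \<sigma> + length L = Suc m + 3"
        "map snd (butlast L) \<in> flags (faces_in (hd \<sigma>)) (length L - 1)"
        using L valid_composable_iff[OF c] by blast+
      have "map snd (butlast ?M) \<in> flags (faces_in (hd \<sigma>)) (length us + length vs)"
        unfolding map_snd_join s(1)[symmetric]
        using v(5) by (intro flags_remove_nth) (simp_all add: s(1))
      then show "valid m \<sigma> ?M"
        unfolding valid_composable_iff[OF M] ends_join s(1)[symmetric]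
        using v ch 1 by (simp add: s(1))
    qed
  next
    fix i assume i: "i < length \<sigma>" "2 \<le> length \<sigma>"
    show "?G (remove_nth i \<sigma>) L = total_incl g (remove_nth i \<sigma>) L"
    proof (rule G)
      assume 1: "length (remove_nth i \<sigma>) = 1" and c: "composable L"
      then have l: "length \<sigma> = 2" using i by (simp add: length_remove_nth)
      have v: "2 \<le> length L" "fst (hd L) = {}" "snd (last L) = {}" "length \<sigma> + length L = Suc m + 3"
        "map snd (butlast L) \<in> flags (faces_in (hd \<sigma>)) (length L - 1)"
        using L valid_composable_iff[OF c] by blast+
      have \<tau>: "remove_nth i \<sigma> \<in> chains n 0"
        using chains_remove_nth[of \<sigma> n 0 i] ch l i by (simp add: numeral_2_eq_2)
      then have "hd (remove_nth i \<sigma>) \<in> set \<sigma>"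
        using chains_le[OF \<tau>] set_remove_nth[of i \<sigma>] hd_in_set[of "remove_nth i \<sigma>"] by blast
      then have "hd \<sigma> \<le> hd (remove_nth i \<sigma>)" "hd (remove_nth i \<sigma>) \<le> n"
        using chains_hd_le[OF ch] by blast+
      then have "map snd (butlast L) \<in> flags (faces_in (hd (remove_nth i \<sigma>))) (length L - 1)"
        using v(5) flags_mono[OF faces_in_mono] by blast
      then show "valid m (remove_nth i \<sigma>) L"
        unfolding valid_composable_iff[OF c] using v \<tau> 1 l by simp
    qed
  qed
  then show ?thesis
    unfolding coords_GS_diff[OF of_coords_cochains L] total_diff_incl[OF ne] .
qed

text \<open>In the homotopy identity the term with \<open>total_diff\<close> inside drops out, so a
  cocycle differs from the inclusion of its nerve part by an explicit coboundary.\<close>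

lemma total_diff_htpy_cocycle:
  assumes \<Gamma>: "\<Gamma> \<in> GS_cochains n Sig m" "GS_diff n Sig phi m \<Gamma> = GS_zero" and L: "valid m \<sigma> L"
  shows "coords m \<Gamma> \<sigma> L = total_diff (total_htpy n (coords m \<Gamma>)) \<sigma> L + total_incl (nerve_part m \<Gamma>) \<sigma> L"
proof -
  have ne: "\<sigma> \<noteq> []" using L chains_le by (auto simp: valid_def)
  have "total_diff (coords m \<Gamma>) \<tau> M = 0" if "valid (Suc m) \<tau> M" for \<tau> M
    using coords_GS_diff[OF \<Gamma>(1) that] \<Gamma>(2) by (simp add: coords_def GS_zero_def ezero_def)
  then have "total_htpy n (total_diff (coords m \<Gamma>)) \<sigma> L = 0"
    by (rule total_htpy_vanishes[OF _ L])
  moreover have "(if length \<sigma> = 1 \<and> composable L then coords m \<Gamma> [n] L else 0)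
      = total_incl (nerve_part m \<Gamma>) \<sigma> L"
    using valid_flag(2)[OF L] by (simp add: total_incl_def nerve_part_def)
  ultimately show ?thesis
    using total_htpy[OF ne, of n "coords m \<Gamma>" L] by simp
qed

lemma GS_zero_cochain: "GS_zero \<in> GS_cochains n Sig m"
  unfolding GS_cochains_def GS_zero_def
  by (auto simp: multilinear_iff multilin_form_zero ezero_def inc_alg_def)

text \<open>In degree 0 nothing is available to bound with, so the homotopy term itself has to
  vanish: it reads only the invalid list \<open>[({}, {})]\<close>.\<close>

lemma GS_cocycle_zero:
  assumes \<Gamma>: "\<Gamma> \<in> GS_cochains n Sig 0" "GS_diff n Sig phi 0 \<Gamma> = GS_zero"
    and g: "\<And>c. c \<in> flags (Sig n) 1 \<Longrightarrow> nerve_part 0 \<Gamma> c = 0"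
  shows "\<Gamma> = GS_zero"
proof (rule GS_cochains_eqI[OF \<Gamma>(1) GS_zero_cochain])
  fix \<sigma> L assume L: "valid 0 \<sigma> L"
  then obtain X ps Z where *: "L = wrap X ps Z" "\<sigma> \<in> chains n (length \<sigma> - 1)" "length \<sigma> + length ps = 1"
    unfolding valid_def by auto
  then have s: "length \<sigma> = 1" "ps = []" using chains_le[OF *(2)] by (cases \<sigma>; simp)+
  have "total_htpy n (coords 0 \<Gamma>) \<sigma> [({}, {})] = 0"
    by (simp add: total_htpy_def coords_def not_valid_singleton)
  then have "total_diff (total_htpy n (coords 0 \<Gamma>)) \<sigma> L = 0"
    using s by (simp add: total_diff_def *(1) hoch_wrap_Nil)
  moreover have "total_incl (nerve_part 0 \<Gamma>) \<sigma> L = 0"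
    using valid_flag(1)[OF L] g s by (simp add: total_incl_def *(1) wrap_def)
  ultimately show "coords 0 \<Gamma> \<sigma> L = coords 0 GS_zero \<sigma> L"
    using total_diff_htpy_cocycle[OF \<Gamma> L] by (simp add: coords_def GS_zero_def ezero_def)
qed

text \<open>The primitive is the homotopy of the cocycle plus the inclusion of the given primitive
  \<open>w\<close> of its nerve part.\<close>

lemma GS_cocycle_coboundary:
  assumes \<Gamma>: "\<Gamma> \<in> GS_cochains n Sig (Suc m)" "GS_diff n Sig phi (Suc m) \<Gamma> = GS_zero"
    and g: "\<And>c. c \<in> flags (Sig n) (Suc (Suc m)) \<Longrightarrow> nerve_part (Suc m) \<Gamma> c = bd w c"
  shows "\<Gamma> \<in> GS_diff n Sig phi m ` GS_cochains n Sig m"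
proof -
  let ?T = "total_htpy n (coords (Suc m) \<Gamma>)"
  let ?F = "\<lambda>\<sigma> L. ?T \<sigma> L + total_incl w \<sigma> L"
  have "\<Gamma> = GS_diff n Sig phi m (of_coords m ?F)"
  proof (rule GS_cochains_eqI[OF \<Gamma>(1) GS_diff_cochains[OF of_coords_cochains]])
    fix \<sigma> L assume L: "valid (Suc m) \<sigma> L"
    have ne: "\<sigma> \<noteq> []" using L chains_le by (auto simp: valid_def)
    have T: "?T \<tau> M = 0" if "\<tau> \<noteq> []" "\<not> valid m \<tau> M" for \<tau> M
      using that by (intro total_htpy_support[where m = m]) (simp_all add: coords_def)
    have F: "coords m (of_coords m ?F) \<tau> M = ?T \<tau> M + coords m (of_coords m (total_incl w)) \<tau> M"
      if "\<tau> \<noteq> []" for \<tau> M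
    proof (cases "valid m \<tau> M")
      case True
      then show ?thesis by (simp add: coords_of_coords)
    next
      case False
      then show ?thesis using T[OF that False] by (simp add: coords_def)
    qed
    have "total_diff (coords m (of_coords m ?F)) \<sigma> L
        = total_diff (\<lambda>\<tau> M. ?T \<tau> M + coords m (of_coords m (total_incl w)) \<tau> M) \<sigma> L"
    proof (rule total_diff_cong[OF ne])
      fix i assume "i < length \<sigma>" "2 \<le> length \<sigma>"
      then have "remove_nth i \<sigma> \<noteq> []" using length_remove_nth[of i \<sigma>] by auto
      then show "coords m (of_coords m ?F) (remove_nth i \<sigma>) L
          = ?T (remove_nth i \<sigma>) L + coords m (of_coords m (total_incl w)) (remove_nth i \<sigma>) L"
        by (rule F)
    qed (rule F[OF ne])
    also have "\<dots> = total_diff ?T \<sigma> L + total_incl (bd w) \<sigma> L"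
      unfolding total_diff_add coords_GS_diff[OF of_coords_cochains L, symmetric]
        coords_GS_diff_incl[OF L] ..
    also have "total_incl (bd w) \<sigma> L = total_incl (nerve_part (Suc m) \<Gamma>) \<sigma> L"
    proof (cases "length \<sigma> = 1 \<and> composable L")
      case True
      have "length L = m + 3" using L True valid_composable_iff by simp
      then show ?thesis using True g valid_flag(1)[OF L] by (simp add: total_incl_def numeral_3_eq_3)
    next
      case False
      then show ?thesis by (auto simp: total_incl_def)
    qed
    finally show "coords (Suc m) \<Gamma> \<sigma> L = coords (Suc m) (GS_diff n Sig phi m (of_coords m ?F)) \<sigma> L"
      unfolding coords_GS_diff[OF of_coords_cochains L] total_diff_htpy_cocycle[OF \<Gamma> L] by simp
  qed
  then show ?thesis using of_coords_cochains by blast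
qed

end

section \<open>The comparison with simplicial cochains\<close>

lemma set_remove_nth_distinct:
  "distinct ms \<Longrightarrow> i < length ms \<Longrightarrow> set (remove_nth i ms) = set ms - {ms ! i}"
proof -
  assume *: "distinct ms" "i < length ms"
  obtain us a vs where "ms = us @ a # vs" "length us = i"
    using id_take_nth_drop[OF *(2)] *(2) by (metis length_take min.absorb4)
  then show ?thesis using * by (auto simp: remove_nth_split)
qed

lemma simp_diff_eq_bd:
  assumes "sorted ms" "distinct ms" "length ms = Suc (Suc q)" "set ms \<in> S"
  shows "simp_diff S q u (set ms) = bd (\<lambda>c. u (set c)) ms"
proof -
  have "sorted_list_of_set (set ms) = ms"
    using assms(1,2) by (rule sorted_list_of_set.idem_if_sorted_distinct)
  moreover have "(\<Sum>i<Suc (Suc q). (-1) ^ i * u (set ms - {ms ! i})) = bd (\<lambda>c. u (set c)) ms"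
    unfolding bd_def assms(3)
    by (rule sum.cong) (simp_all add: set_remove_nth_distinct[OF assms(2)] assms(3))
  ultimately show ?thesis
    using assms by (simp add: simp_diff_def distinct_card del: sum.lessThan_Suc)
qed

locale ordered_filtered_complex = filtered_complex n Sig phi
  for n :: nat and Sig :: "nat \<Rightarrow> 'v::linorder set set" and phi
begin

lemma top_face: "x \<in> Sig n \<Longrightarrow> finite x \<and> x \<noteq> {}"
  by (rule face_finite) simp_all

lemma top_subset: "x \<in> Sig n \<Longrightarrow> t \<subseteq> x \<Longrightarrow> t \<noteq> {} \<Longrightarrow> t \<in> Sig n"
  by (rule face_subset) simp_all

lemma map_Max_flag:
  assumes c: "c \<in> flags (Sig n) (Suc q)" and "distinct (map Max c)"
  shows "sorted (map Max c)" "set (map Max c) \<in> Sig n" "card (set (map Max c)) = Suc q"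
proof -
  show "sorted (map Max c)" by (rule sorted_map_Max[OF c top_face])
  show "card (set (map Max c)) = Suc q"
    using assms by (simp only: distinct_card length_map) (simp add: flags_def)
  have "set (map Max c) \<subseteq> last c"
  proof
    fix v assume "v \<in> set (map Max c)"
    then obtain x where x: "x \<in> set c" "v = Max x" by auto
    then have "x \<in> Sig n" "x \<subseteq> last c" using flags_bounded[OF c] by (auto simp: flags_def)
    then show "v \<in> last c" using Max_in[of x] top_face[of x] x(2) by blast
  qed
  moreover have "set (map Max c) \<noteq> {}" using c by (auto simp: flags_def)
  ultimately show "set (map Max c) \<in> Sig n" by (rule top_subset[OF flags_last[OF c]])
qed

definition to_simplicial :: "nat \<Rightarrow> ('v, 'k::field) gs_cochain \<Rightarrow> 'v set \<Rightarrow> 'k" where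
  "to_simplicial m \<Gamma> x = (if x \<in> Sig n \<and> card x = Suc m
     then subdiv (Suc m) (nerve_part m \<Gamma>) (sorted_list_of_set x) else 0)"

lemma to_simplicial_cochain: "to_simplicial m \<Gamma> \<in> simp_cochains (Sig n) m"
  by (simp add: simp_cochains_def to_simplicial_def)

lemma to_simplicial_set:
  assumes "sorted ms" "distinct ms" "length ms = Suc m" "set ms \<in> Sig n"
  shows "to_simplicial m \<Gamma> (set ms) = subdiv (Suc m) (nerve_part m \<Gamma>) ms"
  using assms sorted_list_of_set.idem_if_sorted_distinct[OF assms(1,2)]
  by (simp add: to_simplicial_def distinct_card del: subdiv.simps)

lemma face_list:
  assumes "x \<in> Sig n" "card x = l"
  obtains ms where "sorted ms" "distinct ms" "length ms = l" "set ms = x"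
  using assms top_face that[of "sorted_list_of_set x"] by simp

lemma subdiv_top_cong:
  assumes "length ms = q" "ms \<noteq> []" "set ms \<in> Sig n"
    and "\<And>c. c \<in> flags (Sig n) q \<Longrightarrow> f c = g c"
  shows "subdiv q f ms = subdiv q g ms"
proof (rule subdiv_cong[where S = "Sig n"])
  show "t \<in> Sig n" if "t \<subseteq> set ms" "t \<noteq> {}" for t
    using that assms(3) by (rule top_subset[rotated])
  show "f c = g c" if "c \<in> flags {y \<in> Sig n. y \<subseteq> set ms} q" for c
    using that flags_mono[of "{y \<in> Sig n. y \<subseteq> set ms}" "Sig n"] assms(4) by blast
qed (rule assms(1))

text \<open>Restriction to the nerve and subdivision both commute with the differentials, and on
  sorted vertex lists \<open>bd\<close> is the ordered simplicial coboundary.\<close>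

lemma to_simplicial_diff:
  assumes "\<Gamma> \<in> GS_cochains n Sig m"
  shows "to_simplicial (Suc m) (GS_diff n Sig phi m \<Gamma>) = simp_diff (Sig n) m (to_simplicial m \<Gamma>)"
proof
  fix x
  show "to_simplicial (Suc m) (GS_diff n Sig phi m \<Gamma>) x = simp_diff (Sig n) m (to_simplicial m \<Gamma>) x"
  proof (cases "x \<in> Sig n \<and> card x = Suc (Suc m)")
    case True
    then obtain ms where ms: "sorted ms" "distinct ms" "length ms = Suc (Suc m)" "set ms = x"
      using face_list by metis
    have "ms \<noteq> []" using ms(3) by auto
    have "to_simplicial (Suc m) (GS_diff n Sig phi m \<Gamma>) x
        = subdiv (Suc (Suc m)) (nerve_part (Suc m) (GS_diff n Sig phi m \<Gamma>)) ms"
      using to_simplicial_set[OF ms(1-3)] ms(4) True by simp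
    also have "\<dots> = subdiv (Suc (Suc m)) (bd (nerve_part m \<Gamma>)) ms"
      using ms True nerve_part_GS_diff[OF assms] \<open>ms \<noteq> []\<close> by (intro subdiv_top_cong) auto
    also have "\<dots> = bd (subdiv (Suc m) (nerve_part m \<Gamma>)) ms"
      by (rule subdiv_bd[OF ms(3)])
    also have "\<dots> = bd (\<lambda>c. to_simplicial m \<Gamma> (set c)) ms"
    proof (rule bd_cong)
      fix i assume i: "i < length ms"
      have l: "length (remove_nth i ms) = Suc m" using i ms(3) by (simp add: length_remove_nth)
      then have "set (remove_nth i ms) \<noteq> {}" by (metis length_0_conv nat.distinct(1) set_empty)
      then have "set (remove_nth i ms) \<in> Sig n"
        using top_subset[of x "set (remove_nth i ms)"] set_remove_nth[of i ms] True ms(4) by blast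
      then show "subdiv (Suc m) (nerve_part m \<Gamma>) (remove_nth i ms) = to_simplicial m \<Gamma> (set (remove_nth i ms))"
        using to_simplicial_set[OF sorted_wrt_remove_nth[OF ms(1)] distinct_remove_nth[OF ms(2)] l] by metis
    qed
    also have "\<dots> = simp_diff (Sig n) m (to_simplicial m \<Gamma>) (set ms)"
      using simp_diff_eq_bd[OF ms(1-3)] ms(4) True by metis
    finally show ?thesis using ms(4) by simp
  next
    case False
    then show ?thesis by (simp only: to_simplicial_def simp_diff_def if_False)
  qed
qed

lemma coords_zero: "coords m GS_zero \<sigma> L = 0"
  by (simp add: coords_def GS_zero_def ezero_def)

lemma to_simplicial_zero: "to_simplicial m GS_zero = (\<lambda>_. 0 :: 'k::field)"
proof -
  have "nerve_part m GS_zero = (\<lambda>_. 0 :: 'k)"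
    by (simp add: nerve_part_def coords_zero fun_eq_iff)
  then show ?thesis
    by (intro ext) (simp add: to_simplicial_def subdiv_zero del: subdiv.simps)
qed

lemma to_simplicial_add: "to_simplicial m (GS_add \<Gamma> \<Delta>) = fadd (to_simplicial m \<Gamma>) (to_simplicial m \<Delta>)"
proof -
  have "nerve_part m (GS_add \<Gamma> \<Delta>) = (\<lambda>c. nerve_part m \<Gamma> c + nerve_part m \<Delta> c)"
    by (simp add: nerve_part_def coords_def GS_add_def eadd_def fun_eq_iff)
  then show ?thesis
    by (intro ext) (simp add: to_simplicial_def fadd_def subdiv_add del: subdiv.simps)
qed

lemma to_simplicial_scale: "to_simplicial m (GS_scale a \<Gamma>) = fscale a (to_simplicial m \<Gamma>)"
proof -
  have "nerve_part m (GS_scale a \<Gamma>) = (\<lambda>c. a * nerve_part m \<Gamma> c)"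
    by (simp add: nerve_part_def coords_def GS_scale_def escale_def fun_eq_iff)
  then show ?thesis
    by (intro ext) (simp add: to_simplicial_def fscale_def subdiv_mult del: subdiv.simps)
qed

lemma last_vertex_subdiv_nerve_part:
  assumes "c \<in> flags (Sig n) (Suc q)"
  shows "last_vertex (subdiv (Suc q) (nerve_part q \<Gamma>)) c = last_vertex (\<lambda>ms. to_simplicial q \<Gamma> (set ms)) c"
proof (cases "distinct (map Max c)")
  case True
  have "length (map Max c) = Suc q" using assms by (simp add: flags_def)
  from to_simplicial_set[OF map_Max_flag(1)[OF assms True] True this map_Max_flag(2)[OF assms True], of \<Gamma>]
  show ?thesis by (simp add: last_vertex_def del: subdiv.simps)
qed (simp add: last_vertex_def)

text \<open>The homotopy identity for \<open>cone_htpy\<close>; its other term reads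
  \<open>bd (nerve_part q \<Gamma>)\<close> at flags of \<open>Sig n\<close> only, where it is
  0.\<close>

lemma nerve_part_cocycle:
  assumes \<Gamma>: "\<Gamma> \<in> GS_cocycles n Sig phi q" and c: "c \<in> flags (Sig n) (Suc q)"
  shows "nerve_part q \<Gamma> c
    = last_vertex (\<lambda>ms. to_simplicial q \<Gamma> (set ms)) c + bd (cone_htpy q (nerve_part q \<Gamma>)) c"
proof -
  have \<Gamma>': "\<Gamma> \<in> GS_cochains n Sig q" "GS_diff n Sig phi q \<Gamma> = GS_zero"
    using \<Gamma> by (simp_all add: GS_cocycles_def)
  have "bd (nerve_part q \<Gamma>) d = 0" if "d \<in> flags (Sig n) (Suc (Suc q))" for d
    using nerve_part_GS_diff[OF \<Gamma>'(1) that] by (simp add: \<Gamma>'(2) nerve_part_def coords_zero)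
  then have "cone_htpy (Suc q) (bd (nerve_part q \<Gamma>)) c = 0"
    by (intro cone_htpy_zero[OF c top_subset top_face])
  then show ?thesis
    using cone_htpy[OF c top_face, of "nerve_part q \<Gamma>"]
    by (simp add: sd_defect_def last_vertex_subdiv_nerve_part[OF c] del: cone_htpy.simps subdiv.simps)
qed

lemma to_simplicial_reflects_coboundaries:
  assumes \<Gamma>: "\<Gamma> \<in> GS_cocycles n Sig phi q"
    and B: "to_simplicial q \<Gamma> \<in> simp_coboundaries (Sig n) q"
  shows "\<Gamma> \<in> GS_coboundaries n Sig phi q"
proof (cases q)
  case 0
  have \<Gamma>': "\<Gamma> \<in> GS_cochains n Sig 0" "GS_diff n Sig phi 0 \<Gamma> = GS_zero"
    using \<Gamma> by (simp_all add: GS_cocycles_def 0)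
  have "to_simplicial q \<Gamma> = (\<lambda>_. 0)"
    using B by (simp add: simp_coboundaries_def 0)
  then have "nerve_part 0 \<Gamma> c = 0" if "c \<in> flags (Sig n) 1" for c
    \<comment> \<open>Both summands vanish: the first because the simplicial image is 0, the second
      because \<open>cone_htpy 0\<close> is 0.\<close>
    using nerve_part_cocycle[OF \<Gamma>, of c] that by (simp add: 0 last_vertex_def bd_def)
  then show ?thesis
    using GS_cocycle_zero[OF \<Gamma>'] by (simp add: GS_coboundaries_def 0)
next
  case (Suc m)
  have \<Gamma>': "\<Gamma> \<in> GS_cochains n Sig (Suc m)" "GS_diff n Sig phi (Suc m) \<Gamma> = GS_zero"
    using \<Gamma> by (simp_all add: GS_cocycles_def Suc)
  obtain u where u: "to_simplicial q \<Gamma> = simp_diff (Sig n) m u"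
    using B by (auto simp: simp_coboundaries_def Suc)
  define U where "U = (\<lambda>ms. u (set ms))"
  \<comment> \<open>Both summands of \<open>nerve_part_cocycle\<close> become coboundaries: the
    first because the last vertex map carries the primitive \<open>u\<close> along, the second as it
    stands.\<close>
  define w where "w = (\<lambda>c. last_vertex U c + cone_htpy q (nerve_part q \<Gamma>) c)"
  have "nerve_part (Suc m) \<Gamma> c = bd w c" if c: "c \<in> flags (Sig n) (Suc (Suc m))" for c
  proof -
    have "last_vertex (\<lambda>ms. to_simplicial q \<Gamma> (set ms)) c = last_vertex (bd U) c"
    proof (cases "distinct (map Max c)")
      case True
      have "length (map Max c) = Suc (Suc m)" using c by (simp add: flags_def)
      from simp_diff_eq_bd[OF map_Max_flag(1)[OF c True] True this map_Max_flag(2)[OF c True], of u]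
      show ?thesis by (simp add: last_vertex_def u U_def)
    qed (simp add: last_vertex_def)
    also have "\<dots> = bd (last_vertex U) c"
      by (rule last_vertex_bd[OF c top_face, symmetric])
    finally have *: "last_vertex (\<lambda>ms. to_simplicial q \<Gamma> (set ms)) c = bd (last_vertex U) c" .
    show ?thesis
      using nerve_part_cocycle[OF \<Gamma>, of c] c
      unfolding w_def bd_add * Suc[symmetric] by simp
  qed
  from GS_cocycle_coboundary[OF \<Gamma>' this] show ?thesis
    by (simp add: GS_coboundaries_def Suc)
qed

text \<open>The preimage is the last vertex pullback of \<open>z\<close>, included in the total
  complex. It is hit exactly, not just up to a coboundary, because \<open>subdiv_Max\<close> is an
  equality of cochains.\<close>

lemma to_simplicial_onto_cocycles:
  assumes z: "z \<in> simp_cocycles (Sig n) q"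
  obtains \<Gamma> where "\<Gamma> \<in> GS_cocycles n Sig phi q" "to_simplicial q \<Gamma> = z"
proof -
  define U where "U = (\<lambda>ms. z (set ms))"
  \<comment> \<open>\<open>?F\<close> cuts \<open>U\<close> off at lists with repetitions, as
    \<open>subdiv_Max\<close> requires; composed with \<open>map Max\<close> it is
    \<open>?g\<close>.\<close>
  let ?g = "last_vertex U" and ?F = "\<lambda>ms. if distinct ms then U ms else 0"
  let ?\<Gamma> = "of_coords q (total_incl ?g)"
  have zc: "z \<in> simp_cochains (Sig n) q" and zd: "simp_diff (Sig n) q z = (\<lambda>_. 0)"
    using z by (simp_all add: simp_cocycles_def)
  have bd0: "bd ?g c = 0" if c: "c \<in> flags (Sig n) (Suc (Suc q))" for c
  proof -
    have "last_vertex (bd U) c = 0"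
    proof (cases "distinct (map Max c)")
      case True
      have "length (map Max c) = Suc (Suc q)" using c by (simp add: flags_def)
      from simp_diff_eq_bd[OF map_Max_flag(1)[OF c True] True this map_Max_flag(2)[OF c True], of z]
      show ?thesis by (simp add: last_vertex_def zd U_def)
    qed (simp add: last_vertex_def)
    then show ?thesis using last_vertex_bd[OF c top_face, of U] by simp
  qed
  have "GS_diff n Sig phi q ?\<Gamma> = GS_zero"
  proof (rule GS_cochains_eqI[OF GS_diff_cochains[OF of_coords_cochains] GS_zero_cochain])
    fix \<sigma> L assume L: "valid (Suc q) \<sigma> L"
    have "total_incl (bd ?g) \<sigma> L = 0"
    proof (cases "length \<sigma> = 1 \<and> composable L")
      case True
      have "length L = q + 3" using L True valid_composable_iff by simp
      then show ?thesis
        using True bd0 valid_flag(1)[OF L] by (simp add: total_incl_def numeral_3_eq_3)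
    next
      case False
      then show ?thesis by (auto simp: total_incl_def)
    qed
    then show "coords (Suc q) (GS_diff n Sig phi q ?\<Gamma>) \<sigma> L = coords (Suc q) GS_zero \<sigma> L"
      unfolding coords_GS_diff_incl[OF L] coords_zero .
  qed
  then have "?\<Gamma> \<in> GS_cocycles n Sig phi q"
    by (simp add: GS_cocycles_def of_coords_cochains)
  moreover have "to_simplicial q ?\<Gamma> = z"
  proof
    fix x
    show "to_simplicial q ?\<Gamma> x = z x"
    proof (cases "x \<in> Sig n \<and> card x = Suc q")
      case True
      then obtain ms where ms: "sorted ms" "distinct ms" "length ms = Suc q" "set ms = x"
        using face_list by metis
      have "ms \<noteq> []" using ms(3) by auto
      have "to_simplicial q ?\<Gamma> x = subdiv (Suc q) (nerve_part q ?\<Gamma>) ms"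
        using to_simplicial_set[OF ms(1-3)] ms(4) True by simp
      also have "\<dots> = subdiv (Suc q) (\<lambda>c. ?F (map Max c @ [])) ms"
      proof (rule subdiv_top_cong[OF ms(3) \<open>ms \<noteq> []\<close>])
        fix c assume c: "c \<in> flags (Sig n) (Suc q)"
        show "nerve_part q ?\<Gamma> c = ?F (map Max c @ [])"
          unfolding nerve_part_def coords_of_coords[OF valid_path[OF c]]
          by (simp add: total_incl_def path_simps last_vertex_def)
      qed (use ms(4) True in simp)
      also have "\<dots> = ?F (ms @ [])"
        by (rule subdiv_Max[OF ms(3,1,2)]) simp
      finally show ?thesis using ms by (simp add: U_def)
    next
      case False
      then have "z x = 0" using zc by (auto simp: simp_cochains_def)
      then show ?thesis using False by (simp only: to_simplicial_def if_False)
    qed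
  qed
  ultimately show thesis by (rule that)
qed

lemma to_simplicial_coboundary:
  assumes "\<Gamma> \<in> GS_coboundaries n Sig phi q"
  shows "to_simplicial q \<Gamma> \<in> simp_coboundaries (Sig n) q"
proof (cases q)
  case 0
  then show ?thesis
    using assms by (simp add: GS_coboundaries_def simp_coboundaries_def to_simplicial_zero)
next
  case (Suc m)
  then obtain \<Delta> where "\<Delta> \<in> GS_cochains n Sig m" "\<Gamma> = GS_diff n Sig phi m \<Delta>"
    using assms by (auto simp: GS_coboundaries_def)
  then show ?thesis
    by (simp add: simp_coboundaries_def Suc to_simplicial_diff to_simplicial_cochain)
qed

lemma to_simplicial_cocycle:
  assumes "\<Gamma> \<in> GS_cocycles n Sig phi q"
  shows "to_simplicial q \<Gamma> \<in> simp_cocycles (Sig n) q"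
  using assms to_simplicial_diff[of \<Gamma> q]
  by (simp add: GS_cocycles_def simp_cocycles_def to_simplicial_cochain to_simplicial_zero)

lemma zero_simp_coboundary: "(\<lambda>_. 0 :: 'k::field) \<in> simp_coboundaries (Sig n) q"
proof (cases q)
  case (Suc m)
  have "(\<lambda>_. 0 :: 'k) = simp_diff (Sig n) m (\<lambda>_. 0)" by (simp add: simp_diff_def fun_eq_iff)
  moreover have "(\<lambda>_. 0 :: 'k) \<in> simp_cochains (Sig n) m" by (simp add: simp_cochains_def)
  ultimately have "(\<lambda>_. 0 :: 'k) \<in> simp_diff (Sig n) m ` simp_cochains (Sig n) m" by (rule image_eqI)
  then show ?thesis by (simp add: simp_coboundaries_def Suc)
qed (simp add: simp_coboundaries_def)

end

theorem theorem5p10: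
  fixes n :: nat and Sig :: "nat \<Rightarrow> 'v::linorder set set" and phi :: "nat \<Rightarrow> nat \<Rightarrow> 'v \<Rightarrow> 'v"
    and q :: nat
  assumes "filtration n Sig phi"
  shows "cohom_iso
           (GS_cocycles n Sig phi q :: ('v, 'k::field) gs_cochain set) (GS_coboundaries n Sig phi q)
           GS_add GS_scale
           (simp_cocycles (Sig n) q :: ('v set \<Rightarrow> 'k) set) (simp_coboundaries (Sig n) q)
           fadd fscale"
proof -
  interpret ordered_filtered_complex n Sig phi
    by unfold_locales (rule assms)
  \<comment> \<open>Surjectivity is asked for modulo coboundaries only; with an exact preimage the
    difference is the zero cochain.\<close>
  have "\<exists>\<Gamma>\<in>GS_cocycles n Sig phi q. fadd z (fscale (-1) (to_simplicial q \<Gamma>)) \<in> simp_coboundaries (Sig n) q"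
    if z: "z \<in> simp_cocycles (Sig n) q" for z :: "'v set \<Rightarrow> 'k"
  proof -
    obtain \<Gamma> where \<Gamma>: "\<Gamma> \<in> GS_cocycles n Sig phi q" "to_simplicial q \<Gamma> = z"
      by (rule to_simplicial_onto_cocycles[OF z])
    have "fadd z (fscale (-1) (to_simplicial q \<Gamma>)) = (\<lambda>_. 0)"
      by (simp add: \<Gamma>(2) fadd_def fscale_def)
    then show ?thesis using \<Gamma>(1) zero_simp_coboundary by metis
  qed
  then show ?thesis
    unfolding cohom_iso_def
    by (intro exI[of _ "to_simplicial q"] conjI ballI allI impI image_subsetI)
      (simp_all add: to_simplicial_add to_simplicial_scale to_simplicial_cocycle to_simplicial_coboundary
        to_simplicial_reflects_coboundaries)
qed

end
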